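(* Let $\alpha$ be a real number with $0\le\alpha<1/2$. Then the equality $$\int_{0}^{\infty}\frac{\ln\bigl|\zeta(1/2+\alpha+it)\,(-1/2+\alpha+it)\bigr|}{\bigl((1/2-\alpha)^2+t^2\bigr)^{3/2}}\,dt=-\int_{1}^{\infty}\frac{\ln\bigl(\zeta(\sigma)(\sigma-1)\bigr)}{(\sigma-1)^{3/2}(\sigma-2\alpha)^{3/2}}\,d\sigma$$ holds if and only if the Riemann zeta function $\zeta$ has no zeros $\sigma+it$ with $\sigma>1/2+\alpha$. In particular, for $\alpha=0$ this equality is equivalent to the Riemann hypothesis.
   Context: $\zeta$ denotes the Riemann zeta function; for real $\sigma>1$, $\zeta(\sigma)(\sigma-1)>0$ and $\ln$ is the real logarithm. The Riemann hypothesis is the statement that $\zeta$ has no zeros with real part $>1/2$. *)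

theory Defs
  imports "HOL-Complex_Analysis.Complex_Analysis"
begin

text \<open>The Riemann zeta function: the unique function that is holomorphic on
  the complex plane minus the pole 1 and agrees with the Dirichlet series
  sum over n >= 1 of n powr (-s) on the half-plane Re s > 1.  The value at the
  pole s = 1 is irrelevant and fixed to 0 only to make the function unique.\<close>

definition riemann_zeta :: "complex \<Rightarrow> complex" where
  "riemann_zeta = (THE f. f holomorphic_on (- {1}) \<and>
      (\<forall>s. 1 < Re s \<longrightarrow> (\<lambda>n. inverse (of_nat (Suc n) powr s)) sums f s) \<and>
      f 1 = 0)"

end

theory Submission
  imports Defs
begin

text \<open>
  Put \<open>a = 1/2 - \<alpha>\<close> and \<open>g(s) = (s - 1) \<zeta>(s)\<close>, an entire function with \<open>g(1) = 1\<close>, and transport it to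
  the unit disc as \<open>f(z) = g(1 + 2az/(1 - z))\<close>. The substitutions \<open>t = a cot p\<close> and
  \<open>\<sigma> = 1 + 2ay\<^sup>2/(1 - y\<^sup>2)\<close> turn \<open>4a\<^sup>2\<close> times the difference of the two sides of the claimed equality into
  the integral of \<open>ln |f(e\<^bsup>2ip\<^esup>)| 2 sin p\<close> over \<open>0 < p < \<pi>\<close> plus twice the integral of
  \<open>ln f(y\<^sup>2) (1 - y\<^sup>2)/y\<^sup>2\<close> over \<open>0 < y < 1\<close>.

  For a function without zeros in a neighbourhood of the closed disc and with \<open>f(0) = 1\<close> this sum vanishes:
  it is the real part of the integral of \<open>log f(y\<^sup>2) (1 - y\<^sup>2)/y\<^sup>2\<close> along the boundary of the upper half
  disc. A Blaschke factor with zero \<open>\<rho>\<close> contributes \<open>2\<pi> Re (1/s - s) > 0\<close>, where \<open>s\<^sup>2 = -\<rho>\<close> and \<open>Re s > 0\<close>.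
  So on every circle of radius \<open>r < 1\<close> the sum is a sum of positive contributions of the zeros, as in
  Jensen's formula. The limit \<open>r \<rightarrow> 1\<close> is harmless at \<open>z = 1\<close>, because Jensen's inequality bounds the
  integrals of \<open>|ln |f||\<close> and the weight \<open>sin p\<close> vanishes there, and on the rest of the circle because
  \<open>f\<close> is holomorphic across it.
\<close>

section \<open>Analytic continuation of the zeta function\<close>

text \<open>The coordinate y with z = y^2 is natural because the weight (1 - y^2)/y^2 has the
  primitive -(y + 1/y), which is real both on the real axis and on the unit circle. The diameter of
  the half disc covers the slit [0, 1) of the z-disc twice, hence the factor 2; points of the slit
  correspond to real arguments >= 1, where g > 0, so log f has no singularity there. If w = i*s is
  the square root of a zero in the upper half disc, the primitive has the value i*(1/s - s) at w,
  and the branching of the logarithm at w turns this into 2 pi Re (1/s - s). This quantity is 0 for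
  |s| = 1, so zeros on the line Re = 1/2 + \<alpha> itself do not count. They are nevertheless the
  obstacle: they lie on the path of integration and may accumulate at z = 1, so the formula cannot
  be applied on the unit circle, and no integrable bound for ln |f| near z = 1 is at hand. Two facts
  about the sum K survive the limit: K = 0 without zeros, and K is at least the weight of each zero.
  As all weights are positive, no exact formula for K is needed.\<close>

definition zeta_remainder :: "nat \<Rightarrow> nat \<Rightarrow> complex \<Rightarrow> complex" where
  "zeta_remainder k n s = of_nat (Suc (Suc n)) powr (1 - s) -
     (\<Sum>j\<le>k. ((1 - s) gchoose j) * of_nat (Suc n) powr (1 - s - of_nat j))"

text \<open>Taylor's theorem on the real segment from N = n + 1 to N + 1. The derivative of order k
  + 1 has modulus const * t^(-Re s - k), largest at t = N because Re s >= -k. The bound of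
  \<open>complex_Taylor\<close> divides by k! only, which leaves the factor k + 1. The result is
  summable over n for Re s > 1 - k: each further Taylor term moves the domain of convergence one
  unit to the left.\<close>

lemma norm_zeta_remainder_le:
  assumes "- real k \<le> Re s"
  shows "norm (zeta_remainder k n s)
      \<le> real (Suc k) * norm ((1 - s) gchoose Suc k) * real (Suc n) powr (- Re s - real k)"
proof -
  define c where "c = 1 - s"
  define w :: complex where "w = of_nat (Suc n)"
  define z :: complex where "z = of_nat (Suc (Suc n))"
  define S where "S = closed_segment w z"
  \<comment> \<open>\<open>f i\<close> is the derivative of order i of x powr c, since i! times the
    binomial coefficient is the falling factorial of c.\<close>
  define f where "f = (\<lambda>i x. fact i * (c gchoose i) * x powr (c - of_nat i))"
  define B where "B = fact (Suc k) * norm (c gchoose Suc k) * real (Suc n) powr (- Re s - real k)"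
  have S: "\<exists>t. x = of_real t \<and> real (Suc n) \<le> t" if x: "x \<in> S" for x
  proof -
    obtain u where u: "0 \<le> u" "x = (1 - u) *\<^sub>R w + u *\<^sub>R z"
      using x by (auto simp: S_def in_segment)
    have "x = of_real (real (Suc n) + u)"
      unfolding u(2) w_def z_def by (simp add: scaleR_conv_of_real algebra_simps)
    then show ?thesis using u(1) by (intro exI[of _ "real (Suc n) + u"] conjI) auto
  qed
  have "norm (f 0 z - (\<Sum>i\<le>k. f i w * (z - w) ^ i / fact i)) \<le> B * norm (z - w) ^ Suc k / fact k"
  proof (rule complex_Taylor)
    show "convex S" by (simp add: S_def)
    show "w \<in> S" "z \<in> S" by (simp_all add: S_def)
  next
    fix i x assume "x \<in> S" "i \<le> k"
    then obtain t where t: "x = of_real t" "real (Suc n) \<le> t" using S by blast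
    then have "x \<notin> \<real>\<^sub>\<le>\<^sub>0" by (auto simp: complex_nonpos_Reals_iff)
    moreover have eq: "fact i * (c gchoose i) * (c - of_nat i) = fact (Suc i) * (c gchoose Suc i)"
      by (simp only: gbinomial_mult_fact prod.atLeast0_lessThan_Suc)
    moreover have "((\<lambda>x. fact i * (c gchoose i) * x powr (c - of_nat i)) has_field_derivative
        fact i * (c gchoose i) * ((c - of_nat i) * x powr (c - of_nat i - 1))) (at x within S)"
      using calculation(1)
      by (intro DERIV_cmult has_field_derivative_at_within[OF has_field_derivative_powr])
    ultimately show "(f i has_field_derivative f (Suc i) x) (at x within S)"
      unfolding f_def eq[symmetric] of_nat_Suc by (simp only: mult.assoc diff_diff_eq add.commute)
  next
    fix x assume "x \<in> S"
    then obtain t where t: "x = of_real t" "real (Suc n) \<le> t" using S by blast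
    then have "norm (x powr (c - of_nat (Suc k))) = t powr (- Re s - real k)"
      by (auto simp: norm_powr_real_powr c_def)
    also have "\<dots> \<le> real (Suc n) powr (- Re s - real k)"
      using t assms by (intro powr_mono2') auto
    finally show "norm (f (Suc k) x) \<le> B"
      unfolding f_def B_def by (simp only: norm_mult norm_fact) (intro mult_left_mono, auto)
  qed
  also have "f 0 z - (\<Sum>i\<le>k. f i w * (z - w) ^ i / fact i) = zeta_remainder k n s"
    by (simp add: f_def zeta_remainder_def c_def w_def z_def)
  also have "B * norm (z - w) ^ Suc k / fact k =
      real (Suc k) * norm ((1 - s) gchoose Suc k) * real (Suc n) powr (- Re s - real k)"
    by (simp add: B_def c_def w_def z_def)
  finally show ?thesis .
qed

lemma summable_Suc_powr:
  assumes "1 < x"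
  shows "summable (\<lambda>n. real (Suc n) powr (- x))"
  using assms summable_real_powr_iff[of "- x"] summable_Suc_iff[of "\<lambda>n. real n powr (-x)"] by simp

text \<open>On a closed disc whose radius r is half the distance of its centre to the boundary line,
  the exponent is at most -(b + r + d) < -1 and the continuous factor \<open>C\<close> is bounded.
  The M-test then gives locally uniform convergence.\<close>

lemma holomorphic_suminf_powr_bound:
  fixes F :: "nat \<Rightarrow> complex \<Rightarrow> complex"
  assumes hol: "\<And>n. F n holomorphic_on {s. b < Re s}"
    and bound: "\<And>n s. b < Re s \<Longrightarrow> norm (F n s) \<le> C s * real (Suc n) powr (- Re s - d)"
    and cont: "continuous_on UNIV C" and bd: "1 \<le> b + d"
  shows "(\<lambda>s. \<Sum>n. F n s) holomorphic_on {s. b < Re s}"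
    and "b < Re s \<Longrightarrow> summable (\<lambda>n. F n s)"
proof -
  show "summable (\<lambda>n. F n s)" if "b < Re s" for s
  proof (rule summable_comparison_test)
    have "- Re s - d = - (Re s + d)" by simp
    then show "summable (\<lambda>n. C s * real (Suc n) powr (- Re s - d))"
      using that bd summable_Suc_powr[of "Re s + d"] by (simp only: summable_mult)
  qed (use bound[OF that] in auto)
  show "(\<lambda>s. \<Sum>n. F n s) holomorphic_on {s. b < Re s}"
  proof (rule holomorphic_uniform_sequence)
    show "open {s. b < Re s}" by (simp add: open_halfspace_Re_gt)
    show "(\<lambda>s. \<Sum>i<n. F i s) holomorphic_on {s. b < Re s}" for n
      by (intro holomorphic_on_sum hol)
  next
    fix x assume x: "x \<in> {s. b < Re s}"
    define r where "r = (Re x - b) / 2"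
    have r: "r > 0" using x by (simp add: r_def)
    have *: "b + r \<le> Re y" if "y \<in> cball x r" for y
    proof -
      have "Re x - Re y \<le> r"
        using that abs_Re_le_cmod[of "x - y"] by (simp add: dist_norm)
      moreover have "Re x = b + 2 * r" by (simp add: r_def field_simps)
      ultimately show ?thesis by simp
    qed
    obtain K where K: "\<And>y. y \<in> cball x r \<Longrightarrow> \<bar>C y\<bar> \<le> K"
    proof -
      have "compact (C ` cball x r)"
        using cont by (intro compact_continuous_image) (auto intro: continuous_on_subset)
      then show ?thesis
        using that by (fastforce simp: compact_eq_bounded_closed bounded_iff)
    qed
    have "uniform_limit (cball x r) (\<lambda>n s. \<Sum>i<n. F i s) (\<lambda>s. \<Sum>n. F n s) sequentially"
    proof (rule Weierstrass_m_test)
      fix n y assume y: "y \<in> cball x r"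
      have "norm (F n y) \<le> C y * real (Suc n) powr (- Re y - d)"
        using bound *[OF y] r by auto
      also have "\<dots> \<le> K * real (Suc n) powr (- (b + r + d))"
        using *[OF y] K[OF y] by (intro mult_mono powr_mono) auto
      finally show "norm (F n y) \<le> K * real (Suc n) powr (- (b + r + d))" .
    next
      show "summable (\<lambda>n. K * real (Suc n) powr (- (b + r + d)))"
        using bd r by (intro summable_mult summable_Suc_powr) auto
    qed
    moreover have "cball x r \<subseteq> {s. b < Re s}" using * r by fastforce
    ultimately show "\<exists>d>0. cball x d \<subseteq> {s. b < Re s} \<and>
        uniform_limit (cball x d) (\<lambda>n s. \<Sum>i<n. F i s) (\<lambda>s. \<Sum>n. F n s) sequentially"
      using r by blast
  qed
qed

lemma continuous_on_gbinomial:
  "continuous_on UNIV (\<lambda>s::complex. (c - s) gchoose k)"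
  unfolding gbinomial_prod_rev by (intro continuous_intros) auto

lemma holomorphic_on_gbinomial:
  "(\<lambda>s::complex. (c - s) gchoose k) holomorphic_on A"
  unfolding gbinomial_prod_rev by (intro holomorphic_intros) auto

lemma
  shows holomorphic_suminf_zeta_remainder:
    "(\<lambda>s. \<Sum>n. zeta_remainder k n s) holomorphic_on {s. 1 - real k < Re s}"
    and summable_zeta_remainder:
    "1 - real k < Re s \<Longrightarrow> summable (\<lambda>n. zeta_remainder k n s)"
proof -
  have hol: "zeta_remainder k n holomorphic_on {s. 1 - real k < Re s}" for n
    unfolding zeta_remainder_def
    by (intro holomorphic_intros holomorphic_on_gbinomial) (auto simp: complex_nonpos_Reals_iff)
  have bound: "norm (zeta_remainder k n s) \<le>
      real (Suc k) * norm ((1 - s) gchoose Suc k) * real (Suc n) powr (- Re s - real k)"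
    if "1 - real k < Re s" for n s
    using norm_zeta_remainder_le[of k s n] that by auto
  have cont: "continuous_on UNIV (\<lambda>s::complex. real (Suc k) * norm ((1 - s) gchoose Suc k))"
    using continuous_on_gbinomial[of 1 "Suc k"] by (intro continuous_intros)
  note * = holomorphic_suminf_powr_bound[OF hol bound cont]
  show "(\<lambda>s. \<Sum>n. zeta_remainder k n s) holomorphic_on {s. 1 - real k < Re s}"
    and "1 - real k < Re s \<Longrightarrow> summable (\<lambda>n. zeta_remainder k n s)"
    using * by auto
qed

section \<open>The Dirichlet series and its recurrence\<close>

definition dirichlet_zeta :: "complex \<Rightarrow> complex" where
  "dirichlet_zeta s = (\<Sum>n. inverse (of_nat (Suc n) powr s))"

lemma dirichlet_zeta_sums:
  assumes s: "1 < Re s"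
  shows "(\<lambda>n. inverse (of_nat (Suc n) powr s)) sums dirichlet_zeta s"
proof -
  have "norm (inverse (of_nat (Suc n) powr s :: complex)) = real (Suc n) powr (- Re s)" for n
  proof -
    have "norm (of_nat (Suc n) powr s :: complex) = real (Suc n) powr Re s"
      by (subst norm_powr_real_powr) auto
    then show ?thesis by (simp add: norm_inverse powr_minus)
  qed
  then have "summable (\<lambda>n. norm (inverse (of_nat (Suc n) powr s :: complex)))"
    using summable_Suc_powr[OF s] by simp
  then show ?thesis
    unfolding dirichlet_zeta_def by (rule summable_sums[OF summable_norm_cancel])
qed

text \<open>The telescoping sum of the differences of \<open>n\<^bsup>1-s\<^esup>\<close>, each expanded by Taylor's theorem
  at \<open>n\<close>, relates the values at \<open>s, s + 1, \<dots>, s + k - 1\<close>.\<close>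

lemma dirichlet_zeta_recurrence:
  assumes s: "1 < Re s"
  shows "- 1 = (\<Sum>j=1..k. ((1 - s) gchoose j) * dirichlet_zeta (s + of_nat j - 1)) +
      (\<Sum>n. zeta_remainder k n s)"
proof -
  have "(\<lambda>n. of_nat (Suc n) powr (1 - s) :: complex) \<longlonglongrightarrow> 0"
  proof (rule tendsto_norm_zero_cancel)
    have "(\<lambda>n. real (Suc n) powr (1 - Re s)) \<longlonglongrightarrow> 0"
      using s by (intro tendsto_neg_powr filterlim_compose[OF filterlim_real_sequentially filterlim_Suc]) auto
    moreover have "norm (of_nat (Suc n) powr (1 - s) :: complex) = real (Suc n) powr (1 - Re s)" for n
      by (subst norm_powr_real_powr) auto
    ultimately show "(\<lambda>n. norm (of_nat (Suc n) powr (1 - s) :: complex)) \<longlonglongrightarrow> 0" by simp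
  qed
  from telescope_sums[OF this]
  have 1: "(\<lambda>n. of_nat (Suc (Suc n)) powr (1 - s) - of_nat (Suc n) powr (1 - s)) sums (-1 :: complex)"
    by simp
  have 2: "(\<lambda>n. (\<Sum>j=1..k. ((1 - s) gchoose j) * inverse (of_nat (Suc n) powr (s + of_nat j - 1))) +
      zeta_remainder k n s) sums ((\<Sum>j=1..k. ((1 - s) gchoose j) * dirichlet_zeta (s + of_nat j - 1)) +
      (\<Sum>n. zeta_remainder k n s))" if "k > 0"
  proof (intro sums_add sums_sum sums_mult dirichlet_zeta_sums summable_sums summable_zeta_remainder)
    show "1 < Re (s + of_nat j - 1)" if "j \<in> {1..k}" for j
      using s that by auto
  qed (use s that in auto)
  show ?thesis
  proof (cases "k = 0")
    case True
    then show ?thesis using sums_unique[OF 1] by (simp add: zeta_remainder_def)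
  next
    case False
    have "of_nat (Suc (Suc n)) powr (1 - s) - of_nat (Suc n) powr (1 - s) =
       (\<Sum>j=1..k. ((1 - s) gchoose j) * inverse (of_nat (Suc n) powr (s + of_nat j - 1))) +
      zeta_remainder k n s" for n
    proof -
      have "{..k} = insert 0 {1..k}" by auto
      then have "(\<Sum>j\<le>k. ((1 - s) gchoose j) * of_nat (Suc n) powr (1 - s - of_nat j)) =
         of_nat (Suc n) powr (1 - s) + (\<Sum>j=1..k. ((1 - s) gchoose j) * of_nat (Suc n) powr (1 - s - of_nat j))"
        by simp
      also have "(\<Sum>j=1..k. ((1 - s) gchoose j) * of_nat (Suc n) powr (1 - s - of_nat j)) =
         (\<Sum>j=1..k. ((1 - s) gchoose j) * inverse (of_nat (Suc n) powr (s + of_nat j - 1)))"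
        by (intro sum.cong refl) (simp add: powr_minus[symmetric] algebra_simps)
      finally show ?thesis by (simp add: zeta_remainder_def)
    qed
    with 2 False have "(\<lambda>n. of_nat (Suc (Suc n)) powr (1 - s) - of_nat (Suc n) powr (1 - s))
      sums ((\<Sum>j=1..k. ((1 - s) gchoose j) * dirichlet_zeta (s + of_nat j - 1)) +
      (\<Sum>n. zeta_remainder k n s))" by simp
    with 1 show ?thesis by (rule sums_unique2)
  qed
qed


definition dirichlet_factor :: "nat \<Rightarrow> complex \<Rightarrow> complex" where
  "dirichlet_factor j s = - (\<Prod>i<j - 1. 1 - s - of_nat i) / fact j"

text \<open>The pole of \<open>\<zeta>(s + j - 1)\<close> is cancelled by a zero of the binomial coefficient.\<close>

lemma gbinomial_eq_dirichlet_factor: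
  assumes "j \<ge> 1"
  shows "((1 - s) gchoose j) = dirichlet_factor j s * (s + of_nat j - 1 - 1)"
proof -
  obtain i where j: "j = Suc i" using assms by (cases j) auto
  have "(\<Prod>i = 0..<j. 1 - s - of_nat i) = (\<Prod>i<j - 1. 1 - s - of_nat i) * (1 - s - of_nat i)"
    by (simp add: j atLeast0LessThan)
  then have "((1 - s) gchoose j) = (\<Prod>i<j - 1. 1 - s - of_nat i) * (1 - s - of_nat i) / fact j"
    unfolding gbinomial_prod_rev by (simp only:)
  also have "1 - s - of_nat i = - (s + of_nat j - 1 - 1)" by (simp add: j)
  finally show ?thesis unfolding dirichlet_factor_def by (metis minus_divide_left mult_minus_left mult_minus_right times_divide_eq_left)
qed

text \<open>The recurrence is solved for its term j = 1, which is (1 - s) zeta(s). The terms j >= 2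
  involve zeta only at s + 1, s + 2, ..., where the extension exists by induction; phrasing
  everything for (s - 1) zeta(s) avoids poles. The choice k = m + 2 makes the remainders summable
  exactly for Re s > 1 - k = -(m + 1).\<close>

lemma zeta_extension_halfplane:
  "\<exists>g. g holomorphic_on {s. - real m < Re s} \<and> (\<forall>s. 1 < Re s \<longrightarrow> g s = (s - 1) * dirichlet_zeta s)"
proof (induction m)
  case 0
  have "1 + (\<Sum>n. zeta_remainder 1 n s) = (s - 1) * dirichlet_zeta s" if "1 < Re s" for s
  proof -
    have "- 1 = (1 - s) * dirichlet_zeta s + (\<Sum>n. zeta_remainder 1 n s)"
      using dirichlet_zeta_recurrence[OF that, of 1] by simp
    then show ?thesis by algebra
  qed
  moreover have "(\<lambda>s. 1 + (\<Sum>n. zeta_remainder 1 n s)) holomorphic_on {s. - real 0 < Re s}"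
    using holomorphic_suminf_zeta_remainder[of 1] by (intro holomorphic_intros) auto
  ultimately show ?case by blast
next
  case (Suc m)
  then obtain g where g: "g holomorphic_on {s. - real m < Re s}"
    "\<And>s. 1 < Re s \<Longrightarrow> g s = (s - 1) * dirichlet_zeta s" by blast
  define k where "k = Suc (Suc m)"
  define h where "h = (\<lambda>s. 1 + (\<Sum>j=2..k. dirichlet_factor j s * g (s + of_nat j - 1)) +
    (\<Sum>n. zeta_remainder k n s))"
  have "h s = (s - 1) * dirichlet_zeta s" if s: "1 < Re s" for s
  proof -
    have *: "(\<Sum>j=2..k. dirichlet_factor j s * g (s + of_nat j - 1)) =
        (\<Sum>j=2..k. ((1 - s) gchoose j) * dirichlet_zeta (s + of_nat j - 1))"
    proof (intro sum.cong refl)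
      fix j assume "j \<in> {2..k}"
      then show "dirichlet_factor j s * g (s + of_nat j - 1) = ((1 - s) gchoose j) * dirichlet_zeta (s + of_nat j - 1)"
        using s by (subst g(2)) (auto simp: gbinomial_eq_dirichlet_factor)
    qed
    have "{1..k} = insert 1 {2..k}" by (auto simp: k_def)
    then have "(\<Sum>j=1..k. ((1 - s) gchoose j) * dirichlet_zeta (s + of_nat j - 1)) =
        (1 - s) * dirichlet_zeta s + (\<Sum>j=2..k. ((1 - s) gchoose j) * dirichlet_zeta (s + of_nat j - 1))"
      by simp
    with * have "- 1 = (1 - s) * dirichlet_zeta s + (h s - 1)"
      using dirichlet_zeta_recurrence[OF s, of k] by (simp add: h_def)
    then show ?thesis by algebra
  qed
  moreover have "h holomorphic_on {s. - real (Suc m) < Re s}"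
  proof -
    have "(\<lambda>s. g (s + of_nat j - 1)) holomorphic_on {s. - real (Suc m) < Re s}" if "j \<in> {2..k}" for j
    proof -
      have "(g \<circ> (\<lambda>s. s + of_nat j - 1)) holomorphic_on {s. - real (Suc m) < Re s}"
        using that by (intro holomorphic_on_compose_gen[OF _ g(1)] holomorphic_intros) auto
      then show ?thesis by (simp add: o_def)
    qed
    moreover have "(\<lambda>s. \<Sum>n. zeta_remainder k n s) holomorphic_on {s. - real (Suc m) < Re s}"
      using holomorphic_suminf_zeta_remainder[of k] by (simp add: k_def)
    ultimately show ?thesis
      unfolding h_def dirichlet_factor_def by (intro holomorphic_intros) auto
  qed
  ultimately show ?case by blast
qed

lemma halfplane_continuation_unique:
  assumes "f holomorphic_on {s. b < Re s}" "g holomorphic_on {s. b < Re s}" "b \<le> 1"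
    and "\<And>s. 1 < Re s \<Longrightarrow> f s = g s" and "b < Re s"
  shows "f s = g s"
proof (rule analytic_continuation_open[of "{s. 1 < Re s}" "{s. b < Re s}" f g])
  show "connected {s. b < Re s}" by (simp add: convex_connected convex_halfspace_Re_gt)
  have "2 \<in> {s. 1 < Re s}" by simp
  then show "{s. 1 < Re s} \<noteq> {}" by blast
qed (use assms in \<open>auto simp: open_halfspace_Re_gt\<close>)

text \<open>The half-planes are nested, so by the identity theorem two extensions agree wherever
  both are defined. Hence the function whose index depends on \<open>s\<close> coincides with a
  single \<open>G k\<close> on a whole half-plane.\<close>

lemma zeta_extension_entire:
  "\<exists>g. g holomorphic_on UNIV \<and> (\<forall>s. 1 < Re s \<longrightarrow> g s = (s - 1) * dirichlet_zeta s)"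
proof -
  obtain G where G: "\<And>m. G m holomorphic_on {s. - real m < Re s}"
    "\<And>m s. 1 < Re s \<Longrightarrow> G m s = (s - 1) * dirichlet_zeta s"
    using zeta_extension_halfplane by metis
  define g where "g = (\<lambda>s. G (nat \<lceil>\<bar>Re s\<bar>\<rceil> + 1) s)"
  have eq: "g s = G m s" if "- real m < Re s" for m s
  proof -
    define k where "k = nat \<lceil>\<bar>Re s\<bar>\<rceil> + 1"
    have k: "- real k < Re s" unfolding k_def by linarith
    define l where "l = min m k"
    have hol: "G m holomorphic_on {s. - real l < Re s}" "G k holomorphic_on {s. - real l < Re s}"
      by (rule holomorphic_on_subset[OF G(1)], force simp: l_def)+
    have "G m s = G k s"
      by (rule halfplane_continuation_unique[OF hol]) (use that k in \<open>auto simp: l_def G(2)\<close>)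
    then show ?thesis by (simp add: g_def k_def)
  qed
  have "g field_differentiable at s" for s
  proof -
    define k where "k = nat \<lceil>\<bar>Re s\<bar>\<rceil> + 1"
    have k: "- real k < Re s" unfolding k_def by linarith
    have "g holomorphic_on {s. - real k < Re s}"
      using holomorphic_transform[OF G(1)[of k]] eq by auto
    then show ?thesis
      using k by (simp add: holomorphic_on_def at_within_open[OF _ open_halfspace_Re_gt])
  qed
  moreover have "g s = (s - 1) * dirichlet_zeta s" if "1 < Re s" for s
    using eq[of 0 s] G(2) that by simp
  ultimately show ?thesis
    by (intro exI[of _ g]) (auto simp: holomorphic_on_def field_differentiable_at_within)
qed

section \<open>The entire function (s - 1) zeta(s): values, growth, symmetry\<close>

definition zeta_entire :: "complex \<Rightarrow> complex" where
  "zeta_entire = (SOME g. g holomorphic_on UNIV \<and> (\<forall>s. 1 < Re s \<longrightarrow> g s = (s - 1) * dirichlet_zeta s))"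

lemma holomorphic_zeta_entire: "zeta_entire holomorphic_on A"
  and zeta_entire_dirichlet: "1 < Re s \<Longrightarrow> zeta_entire s = (s - 1) * dirichlet_zeta s"
proof -
  have *: "zeta_entire holomorphic_on UNIV \<and> (\<forall>s. 1 < Re s \<longrightarrow> zeta_entire s = (s - 1) * dirichlet_zeta s)"
    unfolding zeta_entire_def by (rule someI_ex[OF zeta_extension_entire])
  show "zeta_entire holomorphic_on A"
    by (rule holomorphic_on_subset[OF conjunct1[OF *] subset_UNIV])
  show "1 < Re s \<Longrightarrow> zeta_entire s = (s - 1) * dirichlet_zeta s"
    using * by simp
qed

text \<open>The quotient satisfies the description in the \<open>THE\<close>, including the value 0
  at the pole since x / 0 = 0. Uniqueness is the identity theorem on the connected set
  \<open>- {1}\<close>.\<close>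

lemma riemann_zeta_eq: "riemann_zeta s = zeta_entire s / (s - 1)"
proof -
  let ?P = "\<lambda>f. f holomorphic_on (- {1}) \<and>
      (\<forall>s. 1 < Re s \<longrightarrow> (\<lambda>n. inverse (of_nat (Suc n) powr s)) sums f s) \<and> f 1 = (0::complex)"
  let ?f = "\<lambda>s. zeta_entire s / (s - 1)"
  have f: "?P ?f"
  proof (intro conjI allI impI)
    show "?f holomorphic_on - {1}"
      by (intro holomorphic_intros holomorphic_zeta_entire) auto
    show "(\<lambda>n. inverse (of_nat (Suc n) powr s)) sums ?f s" if "1 < Re s" for s
      using dirichlet_zeta_sums[OF that] zeta_entire_dirichlet[OF that] that by auto
  qed auto
  have "riemann_zeta = ?f"
    unfolding riemann_zeta_def
  proof (rule the_equality)
    fix h assume h: "?P h"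
    show "h = ?f"
    proof
      fix s
      show "h s = ?f s"
      proof (cases "s = 1")
        case False
        show ?thesis
        proof (rule analytic_continuation_open[of "{s. 1 < Re s}" "- {1}" h ?f])
          show "connected (- {1::complex})" by (intro connected_punctured_universe) auto
          have "2 \<in> {s. 1 < Re s}" by simp
          then show "{s. 1 < Re s} \<noteq> {}" by blast
          show "h z = ?f z" if "z \<in> {s. 1 < Re s}" for z
            using h f that sums_unique2 by blast
        qed (use h f False in \<open>auto simp: open_halfspace_Re_gt\<close>)
      qed (use h in auto)
    qed
  qed (fact f)
  then show ?thesis by (rule fun_cong)
qed

lemma zeta_entire_eq_remainder:
  assumes "0 < Re s"
  shows "zeta_entire s = 1 + (\<Sum>n. zeta_remainder 1 n s)"
proof (rule halfplane_continuation_unique[where b = 0 and g = "\<lambda>s. 1 + (\<Sum>n. zeta_remainder 1 n s)"])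
  show "(\<lambda>s. 1 + (\<Sum>n. zeta_remainder 1 n s)) holomorphic_on {s. 0 < Re s}"
    using holomorphic_suminf_zeta_remainder[of 1] by (intro holomorphic_intros) auto
  show "zeta_entire s = 1 + (\<Sum>n. zeta_remainder 1 n s)" if "1 < Re s" for s
  proof -
    have "- 1 = (1 - s) * dirichlet_zeta s + (\<Sum>n. zeta_remainder 1 n s)"
      using dirichlet_zeta_recurrence[OF that, of 1] by simp
    then show ?thesis unfolding zeta_entire_dirichlet[OF that] by algebra
  qed
qed (use assms holomorphic_zeta_entire in auto)

text \<open>At s = 1 the Taylor polynomial is exact: all powers have exponent 0 and the linear
  binomial coefficient vanishes. This is the residue of zeta at 1, and it normalises the function on
  the disc to have value 1 at the origin.\<close>

lemma zeta_entire_1: "zeta_entire 1 = 1"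
proof -
  have "zeta_remainder 1 n 1 = 0" for n
    unfolding zeta_remainder_def using of_nat_neq_0[of n, where 'a = complex]
      of_nat_neq_0[of "Suc n", where 'a = complex] by (simp del: of_nat_Suc)
  then show ?thesis by (subst zeta_entire_eq_remainder) auto
qed

text \<open>With k = 1 the remainders are bounded by a quadratic binomial coefficient times N^(-Re s
  - 1), and for Re s >= 1/2 the powers are dominated by the convergent series of N^(-3/2).\<close>

lemma zeta_entire_growth:
  "\<exists>C>0. \<forall>s. 1/2 \<le> Re s \<longrightarrow> norm (zeta_entire s) \<le> C * (1 + norm s)\<^sup>2"
proof -
  define S where "S = (\<Sum>n. real (Suc n) powr (- (3/2)))"
  have sm: "summable (\<lambda>n. real (Suc n) powr (- (3/2)))" by (rule summable_Suc_powr) auto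
  have S: "0 \<le> S" unfolding S_def by (intro suminf_nonneg sm) auto
  have "norm (zeta_entire s) \<le> (1 + S) * (1 + norm s)\<^sup>2" if s: "1/2 \<le> Re s" for s
  proof -
    have ch: "norm ((1 - s) gchoose 2) \<le> (1 + norm s)\<^sup>2 / 2"
    proof -
      have "((1 - s) gchoose 2) = (1 - s) * (- s) / 2"
        by (simp add: gbinomial_prod_rev numeral_2_eq_2)
      then have "norm ((1 - s) gchoose 2) = norm (1 - s) * norm s / 2"
        by (simp add: norm_mult norm_divide)
      also have "\<dots> \<le> (1 + norm s) * (1 + norm s) / 2"
        using norm_triangle_ineq4[of 1 s] by (intro divide_right_mono mult_mono) auto
      finally show ?thesis by (simp add: power2_eq_square)
    qed
    have b: "norm (zeta_remainder 1 n s) \<le> (1 + norm s)\<^sup>2 * real (Suc n) powr (- (3/2))" for n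
    proof -
      have "norm (zeta_remainder 1 n s) \<le> 2 * norm ((1 - s) gchoose 2) * real (Suc n) powr (- Re s - 1)"
        using norm_zeta_remainder_le[of 1 s n] s by (simp add: numeral_2_eq_2)
      also have "\<dots> \<le> 2 * ((1 + norm s)\<^sup>2 / 2) * real (Suc n) powr (- (3/2))"
        using ch s by (intro mult_mono powr_mono) auto
      finally show ?thesis by simp
    qed
    have "norm (\<Sum>n. zeta_remainder 1 n s) \<le> (\<Sum>n. (1 + norm s)\<^sup>2 * real (Suc n) powr (- (3/2)))"
      using b by (intro norm_suminf_le summable_mult sm)
    also have "\<dots> = (1 + norm s)\<^sup>2 * S" unfolding S_def by (rule suminf_mult[OF sm])
    finally have "norm (zeta_entire s) \<le> 1 + (1 + norm s)\<^sup>2 * S"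
      using zeta_entire_eq_remainder[of s] s norm_triangle_ineq[of 1 "\<Sum>n. zeta_remainder 1 n s"] by auto
    moreover have "1 \<le> (1 + norm s)\<^sup>2" by (simp add: power2_eq_square algebra_simps)
    ultimately show ?thesis unfolding distrib_right mult.commute[of S] mult_1 by linarith
  qed
  with S show ?thesis by (intro exI[of _ "1 + S"]) auto
qed

text \<open>The symmetry makes the function real on the real axis and lets the integral over the
  whole circle be folded onto t >= 0.\<close>

lemma zeta_entire_cnj: "zeta_entire (cnj s) = cnj (zeta_entire s)"
proof -
  have hol: "(cnj \<circ> zeta_entire \<circ> cnj) holomorphic_on UNIV"
    by (rule holomorphic_on_compose_cnj_cnj) (auto intro: holomorphic_zeta_entire)
  have eq: "(cnj \<circ> zeta_entire \<circ> cnj) z = zeta_entire z" if z: "1 < Re z" for z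
  proof -
    have eq: "inverse (of_nat (Suc n) powr cnj z) = cnj (inverse (of_nat (Suc n) powr z))" for n
      by (simp add: cnj_powr complex_nonpos_Reals_iff flip: of_nat_Suc)
    have sums: "(\<lambda>n. inverse (of_nat (Suc n) powr cnj z)) sums cnj (dirichlet_zeta z)"
      unfolding eq by (rule iffD2[OF sums_cnj dirichlet_zeta_sums[OF z]])
    have z': "1 < Re (cnj z)" using z by simp
    have "dirichlet_zeta (cnj z) = cnj (dirichlet_zeta z)"
      by (rule sums_unique2[OF dirichlet_zeta_sums[OF z'] sums])
    then show ?thesis
      unfolding o_apply zeta_entire_dirichlet[OF z] zeta_entire_dirichlet[OF z'] by simp
  qed
  have "(cnj \<circ> zeta_entire \<circ> cnj) s = zeta_entire s"
    by (rule halfplane_continuation_unique[OF holomorphic_on_subset[OF hol subset_UNIV]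
          holomorphic_zeta_entire _ eq, where b = "min 0 (Re s - 1)"]) auto
  then show ?thesis by (metis complex_cnj_cnj o_apply)
qed

text \<open>Only the first term 1 of the positive Dirichlet series is kept. Besides positivity, this
  provides the lower bound for the logarithm on the radius near z = 1.\<close>

lemma zeta_entire_real_ge:
  assumes "1 < x"
  shows "x - 1 \<le> Re (zeta_entire (of_real x))"
proof -
  have "(\<lambda>n. Re (inverse (of_nat (Suc n) powr of_real x))) sums Re (dirichlet_zeta (of_real x))"
    using dirichlet_zeta_sums[of "of_real x"] assms by (intro sums_Re) auto
  moreover have "inverse (of_nat (Suc n) powr of_real x) = (of_real (inverse (real (Suc n) powr x)) :: complex)" for n
  proof -
    have "of_nat (Suc n) powr of_real x = (of_real (real (Suc n) powr x) :: complex)"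
      using powr_of_real[of "real (Suc n)" x] by simp
    then show ?thesis by simp
  qed
  ultimately have sums: "(\<lambda>n. inverse (real (Suc n) powr x)) sums Re (dirichlet_zeta (of_real x))" by (simp only: Re_complex_of_real)
  then have "1 \<le> Re (dirichlet_zeta (of_real x))"
    using sum_le_suminf[OF sums_summable[OF sums], of "{0}"] sums_unique[OF sums] by auto
  then have "(x - 1) * 1 \<le> (x - 1) * Re (dirichlet_zeta (of_real x))"
    using assms by (intro mult_left_mono) auto
  then show ?thesis using assms by (simp add: zeta_entire_dirichlet)
qed

lemma zeta_entire_of_real: "zeta_entire (of_real x) = of_real (Re (zeta_entire (of_real x)))"
  using zeta_entire_cnj[of "of_real x"] by (simp add: complex_eq_iff)

section \<open>A Jensen formula for the unit disc\<close>

lemma has_vector_derivative_compose_cis: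
  assumes "(N has_field_derivative D) (at (cis (c * p)))"
  shows "((\<lambda>p. N (cis (c * p))) has_vector_derivative D * (\<i> * of_real c * cis (c * p))) (at p within S)"
proof -
  have e: "exp (\<i> * of_real c * of_real q) = cis (c * q)" for q
    by (simp add: cis_conv_exp mult_ac)
  have "((\<lambda>z. exp (\<i> * of_real c * z)) has_field_derivative exp (\<i> * of_real c * of_real p) * (\<i> * of_real c)) (at (of_real p))"
    by (auto intro!: derivative_eq_intros)
  moreover have "(N has_field_derivative D) (at (exp (\<i> * of_real c * of_real p)))"
    using assms by (simp add: e)
  ultimately have "((\<lambda>z. N (exp (\<i> * of_real c * z))) has_field_derivative
      D * (exp (\<i> * of_real c * of_real p) * (\<i> * of_real c))) (at (of_real p))"
    by (rule DERIV_chain2[rotated])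
  from has_vector_derivative_real_field[OF this]
  show ?thesis unfolding e by (simp add: mult_ac has_vector_derivative_at_within)
qed

text \<open>\<open>J\<close> is the Jensen integral over the unit circle \<open>e\<^bsup>2ip\<^esup>\<close>; \<open>K\<close> is the combination of the
  integral over the circle weighted with \<open>2 sin p\<close> and the integral over the radius
  \<open>x = y\<^sup>2\<close> whose vanishing is to be characterised.\<close>

definition disc_integrals :: "(complex \<Rightarrow> complex) \<Rightarrow> real \<Rightarrow> real \<Rightarrow> bool" where
  "disc_integrals f J K \<longleftrightarrow>
     ((\<lambda>p. ln (cmod (f (cis (2 * p))))) has_integral J) {0..pi} \<and>
     (\<exists>I. ((\<lambda>y. ln (cmod (f (of_real (y\<^sup>2)))) * ((1 - y\<^sup>2) / y\<^sup>2)) has_integral I) {0..1} \<and>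
          ((\<lambda>p. ln (cmod (f (cis (2 * p)))) * (2 * sin p)) has_integral (K - 2 * I)) {0..pi})"

lemma has_integral_ln_mult:
  assumes "((\<lambda>x. ln (cmod (f x)) * w x) has_integral a) S" "((\<lambda>x. ln (cmod (g x)) * w x) has_integral b) S"
    and "\<And>x. x \<in> S \<Longrightarrow> f x \<noteq> 0" "\<And>x. x \<in> S \<Longrightarrow> g x \<noteq> 0"
  shows "((\<lambda>x. ln (cmod (f x * g x)) * w x) has_integral (a + b)) S"
  by (rule has_integral_eq[OF _ has_integral_add[OF assms(1,2)]])
    (simp add: assms(3,4) norm_mult ln_mult algebra_simps)

text \<open>Logarithms of moduli add up, so a factorisation of the function splits both integrals.
  Nonvanishing on the paths is required because ln 0 = 0 by convention and additivity would fail at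
  a zero.\<close>

lemma disc_integrals_mult:
  assumes "disc_integrals f J K" "disc_integrals g J' K'"
    and "\<And>z. cmod z = 1 \<Longrightarrow> f z \<noteq> 0" "\<And>z. cmod z = 1 \<Longrightarrow> g z \<noteq> 0"
    and "\<And>x. x \<in> {0..1} \<Longrightarrow> f (of_real x) \<noteq> 0" "\<And>x. x \<in> {0..1} \<Longrightarrow> g (of_real x) \<noteq> 0"
  shows "disc_integrals (\<lambda>z. f z * g z) (J + J') (K + K')"
proof -
  obtain I where I: "((\<lambda>y. ln (cmod (f (of_real (y\<^sup>2)))) * ((1 - y\<^sup>2) / y\<^sup>2)) has_integral I) {0..1}"
     "((\<lambda>p. ln (cmod (f (cis (2 * p)))) * (2 * sin p)) has_integral (K - 2 * I)) {0..pi}"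
    using assms(1) unfolding disc_integrals_def by blast
  obtain I' where I': "((\<lambda>y. ln (cmod (g (of_real (y\<^sup>2)))) * ((1 - y\<^sup>2) / y\<^sup>2)) has_integral I') {0..1}"
     "((\<lambda>p. ln (cmod (g (cis (2 * p)))) * (2 * sin p)) has_integral (K' - 2 * I')) {0..pi}"
    using assms(2) unfolding disc_integrals_def by blast
  have sq: "y\<^sup>2 \<in> {0..1}" if "y \<in> {0..1}" for y :: real
    using that by (auto simp: power_le_one)
  have 1: "((\<lambda>y. ln (cmod (f (of_real (y\<^sup>2)) * g (of_real (y\<^sup>2)))) * ((1 - y\<^sup>2) / y\<^sup>2)) has_integral (I + I')) {0..1}"
    by (rule has_integral_ln_mult[OF I(1) I'(1)]) (use assms(5,6) sq in blast)+
  have 2: "((\<lambda>p. ln (cmod (f (cis (2 * p)) * g (cis (2 * p)))) * (2 * sin p)) has_integral ((K - 2 * I) + (K' - 2 * I'))) {0..pi}"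
    by (rule has_integral_ln_mult[OF I(2) I'(2)]) (use assms(3,4) in \<open>auto simp: norm_cis\<close>)
  have 3: "((\<lambda>p. ln (cmod (f (cis (2 * p)) * g (cis (2 * p)))) * 1) has_integral (J + J')) {0..pi}"
    by (rule has_integral_ln_mult) (use assms(1-4) in \<open>auto simp: norm_cis disc_integrals_def\<close>)
  show ?thesis
    unfolding disc_integrals_def
    using 1 2 3 by (intro conjI exI[of _ "I + I'"]) (simp_all add: algebra_simps)
qed

lemma disc_integrals_1: "disc_integrals (\<lambda>_. 1) 0 0"
  unfolding disc_integrals_def by (auto intro!: exI[of _ 0])

lemma disc_integrals_power:
  assumes "disc_integrals f J K"
    and "\<And>z. cmod z = 1 \<Longrightarrow> f z \<noteq> 0" "\<And>x. x \<in> {0..1} \<Longrightarrow> f (of_real x) \<noteq> 0"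
  shows "disc_integrals (\<lambda>z. f z ^ n) (real n * J) (real n * K)"
proof (induction n)
  case 0
  then show ?case by (simp add: disc_integrals_1)
next
  case (Suc n)
  from disc_integrals_mult[OF assms(1) Suc] assms show ?case by (simp add: algebra_simps)
qed

section \<open>Functions without zeros in the closed disc\<close>

text \<open>The branch \<open>H\<close> of log f vanishes at 0, so H(z)/z extends to the holomorphic
  \<open>Q\<close>; its integral over the circle is 0, which is the mean value property J = 0. For
  the same reason \<open>M\<close>, that is H(y^2) (1 - y^2)/y^2, is holomorphic at 0 and has a
  primitive \<open>N\<close>. The arc from 1 to -1 and the diameter form a closed path, and since
  \<open>M\<close> is even the two halves of the diameter contribute equally.\<close>

lemma disc_integrals_nonvanishing:
  assumes hol: "f holomorphic_on ball 0 R" and R: "1 < R" and nz: "\<And>z. z \<in> ball 0 R \<Longrightarrow> f z \<noteq> 0"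
    and f0: "f 0 = 1"
  shows "disc_integrals f 0 0"
proof -
  obtain G where G: "G holomorphic_on ball 0 R" "\<And>z. z \<in> ball 0 R \<Longrightarrow> exp (G z) = f z"
    using holomorphic_logarithm_exists[OF convex_ball open_ball hol nz, of 0] R by auto
  define H where "H = (\<lambda>z. G z - G 0)"
  have H: "H holomorphic_on ball 0 R" "\<And>z. z \<in> ball 0 R \<Longrightarrow> exp (H z) = f z"
    using G R f0 by (auto simp: H_def exp_diff intro!: holomorphic_intros)
  have H0: "H 0 = 0" by (simp add: H_def)
  have lnf: "ln (cmod (f z)) = Re (H z)" if "z \<in> ball 0 R" for z
    using H(2)[OF that] by (metis ln_exp norm_exp_eq_Re)
  define Q where "Q = (\<lambda>z. if z = 0 then deriv H 0 else (H z - H 0) / (z - 0))"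
  have Q: "Q holomorphic_on ball 0 R"
    unfolding Q_def by (rule pole_lemma_open[OF H(1)]) auto
  have HQ: "H z = z * Q z" for z by (simp add: Q_def H0)
  have bd: "cis t \<in> ball 0 R" for t using R by simp
  obtain T where T: "\<And>z. z \<in> ball 0 R \<Longrightarrow> (T has_field_derivative Q z) (at z within ball 0 R)"
    using holomorphic_convex_primitive'[OF convex_ball open_ball Q] by blast
  have T': "(T has_field_derivative Q z) (at z)" if "z \<in> ball 0 R" for z
    using T[OF that] that by (simp add: at_within_open[OF _ open_ball])
  have "((\<lambda>p. Q (cis (2 * p)) * (\<i> * of_real 2 * cis (2 * p))) has_integral T (cis (2 * pi)) - T (cis (2 * 0))) {0..pi}"
    by (rule fundamental_theorem_of_calculus, simp, rule has_vector_derivative_compose_cis, rule T'[OF bd])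
  then have "((\<lambda>p. (Q (cis (2 * p)) * (\<i> * of_real 2 * cis (2 * p))) * (1 / (2 * \<i>))) has_integral 0 * (1 / (2 * \<i>))) {0..pi}"
    by (intro has_integral_mult_left) simp
  then have "((\<lambda>p. H (cis (2 * p))) has_integral 0) {0..pi}"
    by (simp add: HQ mult_ac)
  then have J: "((\<lambda>p. ln (cmod (f (cis (2 * p))))) has_integral 0) {0..pi}"
    using has_integral_Re[of "\<lambda>p. H (cis (2 * p))" 0] lnf[OF bd] by simp
  define M where "M = (\<lambda>y. Q (y\<^sup>2) * (1 - y\<^sup>2))"
  define r where "r = sqrt R"
  have r: "1 < r" "r\<^sup>2 = R" using R by (auto simp: r_def)
  have sq: "y\<^sup>2 \<in> ball 0 R" if "y \<in> ball 0 r" for y :: complex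
    using that r by (auto simp: norm_power simp flip: r(2) intro!: power_strict_mono)
  have "(\<lambda>y. Q (y\<^sup>2)) holomorphic_on ball 0 r"
    by (rule holomorphic_on_compose_gen[of "\<lambda>y. y\<^sup>2" "ball 0 r" Q "ball 0 R", unfolded o_def])
      (use Q sq in \<open>auto intro!: holomorphic_intros\<close>)
  then have M: "M holomorphic_on ball 0 r"
    unfolding M_def by (intro holomorphic_intros)
  obtain N where N: "\<And>z. z \<in> ball 0 r \<Longrightarrow> (N has_field_derivative M z) (at z within ball 0 r)"
    using holomorphic_convex_primitive'[OF convex_ball open_ball M] by blast
  have N': "(N has_field_derivative M z) (at z)" if "z \<in> ball 0 r" for z
    using N[OF that] that by (simp add: at_within_open[OF _ open_ball])
  have bd': "cis t \<in> ball 0 r" for t using r by simp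
  have arc: "((\<lambda>p. M (cis (1 * p)) * (\<i> * of_real 1 * cis (1 * p))) has_integral N (cis (1 * pi)) - N (cis (1 * 0))) {0..pi}"
    by (rule fundamental_theorem_of_calculus, simp, rule has_vector_derivative_compose_cis, rule N'[OF bd'])
  \<comment> \<open>With y = cis p one has (1 - y^2)/y^2 dy = i (1/y - y) dp = 2 sin p dp; this is
    the origin of the circular weight.\<close>
  have "M (cis (1 * p)) * (\<i> * of_real 1 * cis (1 * p)) = H (cis (2 * p)) * of_real (2 * sin p)" for p
  proof -
    have c2: "cis (2 * p) = (cis p)\<^sup>2" by (metis cis_mult mult_2 power2_eq_square)
    have ci: "cis p * cis (- p) = 1" by (simp add: cis_mult)
    have "1 - (cis p)\<^sup>2 = cis p * (cis (- p) - cis p)"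
      using ci by (simp add: algebra_simps power2_eq_square)
    also have "cis (- p) - cis p = - 2 * \<i> * of_real (sin p)"
      by (simp add: complex_eq_iff)
    finally have "(1 - (cis p)\<^sup>2) * (\<i> * cis p) = (cis p)\<^sup>2 * of_real (2 * sin p)"
      by (simp add: power2_eq_square)
    then have "Q ((cis p)\<^sup>2) * ((1 - (cis p)\<^sup>2) * (\<i> * cis p)) = Q ((cis p)\<^sup>2) * ((cis p)\<^sup>2 * of_real (2 * sin p))"
      by (simp only:)
    then show ?thesis unfolding M_def HQ c2 mult_1 of_real_1 by (simp only: mult_ac mult_1)
  qed
  with arc have arc: "((\<lambda>p. H (cis (2 * p)) * of_real (2 * sin p)) has_integral N (- 1) - N 1) {0..pi}"
    by simp
  have seg: "((\<lambda>y. M (of_real y)) has_integral N (of_real b) - N (of_real a)) {a..b}" if "-1 \<le> a" "a \<le> b" "b \<le> 1" for a b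
  proof (rule fundamental_theorem_of_calculus)
    fix x assume "x \<in> {a..b}"
    then have "of_real x \<in> ball (0::complex) r" using that r by auto
    from has_vector_derivative_real_field[OF N'[OF this]]
    show "((\<lambda>y. N (of_real y)) has_vector_derivative M (of_real x)) (at x within {a..b})"
      by (rule has_vector_derivative_at_within)
  qed (use that in auto)
  have "((\<lambda>y. M (of_real (-y))) has_integral N (of_real 0) - N (of_real (-1))) {0..1}"
    using has_integral_reflect_real[where a = "-1" and b = 0 and f = "\<lambda>y. M (of_real y)"] seg[of "-1" 0] by simp
  then have neg: "((\<lambda>y. M (of_real y)) has_integral N 0 - N (-1)) {0..1}"
    by (simp add: M_def)
  have half: "N 0 - N (-1) = N 1 - N 0"
    using has_integral_unique[OF neg seg[of 0 1]] by simp
  define I where "I = Re (N 1 - N 0)"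
  have "((\<lambda>y. Re (M (of_real y))) has_integral I) {0..1}"
    using has_integral_Re[OF seg[of 0 1]] by (simp add: I_def)
  then have rad: "((\<lambda>y. ln (cmod (f (of_real (y\<^sup>2)))) * ((1 - y\<^sup>2) / y\<^sup>2)) has_integral I) {0..1}"
  proof (rule has_integral_spike[of "{0}", rotated 2])
    fix y assume y: "y \<in> {0..1} - {0::real}"
    have "of_real (y\<^sup>2) \<in> ball (0::complex) R"
    proof -
      have "y\<^sup>2 \<le> 1" using y by (auto intro: power_le_one)
      then show ?thesis using R by (simp add: norm_power)
    qed
    then have "ln (cmod (f (of_real (y\<^sup>2)))) = Re (H (of_real (y\<^sup>2)))" by (rule lnf)
    also have "\<dots> = y\<^sup>2 * Re (Q (of_real (y\<^sup>2)))" unfolding HQ by simp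
    finally have "ln (cmod (f (of_real (y\<^sup>2)))) * ((1 - y\<^sup>2) / y\<^sup>2) = Re (Q (of_real (y\<^sup>2))) * (1 - y\<^sup>2)"
      using y by simp
    also have "\<dots> = Re (Q (of_real (y\<^sup>2)) * of_real (1 - y\<^sup>2))" by simp
    also have "Q (of_real (y\<^sup>2)) * of_real (1 - y\<^sup>2) = M (of_real y)" by (simp add: M_def)
    finally show "ln (cmod (f (of_real (y\<^sup>2)))) * ((1 - y\<^sup>2) / y\<^sup>2) = Re (M (of_real y))" .
  qed auto
  have "((\<lambda>p. Re (H (cis (2 * p)) * of_real (2 * sin p))) has_integral Re (N (- 1) - N 1)) {0..pi}"
    by (rule has_integral_Re[OF arc])
  moreover have "Re (N (- 1) - N 1) = 0 - 2 * I"
    using arg_cong[OF half, of Re] by (simp add: I_def)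
  ultimately have "((\<lambda>p. ln (cmod (f (cis (2 * p)))) * (2 * sin p)) has_integral (0 - 2 * I)) {0..pi}"
    by (simp add: lnf[OF bd])
  with rad J show ?thesis unfolding disc_integrals_def by blast
qed


section \<open>The contribution of a single Blaschke factor\<close>

text \<open>The derivative of the sum vanishes on the right half-plane, and the constant is read off
  at 1. At the endpoint y = 1 the two \<open>Arctan\<close> terms of the radial primitive are of
  this form; this is how pi enters \<open>zero_weight\<close>.\<close>

lemma Arctan_inverse_add:
  assumes "0 < Re s"
  shows "Arctan (1 / s) + Arctan s = of_real pi / 2"
proof -
  let ?S = "{z. 0 < Re z}"
  have "((\<lambda>z. Arctan (1 / z) + Arctan z) has_field_derivative 0) (at z within ?S)" if z: "z \<in> ?S" for z
  proof -
    have nz: "z \<noteq> 0" using z by auto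
    have re: "Re (1 / z) > 0" using z nz by (auto simp: Re_divide power2_eq_square sum_squares_gt_zero_iff complex_eq_iff)
    have "1 + z\<^sup>2 \<noteq> 0"
    proof
      assume "1 + z\<^sup>2 = 0"
      then have "(z - \<i>) * (z + \<i>) = 0" by (simp add: algebra_simps power2_eq_square)
      then have "z = \<i> \<or> z = - \<i>" by (auto simp: eq_neg_iff_add_eq_0)
      then show False using z by auto
    qed
    then have "inverse (1 + (1 / z)\<^sup>2) * (- (1 / z\<^sup>2)) + inverse (1 + z\<^sup>2) = 0"
      using nz by (simp add: field_simps)
    moreover have "((\<lambda>z. 1 / z) has_field_derivative - (1 / z\<^sup>2)) (at z within ?S)"
      using nz by (auto intro!: derivative_eq_intros simp: power2_eq_square)
    then have "((\<lambda>z. Arctan (1 / z) + Arctan z) has_field_derivative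
        inverse (1 + (1 / z)\<^sup>2) * (- (1 / z\<^sup>2)) + inverse (1 + z\<^sup>2)) (at z within ?S)"
      using re z by (intro DERIV_add DERIV_chain2[OF has_field_derivative_Arctan]
          has_field_derivative_at_within[OF has_field_derivative_Arctan]) auto
    ultimately show ?thesis by simp
  qed
  then have "\<exists>c. \<forall>z\<in>?S. Arctan (1 / z) + Arctan z = c"
    by (intro has_field_derivative_zero_constant convex_halfspace_Re_gt)
  then obtain c where c: "\<And>z. z \<in> ?S \<Longrightarrow> Arctan (1 / z) + Arctan z = c"
    by blast
  from c[of s] c[of 1] assms have "Arctan (1 / s) + Arctan s = Arctan 1 + Arctan 1" by auto
  also have "Arctan 1 = of_real (pi / 4)" using Arctan_of_real[of 1] arctan_one by simp
  finally show ?thesis by simp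
qed

text \<open>Normalised to the value 1 at the origin instead of modulus 1 on the circle, where its
  modulus is 1/|\<rho>|.\<close>

definition blaschke :: "complex \<Rightarrow> complex \<Rightarrow> complex" where
  "blaschke \<rho> z = (1 - z / \<rho>) / (1 - cnj \<rho> * z)"

text \<open>For s = csqrt (- \<rho>) with Re s > 0, the point i*s is the square root of \<rho> in
  the upper half-plane, and i*(1/s - s) is the value there of the primitive -(y + 1/y) of the radial
  weight.\<close>

definition zero_weight :: "complex \<Rightarrow> real" where
  "zero_weight \<rho> = 2 * pi * Re (1 / csqrt (- \<rho>) - csqrt (- \<rho>))"

lemma Re_csqrt_minus_pos:
  assumes "\<rho> \<notin> \<real>\<^sub>\<ge>\<^sub>0"
  shows "0 < Re (csqrt (- \<rho>))"
proof (rule ccontr)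
  assume "\<not> 0 < Re (csqrt (- \<rho>))"
  then have 0: "Re (csqrt (- \<rho>)) = 0" using csqrt_principal[of "- \<rho>"] by auto
  have "- \<rho> = (csqrt (- \<rho>))\<^sup>2" by simp
  also have "\<dots> = - of_real ((Im (csqrt (- \<rho>)))\<^sup>2)"
    using 0 by (simp add: complex_eq_iff power2_eq_square)
  finally have "\<rho> = of_real ((Im (csqrt (- \<rho>)))\<^sup>2)" by simp
  then have "\<rho> \<in> \<real>\<^sub>\<ge>\<^sub>0" by (metis nonneg_Reals_of_real_iff zero_le_power2)
  with assms show False by simp
qed

lemma zero_weight_pos:
  assumes "\<rho> \<notin> \<real>\<^sub>\<ge>\<^sub>0" "cmod \<rho> < 1"
  shows "0 < zero_weight \<rho>"
proof -
  define s where "s = csqrt (- \<rho>)"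
  have s: "0 < Re s" using Re_csqrt_minus_pos[OF assms(1)] by (simp add: s_def)
  have "cmod s ^ 2 = cmod \<rho>" by (simp add: s_def flip: norm_power)
  then have n: "0 < (cmod s)\<^sup>2" "(cmod s)\<^sup>2 < 1" using assms s by auto
  have "Re (1 / s) = Re s / (cmod s)\<^sup>2" by (simp add: Re_divide cmod_power2)
  also have "\<dots> > Re s" using n s by (simp add: field_simps)
  finally show ?thesis by (simp add: zero_weight_def s_def)
qed

text \<open>The radial integrand has an explicit primitive, built from \<open>Ln\<close> and \<open>Arctan\<close>.\<close>

lemma has_integral_blaschke_radius:
  assumes nr: "\<rho> \<notin> \<real>\<^sub>\<ge>\<^sub>0" and lt: "cmod \<rho> < 1"
  shows "((\<lambda>y. ln (cmod (blaschke \<rho> (of_real (y\<^sup>2)))) * ((1 - y\<^sup>2) / y\<^sup>2)) has_integral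
      (2 * ln (cmod \<rho>) + zero_weight \<rho> / 2)) {0..1}"
proof -
  define s where "s = csqrt (- \<rho>)"
  have s: "0 < Re s" using Re_csqrt_minus_pos[OF nr] by (simp add: s_def)
  have s0: "s \<noteq> 0" using s by auto
  have s2: "s\<^sup>2 = - \<rho>" by (simp add: s_def)
  have ns: "cmod (s\<^sup>2) < 1" using lt s2 by simp
  \<comment> \<open>This is 1 - y^2/\<rho>; a value on the branch cut of \<open>Ln\<close> would put
    \<rho> on the nonnegative real axis.\<close>
  have L1: "1 + (of_real y)\<^sup>2 / s\<^sup>2 \<notin> \<real>\<^sub>\<le>\<^sub>0" for y :: real
  proof
    assume "1 + (of_real y)\<^sup>2 / s\<^sup>2 \<in> \<real>\<^sub>\<le>\<^sub>0"
    then obtain t where t: "t \<le> 0" "1 + (of_real y)\<^sup>2 / s\<^sup>2 = of_real t" by (auto elim: nonpos_Reals_cases)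
    then have "(of_real y)\<^sup>2 / s\<^sup>2 = of_real (t - 1)" by (simp add: algebra_simps)
    then have e: "(of_real y)\<^sup>2 = of_real (t - 1) * s\<^sup>2" using s0 by (simp add: field_simps)
    have "of_real (t - 1) \<noteq> (0::complex)" using t(1) by (simp add: complex_eq_iff)
    with e have "s\<^sup>2 = (of_real y)\<^sup>2 / of_real (t - 1)" by (simp add: field_simps)
    then have "\<rho> = of_real (y\<^sup>2 / (1 - t))" using s2 t(1)
      by (simp add: field_simps)
    moreover have "0 \<le> y\<^sup>2 / (1 - t)" using t(1) by simp
    ultimately show False using nr by (metis nonneg_Reals_of_real_iff)
  qed
  have L2: "1 + s\<^sup>2 * (of_real y)\<^sup>2 \<notin> \<real>\<^sub>\<le>\<^sub>0" if "y \<in> {0..1}" for y :: real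
  proof -
    have "y\<^sup>2 \<le> 1" using that by (auto intro: power_le_one)
    then have "cmod (s\<^sup>2 * (of_real y)\<^sup>2) \<le> cmod (s\<^sup>2) * 1"
      unfolding norm_mult by (intro mult_left_mono) (auto simp: norm_power)
    then have "\<bar>Re (s\<^sup>2 * (of_real y)\<^sup>2)\<bar> < 1"
      using ns abs_Re_le_cmod[of "s\<^sup>2 * (of_real y)\<^sup>2"] by linarith
    then have "0 < Re (1 + s\<^sup>2 * (of_real y)\<^sup>2)" by simp
    then show ?thesis by (auto simp: complex_nonpos_Reals_iff)
  qed
  \<comment> \<open>\<open>Arctan\<close> is differentiable off the parts of the imaginary axis
    beyond i and -i. As Re s > 0, the rays y/s and s*y meet the imaginary axis only at y =
    0.\<close>
  have T1: "\<bar>Im (of_real y / s)\<bar> < 1" if "0 \<le> y" "Re (of_real y / s) = 0" for y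
    using that s s0 by (auto simp: Re_divide Im_divide complex_eq_iff)
  have T2: "\<bar>Im (s * of_real y)\<bar> < 1" if "0 \<le> y" "Re (s * of_real y) = 0" for y
    using that s s0 by auto
  \<comment> \<open>A holomorphic function with real part ln |blaschke| on the radius: for real y
    the denominator 1 - cnj \<rho> * y^2 is replaced by its conjugate 1 + s^2 y^2, so that both
    logarithms depend on s alone.\<close>
  define C where "C = (\<lambda>z. Ln (1 + z\<^sup>2 / s\<^sup>2) - Ln (1 + s\<^sup>2 * z\<^sup>2))"
  \<comment> \<open>Integration by parts against -2(z + 1/z), the primitive of 2(1 - z^2)/z^2. What
    remains is a rational function whose partial fractions s/(s^2 + z^2) and s/(1 + s^2 z^2)
    integrate to the two \<open>Arctan\<close> terms.\<close>
  define A where "A = (\<lambda>z. - 2 * (z + 1 / z) * C z + 4 * (1 - s\<^sup>2) / s * (Arctan (z / s) + Arctan (s * z)))"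
  define C' where "C' = (\<lambda>z. (2 * z / s\<^sup>2) / (1 + z\<^sup>2 / s\<^sup>2) - (s\<^sup>2 * (2 * z)) / (1 + s\<^sup>2 * z\<^sup>2))"
  have dC: "(C has_field_derivative C' (of_real y)) (at (of_real y))" if "y \<in> {0..1}" for y :: real
  proof -
    have "((\<lambda>z. 1 + z\<^sup>2 / s\<^sup>2) has_field_derivative 2 * of_real y / s\<^sup>2) (at (of_real y))"
      using s0 by (auto intro!: derivative_eq_intros simp: power2_eq_square power4_eq_xxxx)
    from DERIV_chain2[OF has_field_derivative_Ln[OF L1] this]
    have 1: "((\<lambda>z. Ln (1 + z\<^sup>2 / s\<^sup>2)) has_field_derivative
        (2 * of_real y / s\<^sup>2) / (1 + (of_real y)\<^sup>2 / s\<^sup>2)) (at (of_real y))"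
      by (simp add: divide_inverse mult_ac)
    have "((\<lambda>z. 1 + s\<^sup>2 * z\<^sup>2) has_field_derivative s\<^sup>2 * (2 * of_real y)) (at (of_real y))"
      by (auto intro!: derivative_eq_intros)
    from DERIV_chain2[OF has_field_derivative_Ln[OF L2[OF that]] this]
    have 2: "((\<lambda>z. Ln (1 + s\<^sup>2 * z\<^sup>2)) has_field_derivative
        (s\<^sup>2 * (2 * of_real y)) / (1 + s\<^sup>2 * (of_real y)\<^sup>2)) (at (of_real y))"
      by (simp add: divide_inverse mult_ac)
    show ?thesis unfolding C_def C'_def by (rule DERIV_diff[OF 1 2])
  qed
  have dA: "(A has_field_derivative 2 * (1 - z\<^sup>2) / z\<^sup>2 * C z) (at z)"
    if y: "0 < y" "y \<le> 1" and z: "z = of_real y" for y z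
  proof -
    define a where "a = s\<^sup>2 + z\<^sup>2"
    define b where "b = 1 + s\<^sup>2 * z\<^sup>2"
    have z0: "z \<noteq> 0" using y z by auto
    have b0: "b \<noteq> 0" using L2[of y] y by (auto simp: b_def z)
    have "1 + z\<^sup>2 / s\<^sup>2 \<noteq> 0" using L1[of y] by (auto simp: z)
    then have a0: "a \<noteq> 0" using s0 by (auto simp: a_def field_simps)
    have C': "C' z = 2 * z / a - 2 * s\<^sup>2 * z / b"
      using s0 a0 by (simp add: C'_def a_def b_def divide_simps)
    have A1: "inverse (1 + (z / s)\<^sup>2) * (1 / s) = s / a"
      using s0 a0 by (simp add: a_def field_simps power2_eq_square)
    have A2: "inverse (1 + (s * z)\<^sup>2) * s = s / b"
      by (simp add: b_def power_mult_distrib divide_inverse)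
    \<comment> \<open>The cancellation rests on b - s^2 a = 1 - s^4 and a + b = (1 + s^2)(1 +
      z^2).\<close>
    have key: "- 2 * (z + 1 / z) * C' z + 4 * (1 - s\<^sup>2) / s * (s / a + s / b) = 0"
    proof -
      have "(- 2 * (z + 1 / z) * C' z + 4 * (1 - s\<^sup>2) / s * (s / a + s / b)) * (a * b) =
         - 4 * (z\<^sup>2 + 1) * (b - s\<^sup>2 * a) + 4 * (1 - s\<^sup>2) * (a + b)"
        unfolding C' using s0 z0 a0 b0 by (simp add: divide_simps) (simp add: algebra_simps power2_eq_square)
      also have "\<dots> = 0" by (simp add: a_def b_def algebra_simps power2_eq_square)
      finally show ?thesis using a0 b0 by simp
    qed
    have dC': "(C has_field_derivative C' z) (at z)" using dC[of y] y z by simp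
    have at1: "((\<lambda>z. Arctan (z / s)) has_field_derivative inverse (1 + (z / s)\<^sup>2) * (1 / s)) (at z)"
      using T1[of y] y z s0 by (intro DERIV_chain2[OF has_field_derivative_Arctan]) (auto intro!: derivative_eq_intros)
    have at2: "((\<lambda>z. Arctan (s * z)) has_field_derivative inverse (1 + (s * z)\<^sup>2) * s) (at z)"
      using T2[of y] y z s0 by (intro DERIV_chain2[OF has_field_derivative_Arctan]) (auto intro!: derivative_eq_intros)
    have "((\<lambda>z. - 2 * (z + 1 / z)) has_field_derivative - 2 * (1 - 1 / z\<^sup>2)) (at z)"
      using z0 by (auto intro!: derivative_eq_intros simp: power2_eq_square)
    from DERIV_add[OF DERIV_mult[OF this dC'] DERIV_cmult[OF DERIV_add[OF at1 at2], of "4 * (1 - s\<^sup>2) / s"]]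
    have "(A has_field_derivative (- 2 * (1 - 1 / z\<^sup>2)) * C z + C' z * (- 2 * (z + 1 / z)) +
        4 * (1 - s\<^sup>2) / s * (s / a + s / b)) (at z)"
      unfolding A1 A2 A_def .
    also have "(- 2 * (1 - 1 / z\<^sup>2)) * C z + C' z * (- 2 * (z + 1 / z)) +
        4 * (1 - s\<^sup>2) / s * (s / a + s / b) = (- 2 * (1 - 1 / z\<^sup>2)) * C z"
      using key by (simp add: algebra_simps)
    also have "(- 2 * (1 - 1 / z\<^sup>2)) = 2 * (1 - z\<^sup>2) / z\<^sup>2" using z0 by (simp add: field_simps)
    finally show ?thesis .
  qed
  have cont: "continuous_on {0..1} (\<lambda>y. A (of_real y))"
    unfolding continuous_on_eq_continuous_within
  proof
    fix y :: real assume y: "y \<in> {0..1}"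
    show "continuous (at y within {0..1}) (\<lambda>y. A (of_real y))"
    proof (cases "y = 0")
      case False
      then have "isCont A (of_real y)" using y by (intro DERIV_isCont[OF dA[of y]]) auto
      then show ?thesis
        by (rule continuous_at_imp_continuous_within[OF isCont_o2[of y of_real A, OF continuous_of_real[OF continuous_ident]]])
    next
      \<comment> \<open>At 0 the term 1/z has the default value 0, so A 0 = 0. This is also the
        limit, because C(z)/z tends to C'(0) = 0.\<close>
      case True
      have C0: "C 0 = 0" "C' 0 = 0" by (simp_all add: C_def C'_def)
      have "(\<lambda>h. (C (0 + h) - C 0) / h) \<midarrow>0\<rightarrow> C' 0"
        using dC[of 0] by (simp add: DERIV_def)
      then have *: "(\<lambda>h. C h / h) \<midarrow>0\<rightarrow> 0" by (simp add: C0)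
      have cC: "C \<midarrow>0\<rightarrow> 0" using DERIV_isCont[OF dC[of 0]] C0 by (simp add: isCont_def)
      have "isCont (\<lambda>z. Arctan (z / s) + Arctan (s * z)) 0"
        by (intro continuous_add isCont_o2[where g = Arctan and f = "\<lambda>z. z / s"]
            isCont_o2[where g = Arctan and f = "\<lambda>z. s * z"] continuous_at_Arctan)
          (use s0 in \<open>auto intro!: continuous_intros\<close>)
      then have cT: "(\<lambda>z. Arctan (z / s) + Arctan (s * z)) \<midarrow>0\<rightarrow> 0" by (simp add: isCont_def)
      have "(\<lambda>z. - 2 * (z * C z + C z / z) + 4 * (1 - s\<^sup>2) / s * (Arctan (z / s) + Arctan (s * z))) \<midarrow>0\<rightarrow>
         - 2 * (0 * 0 + 0) + 4 * (1 - s\<^sup>2) / s * 0"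
        by (intro tendsto_intros * cC cT)
      then have "A \<midarrow>0\<rightarrow> 0" unfolding A_def by (simp add: algebra_simps)
      moreover have "A 0 = 0" by (simp add: A_def)
      ultimately have "isCont A (of_real y)" using True by (simp add: isCont_def)
      then show ?thesis
        by (rule continuous_at_imp_continuous_within[OF isCont_o2[of y of_real A, OF continuous_of_real[OF continuous_ident]]])
    qed
  qed
  have "((\<lambda>y. 2 * (1 - (of_real y)\<^sup>2) / (of_real y)\<^sup>2 * C (of_real y)) has_integral A (of_real 1) - A (of_real 0)) {0..1}"
  proof (rule fundamental_theorem_of_calculus_interior[OF _ cont])
    fix x :: real assume "x \<in> {0<..<1}"
    then show "((\<lambda>y. A (of_real y)) has_vector_derivative
        2 * (1 - (of_real x)\<^sup>2) / (of_real x)\<^sup>2 * C (of_real x)) (at x)"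
      by (intro has_vector_derivative_real_field dA[of x]) auto
  qed auto
  from has_integral_Re[OF this]
  have int: "((\<lambda>y. Re (2 * (1 - (of_real y)\<^sup>2) / (of_real y)\<^sup>2 * C (of_real y))) has_integral Re (A 1)) {0..1}"
    by (simp add: A_def)
  have eq: "Re (2 * (1 - (of_real y)\<^sup>2) / (of_real y)\<^sup>2 * C (of_real y)) =
      2 * (ln (cmod (blaschke \<rho> (of_real (y\<^sup>2)))) * ((1 - y\<^sup>2) / y\<^sup>2))" if "y \<in> {0..1}" for y
  proof -
    have n1: "1 + (of_real y)\<^sup>2 / s\<^sup>2 \<noteq> 0" using L1[of y] by auto
    have n2: "1 + s\<^sup>2 * (of_real y)\<^sup>2 \<noteq> 0" using L2[OF that] by auto
    have "1 - cnj \<rho> * of_real (y\<^sup>2) = cnj (1 + s\<^sup>2 * (of_real y)\<^sup>2)" by (simp add: s2)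
    then have c: "cmod (1 - cnj \<rho> * of_real (y\<^sup>2)) = cmod (1 + s\<^sup>2 * (of_real y)\<^sup>2)"
      by (metis complex_mod_cnj)
    have "ln (cmod (blaschke \<rho> (of_real (y\<^sup>2)))) = ln (cmod (1 + (of_real y)\<^sup>2 / s\<^sup>2)) - ln (cmod (1 + s\<^sup>2 * (of_real y)\<^sup>2))"
      unfolding blaschke_def norm_divide c using n1 n2 by (subst ln_div) (auto simp: s2)
    also have "\<dots> = Re (C (of_real y))" using n1 n2 by (simp add: C_def)
    finally have e: "ln (cmod (blaschke \<rho> (of_real (y\<^sup>2)))) = Re (C (of_real y))" .
    have "2 * (1 - (of_real y)\<^sup>2) / (of_real y)\<^sup>2 = (of_real (2 * ((1 - y\<^sup>2) / y\<^sup>2)) :: complex)" by simp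
    then show ?thesis
      unfolding e by (simp only: times_complex.sel Re_complex_of_real Im_complex_of_real) simp
  qed
  have A1: "Re (A 1) = 4 * ln (cmod \<rho>) + zero_weight \<rho>"
  proof -
    have n1: "1 + s\<^sup>2 \<noteq> 0" using L2[of 1] by auto
    have n2: "1 + 1 / s\<^sup>2 \<noteq> 0" using L1[of 1] by auto
    have "1 + 1 / s\<^sup>2 = (1 + s\<^sup>2) / s\<^sup>2" using s0 by (simp add: field_simps)
    then have "ln (cmod (1 + 1 / s\<^sup>2)) = ln (cmod (1 + s\<^sup>2)) - ln (cmod (s\<^sup>2))"
      using n1 s0 by (simp add: norm_divide ln_div)
    then have "Re (C 1) = - ln (cmod \<rho>)" using n1 n2 s2 by (simp add: C_def)
    moreover have "A 1 = - 4 * C 1 + 4 * (1 - s\<^sup>2) / s * (of_real pi / 2)"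
      by (simp add: A_def Arctan_inverse_add[OF s])
    moreover have "4 * (1 - s\<^sup>2) / s * (of_real pi / 2) = of_real (2 * pi) * (1 / s - s)"
      using s0 by (simp add: field_simps power2_eq_square)
    ultimately show ?thesis by (simp add: zero_weight_def s_def)
  qed
  have "((\<lambda>y. 2 * (ln (cmod (blaschke \<rho> (of_real (y\<^sup>2)))) * ((1 - y\<^sup>2) / y\<^sup>2))) has_integral
      (4 * ln (cmod \<rho>) + zero_weight \<rho>)) {0..1}"
    using has_integral_eq[OF eq int] unfolding A1 .
  from has_integral_mult_right[OF this, of "1/2"]
  show ?thesis by (simp add: algebra_simps)
qed


lemma norm_blaschke_circle:
  assumes "cmod z = 1" "\<rho> \<noteq> 0" "cmod \<rho> < 1"
  shows "cmod (blaschke \<rho> z) = 1 / cmod \<rho>"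
proof -
  have z: "z * cnj z = 1" using assms(1) by (simp add: complex_norm_square[symmetric])
  have "1 - cnj \<rho> * z = z * cnj (z - \<rho>)"
    using z by (simp add: algebra_simps)
  then have "cmod (1 - cnj \<rho> * z) = cmod (z - \<rho>)"
    by (metis assms(1) complex_mod_cnj mult_1 norm_mult)
  moreover have "1 - z / \<rho> = - (z - \<rho>) / \<rho>" using assms(2) by (simp add: field_simps)
  then have "cmod (1 - z / \<rho>) = cmod (z - \<rho>) / cmod \<rho>" by (simp add: norm_divide norm_minus_commute)
  moreover have "cmod (z - \<rho>) \<noteq> 0" using assms by auto
  ultimately show ?thesis by (simp add: blaschke_def norm_divide)
qed

text \<open>On the circle the logarithm is the constant -ln |\<rho>| and the weight has integral 4;
  twice the radial integral is 4 ln |\<rho>| + zero_weight \<rho>. The logarithms cancel and only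
  the weight of the zero is left.\<close>

lemma disc_integrals_blaschke:
  assumes nr: "\<rho> \<notin> \<real>\<^sub>\<ge>\<^sub>0" and lt: "cmod \<rho> < 1"
  shows "disc_integrals (blaschke \<rho>) (- pi * ln (cmod \<rho>)) (zero_weight \<rho>)"
proof -
  have r0: "\<rho> \<noteq> 0" using nr by auto
  have ln: "ln (cmod (blaschke \<rho> (cis t))) = - ln (cmod \<rho>)" for t
    using norm_blaschke_circle[of "cis t" \<rho>] r0 lt by (simp add: ln_div)
  have "((\<lambda>p. - ln (cmod \<rho>)) has_integral (- ln (cmod \<rho>)) * (pi - 0)) {0..pi}"
    using has_integral_const_real[of "- ln (cmod \<rho>)" 0 pi] by (simp add: mult.commute)
  then have 1: "((\<lambda>p. ln (cmod (blaschke \<rho> (cis (2 * p))))) has_integral (- pi * ln (cmod \<rho>))) {0..pi}"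
    unfolding ln by (simp add: mult.commute)
  have "((\<lambda>p. sin p) has_integral (- cos pi - - cos 0)) {0..pi}"
    by (rule fundamental_theorem_of_calculus)
      (auto intro!: derivative_eq_intros simp flip: has_real_derivative_iff_has_vector_derivative)
  from has_integral_mult_right[OF this, of "- 2 * ln (cmod \<rho>)"]
  have 2: "((\<lambda>p. ln (cmod (blaschke \<rho> (cis (2 * p)))) * (2 * sin p)) has_integral
      (zero_weight \<rho> - 2 * (2 * ln (cmod \<rho>) + zero_weight \<rho> / 2))) {0..pi}"
    unfolding ln by (simp add: algebra_simps)
  show ?thesis
    unfolding disc_integrals_def using 1 2 has_integral_blaschke_radius[OF assms] by blast
qed

section \<open>Removing the zeros one at a time\<close>

text \<open>The local factorisation at \<rho> becomes global: the cofactor is f/(z - \<rho>)^n away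
  from \<rho> and the local factor near \<rho>, and the two agree on the overlap.\<close>

lemma holomorphic_factor_zero:
  assumes hol: "f holomorphic_on A" and A: "open A" "connected A" and r: "\<rho> \<in> A" "f \<rho> = 0"
    and nc: "\<not> f constant_on A"
  obtains g n where "0 < n" "g holomorphic_on A" "g \<rho> \<noteq> 0" "\<And>z. z \<in> A \<Longrightarrow> f z = (z - \<rho>) ^ n * g z"
proof -
  obtain h e n where h: "0 < n" "0 < e" "ball \<rho> e \<subseteq> A" "h holomorphic_on ball \<rho> e"
      "\<And>w. w \<in> ball \<rho> e \<Longrightarrow> f w = (w - \<rho>) ^ n * h w" "\<And>w. w \<in> ball \<rho> e \<Longrightarrow> h w \<noteq> 0"
    by (rule holomorphic_factor_zero_nonconstant[OF hol A r nc]) (rule that)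
  define g where "g = (\<lambda>z. if z = \<rho> then h \<rho> else f z / (z - \<rho>) ^ n)"
  have g1: "g z = h z" if "z \<in> ball \<rho> e" for z using h(5)[OF that] by (auto simp: g_def)
  have "g holomorphic_on ball \<rho> e" using holomorphic_transform[OF h(4)] g1 by auto
  moreover have "g holomorphic_on (A - {\<rho>})"
  proof (rule holomorphic_transform)
    show "(\<lambda>z. f z / (z - \<rho>) ^ n) holomorphic_on (A - {\<rho>})"
      using hol by (intro holomorphic_intros) (auto intro: holomorphic_on_subset)
  qed (auto simp: g_def)
  ultimately have "g holomorphic_on (ball \<rho> e \<union> (A - {\<rho>}))"
    using A by (intro holomorphic_on_Un) auto
  moreover have "ball \<rho> e \<union> (A - {\<rho>}) = A" using h(2,3) r by auto
  ultimately have "g holomorphic_on A" by simp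
  moreover have "f z = (z - \<rho>) ^ n * g z" for z
    using h(1) r(2) by (auto simp: g_def)
  moreover have "g \<rho> \<noteq> 0" using h(2,6) by (auto simp: g_def)
  ultimately show ?thesis using that h(1) by blast
qed

text \<open>Induction on the number of zeros in the closed disc; each step divides out one zero with
  its full multiplicity. Zeros on the radius are excluded, so every weight added is positive. The
  part 0 <= J is Jensen's inequality for f 0 = 1.\<close>

lemma disc_integrals_zeros:
  assumes "f holomorphic_on ball 0 R" "1 < R" "f 0 = 1"
    and "\<And>z. cmod z = 1 \<Longrightarrow> f z \<noteq> 0" "\<And>x. x \<in> {0..1} \<Longrightarrow> f (of_real x) \<noteq> 0"
  shows "\<exists>J K. disc_integrals f J K \<and> 0 \<le> J \<and> 0 \<le> K \<and>
     ((\<forall>z\<in>ball 0 1. f z \<noteq> 0) \<longrightarrow> K = 0) \<and> (\<forall>\<rho>\<in>ball 0 1. f \<rho> = 0 \<longrightarrow> zero_weight \<rho> \<le> K)"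
  using assms
proof (induction "card {z \<in> cball 0 1. f z = 0}" arbitrary: f rule: less_induct)
  case (less f)
  note hol = less.prems(1) and R = less.prems(2) and f0 = less.prems(3)
    and circ = less.prems(4) and rad = less.prems(5)
  show ?case
  proof (cases "\<exists>\<rho>\<in>ball 0 1. f \<rho> = 0")
    case False
    then have nz: "f z \<noteq> 0" if "cmod z \<le> 1" for z
      using circ[of z] that by (cases "cmod z = 1") auto
    have "open (ball 0 R \<inter> f -` (- {0}))"
      by (rule continuous_open_preimage[OF holomorphic_on_imp_continuous_on[OF hol]]) auto
    also have "ball 0 R \<inter> f -` (- {0}) = {z \<in> ball 0 R. f z \<noteq> 0}" by auto
    finally have op: "open {z \<in> ball 0 R. f z \<noteq> 0}" .
    have sub: "cball 0 1 \<subseteq> {z \<in> ball 0 R. f z \<noteq> 0}" using nz R by auto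
    \<comment> \<open>By compactness the zero-free closed disc has a zero-free neighbourhood of
      uniform width \<open>e\<close>; radial projection shows that it contains the ball of radius 1
      + e.\<close>
    obtain e where e: "0 < e" "(\<Union>x\<in>cball 0 1. ball x e) \<subseteq> {z \<in> ball 0 R. f z \<noteq> 0}"
      by (rule compact_subset_open_imp_ball_epsilon_subset[OF compact_cball op sub])
    have sub: "ball 0 (1 + e) \<subseteq> {z \<in> ball 0 R. f z \<noteq> 0}"
    proof
      fix z :: complex assume z: "z \<in> ball 0 (1 + e)"
      have "\<exists>x\<in>cball 0 1. z \<in> ball x e"
      proof (cases "cmod z \<le> 1")
        case True
        then show ?thesis using e(1) by (intro bexI[of _ z]) auto
      next
        case False
        have "z - z /\<^sub>R cmod z = (1 - 1 / cmod z) *\<^sub>R z"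
          by (simp add: scaleR_left_diff_distrib divide_inverse)
        then have "dist (z /\<^sub>R cmod z) z = \<bar>1 - 1 / cmod z\<bar> * cmod z"
          by (metis dist_commute dist_norm norm_scaleR)
        also have "\<dots> = cmod z - 1"
          using False by (auto simp: field_simps abs_if)
        finally show ?thesis using z False by (intro bexI[of _ "z /\<^sub>R cmod z"]) (auto simp: field_simps)
      qed
      then show "z \<in> {z \<in> ball 0 R. f z \<noteq> 0}" using e(2) by blast
    qed
    have "disc_integrals f 0 0"
      using sub e(1) f0 by (intro disc_integrals_nonvanishing[of f "1 + e"] holomorphic_on_subset[OF hol]) auto
    with False show ?thesis by (intro exI[of _ 0]) auto
  next
    case True
    then obtain \<rho> where r: "cmod \<rho> < 1" "f \<rho> = 0" by auto
    have nr: "\<rho> \<notin> \<real>\<^sub>\<ge>\<^sub>0"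
    proof
      assume "\<rho> \<in> \<real>\<^sub>\<ge>\<^sub>0"
      then obtain x where "\<rho> = of_real x" "0 \<le> x" by (auto elim: nonneg_Reals_cases)
      with r rad[of x] show False by auto
    qed
    then have r0: "\<rho> \<noteq> 0" by auto
    have nc: "\<not> f constant_on ball 0 R"
    proof
      assume "f constant_on ball 0 R"
      moreover have "\<rho> \<in> ball 0 R" "0 \<in> ball 0 R" using r R by auto
      ultimately have "f \<rho> = f 0" unfolding constant_on_def by metis
      with r f0 show False by simp
    qed
    have rR: "\<rho> \<in> ball 0 R" using r R by auto
    obtain h n where h: "0 < n" "h holomorphic_on ball 0 R" "h \<rho> \<noteq> 0"
        "\<And>z. z \<in> ball 0 R \<Longrightarrow> f z = (z - \<rho>) ^ n * h z"
      by (rule holomorphic_factor_zero[OF hol open_ball connected_ball rR r(2) nc]) (rule that)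
    \<comment> \<open>This is f / blaschke^n on the closed disc, written without the division so
      that it is holomorphic on all of \<open>ball 0 R\<close>, where the pole 1/cnj \<rho> of the
      Blaschke factor may lie.\<close>
    define g where "g = (\<lambda>z. h z * ((- \<rho>) * (1 - cnj \<rho> * z)) ^ n)"
    have nb: "1 - cnj \<rho> * z \<noteq> 0" if "cmod z \<le> 1" for z
    proof
      assume "1 - cnj \<rho> * z = 0"
      then have "cmod \<rho> * cmod z = 1" by (metis complex_mod_cnj eq_iff_diff_eq_0 norm_mult norm_one)
      moreover have "cmod \<rho> * cmod z \<le> cmod \<rho> * 1" using that by (intro mult_left_mono) auto
      ultimately show False using r by simp
    qed
    have fg: "f z = blaschke \<rho> z ^ n * g z" if "cmod z \<le> 1" for z
    proof -
      have "f z = (z - \<rho>) ^ n * h z" using h(4) that R by auto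
      also have "z - \<rho> = blaschke \<rho> z * ((- \<rho>) * (1 - cnj \<rho> * z))"
        using nb[OF that] r0 by (simp add: blaschke_def field_simps)
      finally show ?thesis unfolding g_def power_mult_distrib by (simp only: mult_ac)
    qed
    have g: "g holomorphic_on ball 0 R" unfolding g_def by (intro holomorphic_intros h)
    have g0: "g 0 = 1" using fg[of 0] f0 by (simp add: blaschke_def)
    have zg: "f z = 0 \<longleftrightarrow> z = \<rho> \<or> g z = 0" if "cmod z \<le> 1" for z
    proof -
      have "blaschke \<rho> z = 0 \<longleftrightarrow> z = \<rho>"
        using nb[OF that] r0 by (auto simp: blaschke_def)
      then show ?thesis using fg[OF that] h(1) by simp
    qed
    have gr: "g \<rho> \<noteq> 0" using h(3) r0 nb[of \<rho>] r by (simp add: g_def)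
    have fin: "finite {z \<in> cball 0 1. f z = 0}"
      by (rule holomorphic_compact_finite_zeros[OF hol open_ball connected_ball compact_cball _ nc]) (use R in auto)
    have "{z \<in> cball 0 1. g z = 0} \<subset> {z \<in> cball 0 1. f z = 0}"
      using zg gr r by auto
    then have "card {z \<in> cball 0 1. g z = 0} < card {z \<in> cball 0 1. f z = 0}"
      by (rule psubset_card_mono[OF fin])
    moreover have gc: "g z \<noteq> 0" if "cmod z = 1" for z using circ zg that by auto
    moreover have gx: "g (of_real x) \<noteq> 0" if "x \<in> {0..1}" for x using rad[OF that] zg[of "of_real x"] that by auto
    ultimately obtain J K where JK: "disc_integrals g J K" "0 \<le> J" "0 \<le> K"
       "\<forall>\<rho>\<in>ball 0 1. g \<rho> = 0 \<longrightarrow> zero_weight \<rho> \<le> K"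
      using less.hyps[of g] g R g0 by blast
    have bc: "blaschke \<rho> z \<noteq> 0" if "cmod z = 1" for z
      using norm_blaschke_circle[OF that r0 r(1)] r0 by auto
    have bx: "blaschke \<rho> (of_real x) \<noteq> 0" if "x \<in> {0..1}" for x
      using fg[of "of_real x"] rad[OF that] that h(1) by (auto simp: zero_power)
    have "disc_integrals (\<lambda>z. blaschke \<rho> z ^ n * g z) (real n * (- pi * ln (cmod \<rho>)) + J) (real n * zero_weight \<rho> + K)"
      by (rule disc_integrals_mult[OF disc_integrals_power[OF disc_integrals_blaschke[OF nr r(1)] bc bx] JK(1)])
        (use bc bx gc gx in auto)
    then have "disc_integrals f (real n * (- pi * ln (cmod \<rho>)) + J) (real n * zero_weight \<rho> + K)"
    proof -
      assume *: "disc_integrals (\<lambda>z. blaschke \<rho> z ^ n * g z) (real n * (- pi * ln (cmod \<rho>)) + J) (real n * zero_weight \<rho> + K)"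
      have c: "f (cis (2 * p)) = blaschke \<rho> (cis (2 * p)) ^ n * g (cis (2 * p))" for p by (rule fg) simp
      have x: "f (of_real (y\<^sup>2)) = blaschke \<rho> (of_real (y\<^sup>2)) ^ n * g (of_real (y\<^sup>2))" if "y \<in> {0..1}" for y
      proof (rule fg)
        have "y\<^sup>2 \<le> 1" using that by (auto intro: power_le_one)
        then show "cmod (of_real (y\<^sup>2)) \<le> 1" by (simp add: norm_power)
      qed
      have "((\<lambda>y. ln (cmod (f (of_real (y\<^sup>2)))) * ((1 - y\<^sup>2) / y\<^sup>2)) has_integral I) {0..1} \<longleftrightarrow>
          ((\<lambda>y. ln (cmod (blaschke \<rho> (of_real (y\<^sup>2)) ^ n * g (of_real (y\<^sup>2)))) * ((1 - y\<^sup>2) / y\<^sup>2)) has_integral I) {0..1}" for I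
        by (intro has_integral_cong) (simp only: x)
      with * show ?thesis unfolding disc_integrals_def c by blast
    qed
    moreover have "0 \<le> - pi * ln (cmod \<rho>)" using r r0 by (intro mult_nonpos_nonpos) auto
    then have "0 \<le> real n * (- pi * ln (cmod \<rho>)) + J"
      using JK(2) by (simp only: add_nonneg_nonneg mult_nonneg_nonneg of_nat_0_le_iff)
    moreover have w: "0 < zero_weight \<rho>" by (rule zero_weight_pos[OF nr r(1)])
    then have wn: "zero_weight \<rho> \<le> real n * zero_weight \<rho>" using h(1)
      by (simp add: mult_le_cancel_right1)
    have "0 \<le> real n * zero_weight \<rho> + K" using w JK(3) by auto
    moreover have "zero_weight z \<le> real n * zero_weight \<rho> + K" if "z \<in> ball 0 1" "f z = 0" for z
    proof (cases "z = \<rho>")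
      case True
      then show ?thesis using wn JK(3) by simp
    next
      case False
      then have "zero_weight z \<le> K" using JK(4) zg[of z] that by auto
      then show ?thesis using w by (simp add: add_increasing)
    qed
    moreover have "\<rho> \<in> ball 0 1" using r by auto
    ultimately show ?thesis using r(2) by blast
  qed
qed

section \<open>Passage to the boundary\<close>

lemma integrable_Ioo_iff:
  "integrable (restrict_space lborel {a<..<b::real}) f \<longleftrightarrow> set_integrable lborel {a<..<b} f"
  for f :: "real \<Rightarrow> real"
  unfolding set_integrable_def by (rule integrable_restrict_space) simp

lemma integral_Ioo_eq:
  "integral\<^sup>L (restrict_space lborel {a<..<b::real}) f = (LBINT x:{a<..<b}. f x)"
  for f :: "real \<Rightarrow> real"
  unfolding set_lebesgue_integral_def by (rule integral_restrict_space) simp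

lemma has_integral_imp_integral_Ioo:
  fixes f :: "real \<Rightarrow> real"
  assumes "integrable (restrict_space lborel {a<..<b}) f" "(f has_integral i) {a..b}"
  shows "integral\<^sup>L (restrict_space lborel {a<..<b}) f = i"
  using assms set_borel_integral_eq_integral(2)[of "{a<..<b}" f]
  by (simp add: integrable_Ioo_iff integral_Ioo_eq has_integral_Icc_iff_Ioo integral_unique)

lemma measurable_Ioo_continuous:
  fixes f :: "real \<Rightarrow> 'a::topological_space"
  assumes "continuous_on {a<..<b} f"
  shows "f \<in> borel_measurable (restrict_space lborel {a<..<b})"
proof -
  have "sets (restrict_space lborel {a<..<b}) = sets (restrict_space borel {a<..<b})"
    by (intro sets_restrict_space_cong) simp
  then show ?thesis
    using borel_measurable_continuous_on_restrict[OF assms]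
    by (simp cong: measurable_cong_sets)
qed

lemma finite_measure_Ioo: "finite_measure (restrict_space lborel {a<..<b::real})"
  by (cases "a \<le> b") (auto intro!: finite_measureI simp: emeasure_restrict_space space_restrict_space)

lemma AE_Ioo_countable:
  assumes "countable X"
  shows "AE x in restrict_space lborel {a<..<b::real}. x \<notin> X"
proof -
  have "AE x in lborel. x \<notin> X" by (rule AE_not_in[OF countable_imp_null_set_lborel[OF assms]])
  then show ?thesis by (subst AE_restrict_space_iff) auto
qed

text \<open>An upper bound together with a lower bound for the integrals controls the absolute values,
  since \<open>\<bar>u\<bar> \<le> 2 D - u\<close>; Fatou's lemma carries this over to the limit.\<close>

lemma integrable_limit_one_sided:
  fixes u :: "nat \<Rightarrow> 'a \<Rightarrow> real"
  assumes int: "\<And>n. integrable M (u n)" and v: "v \<in> borel_measurable M"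
    and D: "integrable M D" "\<And>x. 0 \<le> D x" and le: "\<And>n. AE x in M. u n x \<le> D x"
    and nonneg: "\<And>n. 0 \<le> integral\<^sup>L M (u n)"
    and lim: "AE x in M. (\<lambda>n. u n x) \<longlonglongrightarrow> v x"
  shows "integrable M v" "(\<integral>x. \<bar>v x\<bar> \<partial>M) \<le> 2 * integral\<^sup>L M D"
    "(\<integral>x. \<bar>u n x\<bar> \<partial>M) \<le> 2 * integral\<^sup>L M D"
proof -
  have un: "(\<integral>x. \<bar>u n x\<bar> \<partial>M) \<le> 2 * integral\<^sup>L M D" for n
  proof -
    have "(\<integral>x. \<bar>u n x\<bar> \<partial>M) \<le> (\<integral>x. 2 * D x - u n x \<partial>M)"
      using le[of n]
    proof (intro integral_mono_AE)
      show "AE x in M. \<bar>u n x\<bar> \<le> 2 * D x - u n x"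
        using le[of n] by eventually_elim (use D(2) in \<open>smt (verit)\<close>)
    qed (use int D in auto)
    also have "\<dots> = 2 * integral\<^sup>L M D - integral\<^sup>L M (u n)"
      using int D by (subst Bochner_Integration.integral_diff) auto
    finally show ?thesis using nonneg[of n] by simp
  qed
  then show "(\<integral>x. \<bar>u n x\<bar> \<partial>M) \<le> 2 * integral\<^sup>L M D" .
  have meas: "u n \<in> borel_measurable M" for n using int by auto
  have "(\<integral>\<^sup>+x. ennreal \<bar>v x\<bar> \<partial>M) = (\<integral>\<^sup>+x. liminf (\<lambda>n. ennreal \<bar>u n x\<bar>) \<partial>M)"
  proof (rule nn_integral_cong_AE)
    show "AE x in M. ennreal \<bar>v x\<bar> = liminf (\<lambda>n. ennreal \<bar>u n x\<bar>)"
      using lim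
    proof eventually_elim
      case (elim x)
      then have "(\<lambda>n. ennreal \<bar>u n x\<bar>) \<longlonglongrightarrow> ennreal \<bar>v x\<bar>"
        by (intro tendsto_ennrealI tendsto_rabs)
      then show ?case by (intro lim_imp_Liminf[symmetric]) auto
    qed
  qed
  also have "\<dots> \<le> liminf (\<lambda>n. \<integral>\<^sup>+x. ennreal \<bar>u n x\<bar> \<partial>M)"
    using meas by (intro nn_integral_liminf) auto
  also have "\<dots> \<le> ennreal (2 * integral\<^sup>L M D)"
  proof -
    have "(\<integral>\<^sup>+x. ennreal \<bar>u n x\<bar> \<partial>M) \<le> ennreal (2 * integral\<^sup>L M D)" for n
      using un[of n] int[of n] by (subst nn_integral_eq_integral) (auto intro: ennreal_leI)
    then show ?thesis by (intro Liminf_le) auto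
  qed
  finally have *: "(\<integral>\<^sup>+x. ennreal \<bar>v x\<bar> \<partial>M) \<le> ennreal (2 * integral\<^sup>L M D)" .
  then show iv: "integrable M v"
    using v by (intro integrableI_bounded) (auto simp: le_less_trans)
  have "ennreal (\<integral>x. \<bar>v x\<bar> \<partial>M) \<le> ennreal (2 * integral\<^sup>L M D)"
    using * iv by (subst nn_integral_eq_integral[symmetric]) auto
  then show "(\<integral>x. \<bar>v x\<bar> \<partial>M) \<le> 2 * integral\<^sup>L M D"
    using D by (subst (asm) ennreal_le_iff) auto
qed

text \<open>Bounded integrals of |u n| do not prevent mass from concentrating. Where the weight is
  at most e, such mass changes the integral by at most e * B, for the sequence and the limit alike;
  on the rest, convergence is assumed.\<close>

lemma tendsto_integral_weighted:
  fixes u :: "nat \<Rightarrow> 'a \<Rightarrow> real"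
  assumes int: "\<And>n. integrable M (u n)" "integrable M v"
    and B: "\<And>n. (\<integral>x. \<bar>u n x\<bar> \<partial>M) \<le> B" "(\<integral>x. \<bar>v x\<bar> \<partial>M) \<le> B"
    and W: "W \<in> borel_measurable M" "\<And>x. \<bar>W x\<bar> \<le> C"
    and loc: "\<And>e. 0 < e \<Longrightarrow> \<exists>E\<in>sets M. (\<forall>x\<in>space M - E. \<bar>W x\<bar> \<le> e) \<and>
        (\<lambda>n. \<integral>x. indicator E x * (u n x * W x) \<partial>M) \<longlonglongrightarrow> (\<integral>x. indicator E x * (v x * W x) \<partial>M)"
  shows "(\<lambda>n. \<integral>x. u n x * W x \<partial>M) \<longlonglongrightarrow> (\<integral>x. v x * W x \<partial>M)"
proof (rule LIMSEQ_I)
  fix r :: real assume r: "0 < r"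
  have B0: "0 \<le> B" using order_trans[OF _ B(2)] by simp
  \<comment> \<open>Two tails of size e * B have to stay below r / 2; B + 1 instead of B keeps the
    denominator positive.\<close>
  define e where "e = r / (4 * (B + 1))"
  have e: "0 < e" using r B0 by (simp add: e_def)
  obtain E where E: "E \<in> sets M" "\<And>x. x \<in> space M - E \<Longrightarrow> \<bar>W x\<bar> \<le> e"
     "(\<lambda>n. \<integral>x. indicator E x * (u n x * W x) \<partial>M) \<longlonglongrightarrow> (\<integral>x. indicator E x * (v x * W x) \<partial>M)"
    using loc[OF e] by blast
  have tail: "\<bar>(\<integral>x. f x * W x \<partial>M) - (\<integral>x. indicator E x * (f x * W x) \<partial>M)\<bar> \<le> e * B"
    if f: "integrable M f" "(\<integral>x. \<bar>f x\<bar> \<partial>M) \<le> B" for f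
  proof -
    have C0: "0 \<le> C" using W(2) abs_ge_zero order_trans by blast
    have fW: "integrable M (\<lambda>x. f x * W x)"
    proof (rule Bochner_Integration.integrable_bound)
      show "integrable M (\<lambda>x. C * f x)" using f by simp
      show "AE x in M. norm (f x * W x) \<le> norm (C * f x)"
        using W(2) C0 by (auto simp: abs_mult mult.commute[of "\<bar>f _\<bar>"] intro!: mult_right_mono)
    qed (use f W in auto)
    have fWE: "integrable M (\<lambda>x. indicator E x * (f x * W x))"
      using integrable_mult_indicator[OF E(1) fW] by simp
    have "\<bar>(\<integral>x. f x * W x \<partial>M) - (\<integral>x. indicator E x * (f x * W x) \<partial>M)\<bar> =
        \<bar>\<integral>x. f x * W x - indicator E x * (f x * W x) \<partial>M\<bar>"
      using fW fWE by simp
    also have "\<dots> \<le> (\<integral>x. \<bar>f x * W x - indicator E x * (f x * W x)\<bar> \<partial>M)"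
      by (rule integral_abs_bound)
    also have "\<dots> \<le> (\<integral>x. e * \<bar>f x\<bar> \<partial>M)"
    proof (rule integral_mono)
      fix x assume "x \<in> space M"
      then show "\<bar>f x * W x - indicator E x * (f x * W x)\<bar> \<le> e * \<bar>f x\<bar>"
        using E(2)[of x] e by (cases "x \<in> E") (auto simp: abs_mult mult.commute[of "\<bar>f x\<bar>"] intro!: mult_right_mono)
    qed (use f fW fWE in auto)
    also have "\<dots> = e * (\<integral>x. \<bar>f x\<bar> \<partial>M)" by simp
    also have "\<dots> \<le> e * B" using f e by (intro mult_left_mono) auto
    finally show ?thesis .
  qed
  obtain N where N: "\<And>n. N \<le> n \<Longrightarrow> \<bar>(\<integral>x. indicator E x * (u n x * W x) \<partial>M) - (\<integral>x. indicator E x * (v x * W x) \<partial>M)\<bar> < r / 2"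
    using LIMSEQ_D[OF E(3), of "r / 2"] r by auto
  have "2 * (e * B) < r / 2"
  proof -
    have "4 * (e * B) = r * (B / (B + 1))" using B0 by (simp add: e_def field_simps)
    also have "\<dots> < r * 1" using r B0 by (intro mult_strict_left_mono) auto
    finally show ?thesis by simp
  qed
  then have "\<bar>(\<integral>x. u n x * W x \<partial>M) - (\<integral>x. v x * W x \<partial>M)\<bar> < r" if "N \<le> n" for n
    using N[OF that] tail[OF int(1)[of n] B(1)[of n]] tail[OF int(2) B(2)] by linarith
  then show "\<exists>no. \<forall>n\<ge>no. norm ((\<integral>x. u n x * W x \<partial>M) - (\<integral>x. v x * W x \<partial>M)) < r" by auto
qed

section \<open>Logarithmic singularities on the unit circle\<close>

lemma inj_on_cis_double: "inj_on (\<lambda>p. cis (2 * p)) {0<..<pi}"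
proof (rule inj_onI)
  fix p q assume pq: "p \<in> {0<..<pi}" "q \<in> {0<..<pi}" "cis (2 * p) = cis (2 * q)"
  then have "cis (2 * p) * cis (- (2 * q)) = 1" by (simp add: cis_mult)
  then have "cos (2 * p - 2 * q) = 1" by (simp add: cis_mult complex_eq_iff)
  then obtain n :: nat where n: "2 * p - 2 * q = real n * 2 * pi \<or> 2 * p - 2 * q = - (real n * 2 * pi)"
    unfolding cos_one_2pi by blast
  then have "p - q = real n * pi \<or> p - q = - (real n * pi)" by linarith
  then have "\<bar>p - q\<bar> = real n * pi" by auto
  moreover have "\<bar>p - q\<bar> < 1 * pi" using pq by auto
  ultimately have "real n < 1" by (metis mult_less_cancel_right_pos pi_gt_zero)
  then have "n = 0" by simp
  then show "p = q" using n by auto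
qed

lemma cis_double_ne_1:
  assumes "p \<in> {0<..<pi}"
  shows "cis (2 * p) \<noteq> 1"
proof
  assume "cis (2 * p) = 1"
  then have "1 - 2 * (sin p)\<^sup>2 = 1" by (metis cis.sel(1) cos_double_sin one_complex.sel(1))
  then show False using sin_gt_zero[of p] assms by auto
qed

lemma AE_cis_notin:
  assumes "countable X"
  shows "AE p in restrict_space lborel {0<..<pi}. cis (2 * p) \<notin> X"
proof -
  have "countable ({0<..<pi} \<inter> (\<lambda>p. cis (2 * p)) -` X)"
    by (rule countable_image_inj_Int_vimage[OF inj_on_cis_double assms])
  from AE_Ioo_countable[OF this, of 0 pi]
  have "AE p in restrict_space lborel {0<..<pi}. p \<notin> {0<..<pi} \<inter> (\<lambda>p. cis (2 * p)) -` X" .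
  then show ?thesis
    by (rule AE_mp) (auto intro!: AE_I2 simp: space_restrict_space)
qed

text \<open>The distance 1 - r from c to r*c is at most the distance from r*c to any point z of the
  circle, so the triangle inequality loses only a factor 2, uniformly in r.\<close>

lemma norm_radial_ge:
  assumes "0 \<le> r" "r \<le> 1" "cmod c = 1" "cmod z = 1"
  shows "cmod (c - z) / 2 \<le> cmod (of_real r * c - z)"
proof -
  have "cmod (c - z) \<le> cmod (c - of_real r * c) + cmod (of_real r * c - z)"
    using norm_triangle_ineq[of "c - of_real r * c" "of_real r * c - z"] by simp
  moreover have "c - of_real r * c = of_real (1 - r) * c" by (simp add: algebra_simps)
  then have "cmod (c - of_real r * c) = 1 - r" using assms by (simp add: norm_mult del: of_real_diff)
  moreover have "1 - r \<le> cmod (of_real r * c - z)"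
    using norm_triangle_ineq2[of z "of_real r * c"] assms by (simp add: norm_mult norm_minus_commute)
  ultimately show ?thesis by simp
qed

text \<open>The functions 1 - r * cnj z * w with r < 1 have no zeros in the closed disc, so their
  logarithms have mean 0 by the zero-free case. With the upper bound ln 2 the one-sided limit
  theorem applies, and no estimate of the logarithm at its singularity is needed.\<close>

lemma integrable_ln_circle:
  assumes z: "cmod z = 1"
  shows "integrable (restrict_space lborel {0<..<pi}) (\<lambda>p. ln (cmod (cis (2 * p) - z)))"
proof -
  define M where "M = restrict_space lborel {0<..<pi}"
  \<comment> \<open>The shift by two makes already the first radius, 1/2, positive.\<close>
  define r where "r = (\<lambda>n::nat. 1 - inverse (real (Suc (Suc n))))"
  have r: "0 < r n" "r n < 1" for n by (auto simp: r_def field_simps)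
  have rlim: "r \<longlonglongrightarrow> 1"
    unfolding r_def using tendsto_diff[OF tendsto_const LIMSEQ_Suc[OF LIMSEQ_inverse_real_of_nat], of 1] by simp
  define u where "u = (\<lambda>n p. ln (cmod (1 - of_real (r n) * cnj z * cis (2 * p))))"
  have nz: "1 - of_real (r n) * cnj z * w \<noteq> 0" if "cmod w < 1 / r n" for n w
  proof
    assume "1 - of_real (r n) * cnj z * w = 0"
    then have "cmod (of_real (r n) * cnj z * w) = 1" by (metis eq_iff_diff_eq_0 norm_one)
    then have "r n * cmod w = 1" using r[of n] z by (simp add: norm_mult)
    then show False using that r[of n] by (simp add: field_simps)
  qed
  have cis: "cmod (cis t) < 1 / r n" for t n using r[of n] by simp
  have "disc_integrals (\<lambda>w. 1 - of_real (r n) * cnj z * w) 0 0" for n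
    by (rule disc_integrals_nonvanishing[where R = "1 / r n"])
      (use r[of n] nz in \<open>auto intro!: holomorphic_intros\<close>)
  then have hu: "(u n has_integral 0) {0..pi}" for n
    unfolding disc_integrals_def u_def by blast
  have "continuous_on {0..pi} (u n)" for n
    unfolding u_def using nz[OF cis] by (intro continuous_intros) auto
  then have "set_integrable lborel {0..pi} (u n)" for n by (rule borel_integrable_atLeastAtMost')
  then have iu: "integrable M (u n)" for n
    unfolding M_def integrable_Ioo_iff by (rule set_integrable_subset) auto
  have "integrable M (\<lambda>p. ln (cmod (1 - cnj z * cis (2 * p))))"
  proof (rule integrable_limit_one_sided(1)[OF iu])
    show "(\<lambda>p. ln (cmod (1 - cnj z * cis (2 * p)))) \<in> borel_measurable M"
      unfolding M_def by (intro borel_measurable_ln measurable_Ioo_continuous continuous_intros)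
    show "integrable M (\<lambda>_. ln 2)"
      unfolding M_def by (rule finite_measure.integrable_const[OF finite_measure_Ioo])
    show "0 \<le> integral\<^sup>L M (u n)" for n
      using has_integral_imp_integral_Ioo[OF iu[unfolded M_def] hu] by (simp add: M_def)
    show "AE x in M. u n x \<le> ln 2" for n
    proof (rule AE_I2)
      fix x
      have "cmod (1 - of_real (r n) * cnj z * cis (2 * x)) \<le> 1 + cmod (of_real (r n) * cnj z * cis (2 * x))"
        using norm_triangle_ineq4[of 1 "of_real (r n) * cnj z * cis (2 * x)"] by (simp only: norm_one)
      also have "\<dots> \<le> 2" using r[of n] z by (simp add: norm_mult)
      finally show "u n x \<le> ln 2" using nz[OF cis, of n "2 * x"] unfolding u_def by (subst ln_le_cancel_iff) auto
    qed
    have "AE p in M. cis (2 * p) \<notin> {z}" unfolding M_def by (rule AE_cis_notin) simp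
    then show "AE x in M. (\<lambda>n. u n x) \<longlonglongrightarrow> ln (cmod (1 - cnj z * cis (2 * x)))"
    proof eventually_elim
      case (elim x)
      have "z * cnj z = 1" using z by (simp add: complex_norm_square[symmetric])
      then have "1 - cnj z * cis (2 * x) \<noteq> 0" using elim z
        by (metis eq_iff_diff_eq_0 mult.commute mult.left_neutral mult.assoc singletonI mult.right_neutral)
      moreover have "(\<lambda>n. 1 - of_real (r n) * cnj z * cis (2 * x)) \<longlonglongrightarrow> 1 - of_real 1 * cnj z * cis (2 * x)"
        by (intro tendsto_intros rlim)
      ultimately show ?case unfolding u_def by (intro tendsto_ln tendsto_norm) auto
    qed
  qed auto
  moreover have "cmod (1 - cnj z * c) = cmod (c - z)" for c
  proof -
    have "z * cnj z = 1" using z by (simp add: complex_norm_square[symmetric])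
    then have "z * (1 - cnj z * c) = z - c" by (simp add: right_diff_distrib flip: mult.assoc)
    then show ?thesis using z by (metis mult_1 norm_minus_commute norm_mult)
  qed
  ultimately show ?thesis by (simp add: M_def)
qed

text \<open>At a vanishing factor the product vanishes too, and the inequality survives because ln 0
  = 0.\<close>

lemma abs_ln_mult_le:
  fixes x y :: real
  assumes "0 \<le> x" "0 \<le> y"
  shows "\<bar>ln (x * y)\<bar> \<le> \<bar>ln x\<bar> + \<bar>ln y\<bar>"
  using assms by (cases "x = 0 \<or> y = 0") (auto simp: ln_mult)

lemma abs_ln_power:
  fixes x :: real
  assumes "0 \<le> x" "0 < n"
  shows "\<bar>ln (x ^ n)\<bar> = real n * \<bar>ln x\<bar>"
  using assms by (cases "x = 0") (auto simp: ln_realpow abs_mult)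

lemma abs_ln_radial_le:
  assumes "0 \<le> r" "r \<le> 1" "cmod c = 1" "cmod z = 1" "c \<noteq> z"
  shows "\<bar>ln (cmod (of_real r * c - z))\<bar> \<le> ln 2 + \<bar>ln (cmod (c - z))\<bar>"
proof -
  have pos: "0 < cmod (c - z)" using assms by simp
  have ge: "cmod (c - z) / 2 \<le> cmod (of_real r * c - z)" by (rule norm_radial_ge[OF assms(1-4)])
  then have "ln (cmod (c - z) / 2) \<le> ln (cmod (of_real r * c - z))"
    using pos by (subst ln_le_cancel_iff) auto
  then have 1: "ln (cmod (c - z)) - ln 2 \<le> ln (cmod (of_real r * c - z))" using pos by (simp add: ln_div)
  have "cmod (of_real r * c - z) \<le> 2"
    using norm_triangle_ineq4[of "of_real r * c" z] assms by (simp add: norm_mult)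
  then have "ln (cmod (of_real r * c - z)) \<le> ln 2"
    using ge pos by (subst ln_le_cancel_iff) auto
  with 1 show ?thesis by linarith
qed

lemma constant_on_imp_eq:
  assumes "f constant_on A" "x \<in> A" "y \<in> A"
  shows "f x = f y"
  using assms unfolding constant_on_def by metis

lemma connected_Compl_1: "connected (- {1::complex})"
  by (intro connected_punctured_universe) auto

text \<open>Zeros on the arc are split off one at a time; each contributes an integrable logarithm.\<close>

lemma ln_radial_dominated:
  fixes f :: "complex \<Rightarrow> complex"
  assumes "f holomorphic_on - {1}" "\<exists>z\<in>- {1}. f z \<noteq> 0"
    and K: "compact K" "1 \<notin> K" "K \<subseteq> sphere 0 1"
  shows "\<exists>\<beta> r0. integrable (restrict_space lborel {0<..<pi}) \<beta> \<and> r0 < 1 \<and>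
     (\<forall>r p. r0 \<le> r \<and> r \<le> 1 \<and> cis (2 * p) \<in> K \<and> f (cis (2 * p)) \<noteq> 0 \<longrightarrow>
        \<bar>ln (cmod (f (of_real r * cis (2 * p))))\<bar> \<le> \<beta> p)"
  using assms(1,2)
proof (induction "card {z \<in> K. f z = 0}" arbitrary: f rule: less_induct)
  case (less f)
  note hol = less.prems(1) and nz = less.prems(2)
  have KA: "K \<subseteq> - {1}" using K by auto
  show ?case
  proof (cases "\<exists>\<rho>\<in>K. f \<rho> = 0")
    case False
    have "open (- {1} \<inter> f -` (- {0}))"
      by (rule continuous_open_preimage[OF holomorphic_on_imp_continuous_on[OF hol]]) auto
    moreover have "K \<subseteq> - {1} \<inter> f -` (- {0})" using False KA by auto
    ultimately obtain e where e: "0 < e" "(\<Union>x\<in>K. ball x e) \<subseteq> - {1} \<inter> f -` (- {0})"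
      by (rule compact_subset_open_imp_ball_epsilon_subset[OF K(1)])
    define r0 where "r0 = 1 - min e 1 / 2"
    have r0: "0 < r0" "r0 < 1" "1 - r0 < e" using e(1) by (auto simp: r0_def)
    \<comment> \<open>The compact set swept out by moving \<open>K\<close> radially inwards to
      \<open>r0\<close>; since 1 - r0 < e it stays in the zero-free neighbourhood.\<close>
    define L where "L = (\<lambda>(r, x). of_real r * x) ` ({r0..1} \<times> K)"
    have "compact L"
      unfolding L_def case_prod_unfold
      by (intro compact_continuous_image compact_Times K continuous_intros) auto
    have L: "L \<subseteq> - {1} \<inter> f -` (- {0})"
    proof
      fix w assume "w \<in> L"
      then obtain r x where rx: "r \<in> {r0..1}" "x \<in> K" "w = of_real r * x" unfolding L_def by auto
      have "x - w = of_real (1 - r) * x" using rx by (simp add: algebra_simps)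
      then have "dist x w = 1 - r" using rx K(3) by (auto simp: dist_norm norm_mult simp del: of_real_diff)
      then have "w \<in> ball x e" using rx r0 by auto
      then show "w \<in> - {1} \<inter> f -` (- {0})" using e(2) rx(2) by blast
    qed
    have "continuous_on L f"
      using L by (intro continuous_on_subset[OF holomorphic_on_imp_continuous_on[OF hol]]) auto
    then have "continuous_on L (\<lambda>w. ln (cmod (f w)))"
      using L by (intro continuous_intros) auto
    then have "bounded ((\<lambda>w. ln (cmod (f w))) ` L)"
      using \<open>compact L\<close> by (intro compact_imp_bounded compact_continuous_image)
    then obtain B where B: "\<And>w. w \<in> L \<Longrightarrow> \<bar>ln (cmod (f w))\<bar> \<le> B"
      unfolding bounded_iff by auto
    have "\<bar>ln (cmod (f (of_real r * cis (2 * p))))\<bar> \<le> B"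
      if "r0 \<le> r" "r \<le> 1" "cis (2 * p) \<in> K" for r p
      using that by (intro B) (auto simp: L_def)
    moreover have "integrable (restrict_space lborel {0<..<pi}) (\<lambda>_. B)"
      by (rule finite_measure.integrable_const[OF finite_measure_Ioo])
    ultimately show ?thesis using r0 by (intro exI[of _ "\<lambda>_. B"] exI[of _ r0]) auto
  next
    case True
    then obtain \<rho> where r: "\<rho> \<in> K" "f \<rho> = 0" by blast
    have nr: "cmod \<rho> = 1" "\<rho> \<in> - {1}" using r K by auto
    have nc: "\<not> f constant_on - {1}"
      using nz r nr constant_on_imp_eq[of f "- {1}" \<rho>] by metis
    obtain g n where g: "0 < n" "g holomorphic_on - {1}" "g \<rho> \<noteq> 0" "\<And>z. z \<in> - {1} \<Longrightarrow> f z = (z - \<rho>) ^ n * g z"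
      by (rule holomorphic_factor_zero[OF hol _ connected_Compl_1 nr(2) r(2) nc]) auto
    have fin: "finite {z \<in> K. f z = 0}"
      by (rule holomorphic_compact_finite_zeros[OF hol _ connected_Compl_1 K(1) KA nc]) auto
    have "{z \<in> K. g z = 0} \<subset> {z \<in> K. f z = 0}"
    proof -
      have "f z = 0" if "z \<in> K" "g z = 0" for z using g(4)[of z] that KA by auto
      then show ?thesis using g(3) r by blast
    qed
    then have "card {z \<in> K. g z = 0} < card {z \<in> K. f z = 0}"
      by (rule psubset_card_mono[OF fin])
    moreover have "\<exists>z\<in>- {1}. g z \<noteq> 0" using g(3) nr(2) by blast
    ultimately obtain \<beta> r0 where b: "integrable (restrict_space lborel {0<..<pi}) \<beta>" "r0 < 1"
      "\<And>r p. r0 \<le> r \<Longrightarrow> r \<le> 1 \<Longrightarrow> cis (2 * p) \<in> K \<Longrightarrow> g (cis (2 * p)) \<noteq> 0 \<Longrightarrow>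
        \<bar>ln (cmod (g (of_real r * cis (2 * p))))\<bar> \<le> \<beta> p"
      using less.hyps[OF _ g(2)] by blast
    \<comment> \<open>The summand ln 2 pays for moving from the circle to radius r, by
      \<open>norm_radial_ge\<close>.\<close>
    define \<gamma> where "\<gamma> = (\<lambda>p. real n * (ln 2 + \<bar>ln (cmod (cis (2 * p) - \<rho>))\<bar>) + \<beta> p)"
    have "integrable (restrict_space lborel {0<..<pi}) \<gamma>"
      unfolding \<gamma>_def
      by (intro Bochner_Integration.integrable_add integrable_mult_right b
          finite_measure.integrable_const[OF finite_measure_Ioo] integrable_abs integrable_ln_circle nr)
    moreover have "\<bar>ln (cmod (f (of_real r * cis (2 * p))))\<bar> \<le> \<gamma> p"
      if rp: "max r0 0 \<le> r" "r \<le> 1" "cis (2 * p) \<in> K" "f (cis (2 * p)) \<noteq> 0" for r p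
    proof -
      define w where "w = of_real r * cis (2 * p)"
      have c: "cis (2 * p) \<noteq> 1" "cis (2 * p) \<noteq> \<rho>" using rp K r by auto
      have "w \<noteq> 1"
      proof
        assume w1: "w = 1"
        then have "cmod w = 1" by simp
        then have "r = 1" using rp by (simp add: w_def norm_mult)
        then show False using w1 c by (simp add: w_def)
      qed
      then have fw: "f w = (w - \<rho>) ^ n * g w" using g(4) by auto
      have "g (cis (2 * p)) \<noteq> 0" using rp(4) g(4)[of "cis (2 * p)"] c by auto
      then have 1: "\<bar>ln (cmod (g w))\<bar> \<le> \<beta> p" unfolding w_def using rp by (intro b(3)) auto
      have 2: "\<bar>ln (cmod (w - \<rho>))\<bar> \<le> ln 2 + \<bar>ln (cmod (cis (2 * p) - \<rho>))\<bar>"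
        unfolding w_def using rp c nr by (intro abs_ln_radial_le) auto
      have "\<bar>ln (cmod (f w))\<bar> \<le> \<bar>ln (cmod (w - \<rho>) ^ n)\<bar> + \<bar>ln (cmod (g w))\<bar>"
        unfolding fw norm_mult norm_power by (intro abs_ln_mult_le) auto
      also have "\<bar>ln (cmod (w - \<rho>) ^ n)\<bar> = real n * \<bar>ln (cmod (w - \<rho>))\<bar>"
        using g(1) by (intro abs_ln_power) auto
      also have "real n * \<bar>ln (cmod (w - \<rho>))\<bar> + \<bar>ln (cmod (g w))\<bar> \<le> \<gamma> p"
        unfolding \<gamma>_def using 1 2 by (intro add_mono mult_left_mono) auto
      finally show ?thesis by (simp add: w_def)
    qed
    moreover have "max r0 0 < 1" using b(2) by simp
    ultimately show ?thesis by blast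
  qed
qed

section \<open>The formula on the unit circle as a limit\<close>

text \<open>Zeros may accumulate at 1, so finiteness cannot be expected. The punctured plane is a
  countable union of closed sets, which suffices for countability.\<close>

lemma countable_zeros_Compl_1:
  assumes hol: "f holomorphic_on - {1}" and f0: "f 0 \<noteq> 0"
  shows "countable {z \<in> - {1}. f z = 0}"
proof (cases "f constant_on - {1}")
  case True
  then have "{z \<in> - {1}. f z = 0} = {}" using f0 constant_on_imp_eq[OF True, of 0] by auto
  then show ?thesis by (simp only: countable_empty)
next
  case False
  have "\<exists>n. inverse (real (Suc n)) \<le> dist 1 z" if "z \<noteq> 1" for z :: complex
    using reals_Archimedean[of "dist 1 z"] that by (auto intro: less_imp_le)
  then have "- {1::complex} = (\<Union>n. - ball 1 (inverse (real (Suc n))))"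
    by (fastforce simp: not_less)
  moreover have "fsigma (\<Union>n. - ball (1::complex) (inverse (real (Suc n))))"
    by (intro fsigma.intros) auto
  ultimately have "fsigma (- {1::complex})" by (simp only:)
  then show ?thesis
    by (intro holomorphic_countable_zeros[OF hol _ connected_Compl_1 _ False]) auto
qed

lemma radii_avoiding_zeros:
  assumes hol: "f holomorphic_on - {1}" and f0: "f 0 \<noteq> 0"
  obtains r :: "nat \<Rightarrow> real" where "\<And>n. 0 < r n" "\<And>n. r n < 1" "r \<longlonglongrightarrow> 1"
    "\<And>n z. cmod z = r n \<Longrightarrow> f z \<noteq> 0"
proof -
  note countable_zeros_Compl_1[OF assms]
  then have cnt: "countable (cmod ` {z \<in> - {1}. f z = 0})" by (rule countable_image)
  have "\<exists>r. 1 - inverse (real (Suc n)) < r \<and> r < 1 \<and> (\<forall>z. cmod z = r \<longrightarrow> f z \<noteq> 0)" for n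
  proof -
    have "uncountable {1 - inverse (real (Suc n))<..<1}" by (simp add: uncountable_open_interval)
    then have "\<not> {1 - inverse (real (Suc n))<..<1} \<subseteq> cmod ` {z \<in> - {1}. f z = 0}"
      using cnt countable_subset by blast
    then obtain r where r: "r \<in> {1 - inverse (real (Suc n))<..<1}" "r \<notin> cmod ` {z \<in> - {1}. f z = 0}" by blast
    have "f z \<noteq> 0" if "cmod z = r" for z
    proof
      assume "f z = 0"
      moreover have "z \<noteq> 1" using that r(1) by auto
      ultimately show False using r(2) that by blast
    qed
    with r(1) show ?thesis by auto
  qed
  then obtain r where r: "\<And>n. 1 - inverse (real (Suc n)) < r n" "\<And>n. r n < 1" "\<And>n z. cmod z = r n \<Longrightarrow> f z \<noteq> 0"
    by metis
  have "r \<longlonglongrightarrow> 1"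
  proof (rule tendsto_sandwich)
    show "(\<lambda>n. 1 - inverse (real (Suc n))) \<longlonglongrightarrow> 1"
      using tendsto_diff[OF tendsto_const LIMSEQ_inverse_real_of_nat, of 1] by simp
  qed (use r in \<open>auto intro!: always_eventually less_imp_le\<close>)
  moreover have "0 < r n" for n
  proof -
    have "inverse (real (Suc n)) \<le> 1" by (simp add: field_simps)
    then show ?thesis using r(1)[of n] by linarith
  qed
  ultimately show ?thesis using that r by blast
qed

text \<open>The formula is applied to the dilations z -> f(r z) along radii r < 1 without zeros on
  the circle. Growth bounds the circle integrands from above, Jensen's inequality bounds the
  integrals from below, and \<open>real_bound\<close> dominates the radial integrands. A zero \<rho>
  of f gives the zero \<rho>/r of the dilation, whose weight converges to the positive weight of
  \<rho>; the limit therefore cannot vanish.\<close>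

lemma disc_formula:
  fixes f :: "complex \<Rightarrow> complex"
  assumes hol: "f holomorphic_on - {1}" and f0: "f 0 = 1"
    and growth: "\<And>z. cmod z \<le> 1 \<Longrightarrow> z \<noteq> 1 \<Longrightarrow> cmod (f z) \<le> B / (cmod (1 - z))\<^sup>2"
    and real_nz: "\<And>x. 0 \<le> x \<Longrightarrow> x < 1 \<Longrightarrow> f (of_real x) \<noteq> 0"
    and real_bound: "\<And>x. 0 \<le> x \<Longrightarrow> x < 1 \<Longrightarrow> \<bar>ln (cmod (f (of_real x)))\<bar> * (1 - x) \<le> C * x"
  shows "set_integrable lborel {0<..<pi} (\<lambda>p. ln (cmod (f (cis (2 * p)))) * (2 * sin p))"
    and "set_integrable lborel {0<..<1} (\<lambda>y. ln (cmod (f (of_real (y\<^sup>2)))) * ((1 - y\<^sup>2) / y\<^sup>2))"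
    and "(LBINT p:{0<..<pi}. ln (cmod (f (cis (2 * p)))) * (2 * sin p)) +
      2 * (LBINT y:{0<..<1}. ln (cmod (f (of_real (y\<^sup>2)))) * ((1 - y\<^sup>2) / y\<^sup>2)) = 0
      \<longleftrightarrow> (\<forall>z\<in>ball 0 1. f z \<noteq> 0)"
proof -
  define M where "M = restrict_space lborel {0<..<pi}"
  define N where "N = restrict_space lborel {0<..<1::real}"
  have space: "space M = {0<..<pi}" "space N = {0<..<1}"
    by (auto simp: M_def N_def space_restrict_space)
  obtain r where r: "\<And>n. 0 < r n" "\<And>n. r n < 1" "r \<longlonglongrightarrow> 1" "\<And>n z. cmod z = r n \<Longrightarrow> f z \<noteq> 0"
    using radii_avoiding_zeros[OF hol] f0 by auto
  define F where "F = (\<lambda>n z. f (of_real (r n) * z))"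
  have ne1: "of_real (r n) * z \<noteq> 1" if "cmod z \<le> 1" for n z
  proof
    assume "of_real (r n) * z = 1"
    then have "r n * cmod z = 1" using r(1)[of n] by (metis abs_of_pos norm_mult norm_of_real norm_one)
    moreover have "r n * cmod z \<le> r n * 1" using that r(1)[of n] by (intro mult_left_mono) auto
    ultimately show False using r(2)[of n] by simp
  qed
  have Fhol: "F n holomorphic_on ball 0 (1 / r n)" for n
  proof -
    have "of_real (r n) * z \<noteq> 1" if "cmod z < 1 / r n" for z
    proof
      assume "of_real (r n) * z = 1"
      then have "r n * cmod z = 1" using r(1)[of n] by (metis abs_of_pos norm_mult norm_of_real norm_one)
      then show False using that r(1)[of n] by (simp add: field_simps)
    qed
    then show ?thesis
      unfolding F_def
      by (intro holomorphic_on_compose_gen[of "\<lambda>z. of_real (r n) * z" _ f "- {1}", unfolded o_def] hol holomorphic_intros) auto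
  qed
  have Fcirc: "F n z \<noteq> 0" if "cmod z = 1" for n z
    unfolding F_def using that r(1)[of n] by (intro r(4)[of _ n]) (simp add: norm_mult)
  have Fx: "F n (of_real x) \<noteq> 0" if "x \<in> {0..1}" for n x
  proof -
    have "r n * x \<le> r n * 1" using that r(1)[of n] by (intro mult_left_mono) auto
    then have "r n * x < 1" using r(2)[of n] by linarith
    then have "f (of_real (r n * x)) \<noteq> 0" using that r(1)[of n] by (intro real_nz) auto
    then show ?thesis by (simp add: F_def)
  qed
  have "\<exists>J K. disc_integrals (F n) J K \<and> 0 \<le> J \<and> 0 \<le> K \<and>
     ((\<forall>z\<in>ball 0 1. F n z \<noteq> 0) \<longrightarrow> K = 0) \<and> (\<forall>\<rho>\<in>ball 0 1. F n \<rho> = 0 \<longrightarrow> zero_weight \<rho> \<le> K)" for n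
    by (rule disc_integrals_zeros[OF Fhol]) (use r(1,2)[of n] Fcirc Fx in \<open>auto simp: F_def f0\<close>)
  then obtain J Kn where JK: "\<And>n. disc_integrals (F n) (J n) (Kn n)" "\<And>n. 0 \<le> J n"
     "\<And>n. (\<forall>z\<in>ball 0 1. F n z \<noteq> 0) \<Longrightarrow> Kn n = 0"
     "\<And>n \<rho>. \<rho> \<in> ball 0 1 \<Longrightarrow> F n \<rho> = 0 \<Longrightarrow> zero_weight \<rho> \<le> Kn n"
    by metis
  then have "\<forall>n. \<exists>I. ((\<lambda>y. ln (cmod (F n (of_real (y\<^sup>2)))) * ((1 - y\<^sup>2) / y\<^sup>2)) has_integral I) {0..1} \<and>
          ((\<lambda>p. ln (cmod (F n (cis (2 * p)))) * (2 * sin p)) has_integral (Kn n - 2 * I)) {0..pi}"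
    unfolding disc_integrals_def by blast
  from choice[OF this] obtain I where I: "\<And>n. ((\<lambda>y. ln (cmod (F n (of_real (y\<^sup>2)))) * ((1 - y\<^sup>2) / y\<^sup>2)) has_integral I n) {0..1}"
    "\<And>n. ((\<lambda>p. ln (cmod (F n (cis (2 * p)))) * (2 * sin p)) has_integral (Kn n - 2 * I n)) {0..pi}"
    by blast
  have Ju: "((\<lambda>p. ln (cmod (F n (cis (2 * p))))) has_integral J n) {0..pi}" for n
    using JK(1)[of n] unfolding disc_integrals_def by blast
  define u where "u = (\<lambda>n p. ln (cmod (F n (cis (2 * p)))))"
  define v where "v = (\<lambda>p. ln (cmod (f (cis (2 * p)))))"
  define W where "W = (\<lambda>p::real. 2 * sin p)"
  have fcont: "isCont f z" if "z \<noteq> 1" for z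
    using that holomorphic_on_imp_differentiable_at[OF hol] by (auto intro: field_differentiable_imp_continuous_at)
  have cu: "continuous_on {0..pi} (u n)" for n
  proof -
    have "continuous_on {0..pi} (\<lambda>p. F n (cis (2 * p)))"
      by (intro continuous_on_compose2[OF holomorphic_on_imp_continuous_on[OF Fhol[of n]]] continuous_intros)
        (use r(1,2)[of n] in auto)
    then show ?thesis unfolding u_def using Fcirc by (intro continuous_intros) auto
  qed
  have iu: "integrable M (u n)" for n
    unfolding M_def integrable_Ioo_iff
    by (rule set_integrable_subset[OF borel_integrable_atLeastAtMost'[OF cu]]) auto
  have iuW: "integrable M (\<lambda>p. u n p * W p)" for n
    unfolding M_def integrable_Ioo_iff
    by (rule set_integrable_subset[OF borel_integrable_atLeastAtMost'[where a = 0 and b = pi]])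
      (auto intro!: continuous_intros cu simp: W_def)
  have vm: "v \<in> borel_measurable M"
    unfolding v_def M_def
  proof (intro borel_measurable_ln measurable_Ioo_continuous continuous_intros)
    show "continuous_on {0<..<pi} (\<lambda>p. f (cis (2 * p)))"
      by (intro continuous_on_compose2[OF holomorphic_on_imp_continuous_on[OF hol]] continuous_intros)
        (use cis_double_ne_1 in auto)
  qed
  have B0: "0 < B"
  proof -
    have "1 \<le> B / (cmod (1 - 0))\<^sup>2" using growth[of 0] f0 by simp
    then show ?thesis by simp
  qed
  \<comment> \<open>With d the distance from cis (2 * p) to 1, the dilated point keeps distance d/2
    from 1, so |F n| <= 4B/d^2 and the logarithm is at most ln (4B) - 2 ln d.\<close>
  define D where "D = (\<lambda>p. \<bar>ln (4 * B)\<bar> + 2 * \<bar>ln (cmod (cis (2 * p) - 1))\<bar>)"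
  have iD: "integrable M D"
    unfolding D_def M_def
    by (intro Bochner_Integration.integrable_add integrable_mult_right
          finite_measure.integrable_const[OF finite_measure_Ioo] integrable_abs integrable_ln_circle) simp
  have uD: "AE p in M. u n p \<le> D p" for n
  proof (rule AE_I2)
    fix p assume "p \<in> space M"
    then have c: "cis (2 * p) \<noteq> 1" using cis_double_ne_1 space by auto
    define d where "d = cmod (cis (2 * p) - 1)"
    have d: "0 < d" using c by (simp add: d_def)
    have "d / 2 \<le> cmod (of_real (r n) * cis (2 * p) - 1)"
      unfolding d_def using r(1,2)[of n] by (intro norm_radial_ge) auto
    then have d': "d / 2 \<le> cmod (1 - of_real (r n) * cis (2 * p))" by (simp add: norm_minus_commute)
    have "cmod (F n (cis (2 * p))) \<le> B / (cmod (1 - of_real (r n) * cis (2 * p)))\<^sup>2"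
      unfolding F_def using ne1[of "cis (2 * p)" n] r(1,2)[of n] by (intro growth) (auto simp: norm_mult)
    also have "\<dots> \<le> B / (d / 2)\<^sup>2"
      using d d' B0 by (intro divide_left_mono power_mono mult_pos_pos zero_less_power) auto
    also have "\<dots> = 4 * B / d\<^sup>2" by (simp add: power_divide)
    finally have "u n p \<le> ln (4 * B / d\<^sup>2)"
      unfolding u_def using Fcirc[of "cis (2 * p)" n] B0 d by (subst ln_le_cancel_iff) auto
    also have "\<dots> = ln (4 * B) - 2 * ln d" using B0 d by (simp add: ln_div ln_realpow ln_mult)
    also have "\<dots> \<le> D p" unfolding D_def d_def by linarith
    finally show "u n p \<le> D p" .
  qed
  have J0: "0 \<le> integral\<^sup>L M (u n)" for n
  proof -
    have "(u n has_integral J n) {0..pi}" unfolding u_def by (rule Ju)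
    from has_integral_imp_integral_Ioo[OF iu[unfolded M_def] this] JK(2)[of n]
    show ?thesis by (simp add: M_def)
  qed
  have cntz: "AE p in M. f (cis (2 * p)) \<noteq> 0"
  proof -
    have "countable {z \<in> - {1}. f z = 0}"
      by (rule countable_zeros_Compl_1[OF hol]) (simp add: f0)
    then have "AE p in M. cis (2 * p) \<notin> {z \<in> - {1}. f z = 0}" unfolding M_def by (rule AE_cis_notin)
    moreover have "AE p in M. p \<in> space M" by (rule AE_space)
    ultimately show ?thesis
      by eventually_elim (use cis_double_ne_1 space in auto)
  qed
  have lim: "(\<lambda>n. u n p) \<longlonglongrightarrow> v p" if "p \<in> space M" "f (cis (2 * p)) \<noteq> 0" for p
  proof -
    have "(\<lambda>n. of_real (r n) * cis (2 * p)) \<longlonglongrightarrow> of_real 1 * cis (2 * p)" by (intro tendsto_intros r)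
    then have "(\<lambda>n. F n (cis (2 * p))) \<longlonglongrightarrow> f (cis (2 * p))"
      unfolding F_def using that cis_double_ne_1 space by (intro isCont_tendsto_compose[OF fcont]) auto
    then show ?thesis unfolding u_def v_def using that(2) by (intro tendsto_ln tendsto_norm) auto
  qed
  have limAE: "AE p in M. (\<lambda>n. u n p) \<longlonglongrightarrow> v p"
    using cntz AE_space by eventually_elim (rule lim)
  \<comment> \<open>The common majorant \<open>D\<close> and the nonnegative Jensen integrals bound
    the integrals of |u n| uniformly in n.\<close>
  note one = integrable_limit_one_sided[OF iu vm iD _ uD J0 limAE]
  have D0: "0 \<le> D p" for p by (simp add: D_def)
  have iv: "integrable M v" using one(1) D0 by blast
  have Wm: "W \<in> borel_measurable M"
    unfolding W_def M_def by (intro measurable_Ioo_continuous continuous_intros)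
  have circ_lim: "(\<lambda>n. \<integral>p. u n p * W p \<partial>M) \<longlonglongrightarrow> (\<integral>p. v p * W p \<partial>M)"
  proof (rule tendsto_integral_weighted[OF iu iv, where B = "2 * integral\<^sup>L M D" and C = 2])
    show "(\<integral>x. \<bar>u n x\<bar> \<partial>M) \<le> 2 * integral\<^sup>L M D" for n using one(3) D0 by blast
    show "(\<integral>x. \<bar>v x\<bar> \<partial>M) \<le> 2 * integral\<^sup>L M D" using one(2) D0 by blast
    show "\<bar>W x\<bar> \<le> 2" for x by (simp add: W_def abs_mult)
    fix e :: real assume e: "0 < e"
    \<comment> \<open>Since sin p is at most the distance to the nearer endpoint, the weight is at
      most 2 * \<delta> = e outside \<open>E\<close>.\<close>
    define \<delta> where "\<delta> = e / 2"
    define E where "E = {0<..<pi} \<inter> {\<delta>..pi - \<delta>}"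
    have E: "E \<in> sets M" unfolding M_def E_def by (subst sets_restrict_space_iff) auto
    have small: "\<bar>W p\<bar> \<le> e" if "p \<in> space M - E" for p
    proof -
      have p: "0 < p" "p < pi" "p < \<delta> \<or> pi - \<delta> < p" using that space by (auto simp: E_def)
      have "sin p \<le> \<delta>"
      proof (cases "p < \<delta>")
        case True
        then show ?thesis using sin_x_le_x[of p] p by simp
      next
        case False
        then have "sin (pi - p) \<le> \<delta>" using sin_x_le_x[of "pi - p"] p by simp
        then show ?thesis by simp
      qed
      moreover have "0 \<le> sin p" using p by (intro sin_ge_zero) auto
      ultimately show ?thesis by (simp add: W_def \<delta>_def)
    qed
    \<comment> \<open>A closed arc away from 1. Only finitely many zeros lie on it, so a dominating
      function exists for radii close to 1.\<close>
    define K where "K = (\<lambda>p. cis (2 * p)) ` {\<delta>..pi - \<delta>}"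
    have d0: "0 < \<delta>" using e by (simp add: \<delta>_def)
    have "compact K" unfolding K_def by (intro compact_continuous_image continuous_intros compact_Icc)
    moreover have "1 \<notin> K" unfolding K_def using cis_double_ne_1 d0 by force
    moreover have "K \<subseteq> sphere 0 1" unfolding K_def by auto
    moreover have "\<exists>z\<in>- {1}. f z \<noteq> 0" using f0 by (intro bexI[of _ 0]) auto
    ultimately obtain \<beta> r0 where b: "integrable M \<beta>" "r0 < 1"
      "\<And>r p. r0 \<le> r \<Longrightarrow> r \<le> 1 \<Longrightarrow> cis (2 * p) \<in> K \<Longrightarrow> f (cis (2 * p)) \<noteq> 0 \<Longrightarrow>
        \<bar>ln (cmod (f (of_real r * cis (2 * p))))\<bar> \<le> \<beta> p"
      using ln_radial_dominated[OF hol, of K] unfolding M_def by blast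
    \<comment> \<open>Dominated convergence wants the bound for every index, so the sequence is
      started at \<open>n0\<close>.\<close>
    obtain n0 where n0: "\<And>n. n0 \<le> n \<Longrightarrow> r0 \<le> r n"
      using order_tendstoD(1)[OF r(3) b(2)] unfolding eventually_sequentially by (meson less_imp_le)
    have "(\<lambda>n. \<integral>x. indicator E x * (u (n + n0) x * W x) \<partial>M) \<longlonglongrightarrow> (\<integral>x. indicator E x * (v x * W x) \<partial>M)"
    proof (rule integral_dominated_convergence[where w = "\<lambda>p. 2 * \<bar>\<beta> p\<bar>"])
      show "integrable M (\<lambda>p. 2 * \<bar>\<beta> p\<bar>)" using b(1) by auto
      show "(\<lambda>x. indicator E x * (v x * W x)) \<in> borel_measurable M" using E vm Wm by measurable
      show "(\<lambda>x. indicator E x * (u (n + n0) x * W x)) \<in> borel_measurable M" for n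
        using E Wm borel_measurable_integrable[OF iu] by measurable
      show "AE x in M. (\<lambda>n. indicator E x * (u (n + n0) x * W x)) \<longlonglongrightarrow> indicator E x * (v x * W x)"
        using limAE
      proof eventually_elim
        case (elim x)
        then have "(\<lambda>n. u (n + n0) x) \<longlonglongrightarrow> v x" by (rule LIMSEQ_ignore_initial_segment)
        then show ?case by (intro tendsto_intros)
      qed
      show "AE x in M. norm (indicator E x * (u (n + n0) x * W x)) \<le> 2 * \<bar>\<beta> x\<bar>" for n
        using cntz
      proof eventually_elim
        case (elim p)
        show ?case
        proof (cases "p \<in> E")
          case True
          then have "cis (2 * p) \<in> K" by (auto simp: E_def K_def)
          then have "\<bar>u (n + n0) p\<bar> \<le> \<beta> p"
            unfolding u_def F_def using n0[of "n + n0"] r(2)[of "n + n0"] elim by (intro b(3)) auto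
          moreover have "\<bar>W p\<bar> \<le> 2" by (simp add: W_def abs_mult)
          ultimately have "\<bar>u (n + n0) p\<bar> * \<bar>W p\<bar> \<le> \<bar>\<beta> p\<bar> * 2" by (intro mult_mono) auto
          then show ?thesis using True by (simp add: abs_mult)
        qed auto
      qed
    qed
    then have "(\<lambda>n. \<integral>x. indicator E x * (u n x * W x) \<partial>M) \<longlonglongrightarrow> (\<integral>x. indicator E x * (v x * W x) \<partial>M)"
      by (rule LIMSEQ_offset)
    then show "\<exists>E\<in>sets M. (\<forall>x\<in>space M - E. \<bar>W x\<bar> \<le> e) \<and>
        (\<lambda>n. \<integral>x. indicator E x * (u n x * W x) \<partial>M) \<longlonglongrightarrow> (\<integral>x. indicator E x * (v x * W x) \<partial>M)"
      using E small by blast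
  qed (fact Wm)
  define q where "q = (\<lambda>n y. ln (cmod (F n (of_real (y\<^sup>2)))) * ((1 - y\<^sup>2) / y\<^sup>2))"
  define q0 where "q0 = (\<lambda>y. ln (cmod (f (of_real (y\<^sup>2)))) * ((1 - y\<^sup>2) / y\<^sup>2))"
  have sq: "0 < y\<^sup>2" "y\<^sup>2 < 1" if "y \<in> {0<..<1}" for y :: real
    using that by (auto simp: power_less_one_iff)
  have qm: "(\<lambda>y. ln (cmod (f (of_real (s * y\<^sup>2)))) * ((1 - y\<^sup>2) / y\<^sup>2)) \<in> borel_measurable N" if s: "0 < s" "s \<le> 1" for s
    unfolding N_def
  proof (intro measurable_Ioo_continuous continuous_intros)
    have sy: "0 \<le> s * y\<^sup>2" "s * y\<^sup>2 < 1" if "y \<in> {0<..<1}" for y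
    proof -
      have "s * y\<^sup>2 \<le> 1 * y\<^sup>2" using s by (intro mult_right_mono) auto
      then show "s * y\<^sup>2 < 1" using sq[OF that] by linarith
      show "0 \<le> s * y\<^sup>2" using s by simp
    qed
    show "continuous_on {0<..<1} (\<lambda>y. f (of_real (s * y\<^sup>2)))"
    proof (intro continuous_on_compose2[OF holomorphic_on_imp_continuous_on[OF hol]] continuous_intros)
      show "(\<lambda>y. complex_of_real (s * y\<^sup>2)) ` {0<..<1} \<subseteq> - {1}"
        using sy by (force simp del: of_real_mult)
    qed
    show "\<forall>y\<in>{0<..<1}. cmod (f (of_real (s * y\<^sup>2))) \<noteq> 0"
      using real_nz sy by (auto simp del: of_real_mult)
  qed auto
  have F_eq: "F n (of_real (y\<^sup>2)) = f (of_real (r n * y\<^sup>2))" for n y by (simp add: F_def)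
  have rad: "integrable N q0" "\<And>n. integrable N (q n)" "(\<lambda>n. integral\<^sup>L N (q n)) \<longlonglongrightarrow> integral\<^sup>L N q0"
  proof -
    have C: "integrable N (\<lambda>_. C)" unfolding N_def by (rule finite_measure.integrable_const[OF finite_measure_Ioo])
    have m0: "q0 \<in> borel_measurable N" unfolding q0_def using qm[of 1] by simp
    have mn: "q n \<in> borel_measurable N" for n unfolding q_def F_eq using qm[of "r n"] r(1,2)[of n] by simp
    have li: "AE y in N. (\<lambda>n. q n y) \<longlonglongrightarrow> q0 y"
    proof (rule AE_I2)
      fix y assume "y \<in> space N"
      then have y: "0 < y\<^sup>2" "y\<^sup>2 < 1" using sq space by auto
      have "(\<lambda>n. of_real (r n * y\<^sup>2)) \<longlonglongrightarrow> (of_real (1 * y\<^sup>2) :: complex)" by (intro tendsto_intros r)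
      moreover have "isCont f (of_real (1 * y\<^sup>2))"
      proof (rule fcont)
        show "complex_of_real (1 * y\<^sup>2) \<noteq> 1" using y(2) by (simp only: of_real_eq_1_iff)
      qed
      ultimately have "(\<lambda>n. f (of_real (r n * y\<^sup>2))) \<longlonglongrightarrow> f (of_real (1 * y\<^sup>2))"
        by (intro isCont_tendsto_compose[of _ f])
      then show "(\<lambda>n. q n y) \<longlonglongrightarrow> q0 y"
        unfolding q_def q0_def F_eq using real_nz[of "y\<^sup>2"] y by (intro tendsto_intros) auto
    qed
    have bo: "AE y in N. norm (q n y) \<le> C" for n
    proof (rule AE_I2)
      fix y assume "y \<in> space N"
      then have y: "0 < y\<^sup>2" "y\<^sup>2 < 1" using sq space by auto
      \<comment> \<open>Since x <= y^2, replacing y^2 by x in the factor 1 - y^2 and then x by y^2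
        on the right of \<open>real_bound\<close> gives a bound independent of n.\<close>
      define x where "x = r n * y\<^sup>2"
      have xy: "x \<le> y\<^sup>2" using r(1,2)[of n] y by (simp add: x_def)
      have x0: "0 \<le> x" using r(1)[of n] by (simp add: x_def)
      have "\<bar>ln (cmod (f (of_real x)))\<bar> * (1 - y\<^sup>2) \<le> \<bar>ln (cmod (f (of_real x)))\<bar> * (1 - x)"
        using xy by (intro mult_left_mono) auto
      also have "\<dots> \<le> C * x" using xy x0 y by (intro real_bound) auto
      \<comment> \<open>The constant is nonnegative: at x = 1/2 the left-hand side of
        \<open>real_bound\<close> is.\<close>
      also have "\<dots> \<le> C * y\<^sup>2"
      proof (cases "0 \<le> C")
        case True
        then show ?thesis using xy by (rule mult_left_mono[rotated])
      next
        case False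
        have "0 \<le> \<bar>ln (cmod (f (of_real (1/2))))\<bar> * (1 - 1/2)" by simp
        also have "\<dots> \<le> C * (1/2)" by (rule real_bound) auto
        finally show ?thesis using False by simp
      qed
      finally have "\<bar>ln (cmod (f (of_real x)))\<bar> * (1 - y\<^sup>2) / y\<^sup>2 \<le> C" using y by (simp add: divide_le_eq)
      then show "norm (q n y) \<le> C" unfolding q_def F_eq using y by (simp add: x_def abs_mult)
    qed
    show "integrable N q0" by (rule integrable_dominated_convergence[OF m0 mn C li bo])
    show "integrable N (q n)" for n by (rule integrable_dominated_convergence2[OF m0 mn C li bo])
    show "(\<lambda>n. integral\<^sup>L N (q n)) \<longlonglongrightarrow> integral\<^sup>L N q0" by (rule integral_dominated_convergence[OF m0 mn C li bo])
  qed
  have In: "integral\<^sup>L N (q n) = I n" for n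
  proof -
    have "(q n has_integral I n) {0..1}" unfolding q_def by (rule I)
    from has_integral_imp_integral_Ioo[OF rad(2)[unfolded N_def] this] show ?thesis by (simp add: N_def)
  qed
  have Un: "(\<integral>p. u n p * W p \<partial>M) = Kn n - 2 * I n" for n
  proof -
    have "((\<lambda>p. u n p * W p) has_integral Kn n - 2 * I n) {0..pi}" unfolding u_def W_def by (rule I)
    from has_integral_imp_integral_Ioo[OF iuW[unfolded M_def] this] show ?thesis by (simp add: M_def)
  qed
  define K where "K = (\<integral>p. v p * W p \<partial>M) + 2 * integral\<^sup>L N q0"
  have Klim: "Kn \<longlonglongrightarrow> K"
  proof -
    have "(\<lambda>n. (Kn n - 2 * I n) + 2 * I n) \<longlonglongrightarrow> K"
      unfolding K_def using circ_lim rad(3) unfolding In Un by (intro tendsto_intros)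
    then show ?thesis by simp
  qed
  have ivW: "integrable M (\<lambda>p. v p * W p)"
  proof (rule Bochner_Integration.integrable_bound)
    show "integrable M (\<lambda>p. 2 * v p)" using iv by simp
    show "AE p in M. norm (v p * W p) \<le> norm (2 * v p)"
    proof (rule AE_I2)
      fix p
      have "\<bar>v p\<bar> * \<bar>W p\<bar> \<le> \<bar>v p\<bar> * 2" by (intro mult_left_mono) (auto simp: W_def abs_mult)
      then show "norm (v p * W p) \<le> norm (2 * v p)" by (simp add: abs_mult)
    qed
  qed (use vm Wm in auto)
  have Kiff: "K = 0 \<longleftrightarrow> (\<forall>z\<in>ball 0 1. f z \<noteq> 0)"
  proof
    assume nz: "\<forall>z\<in>ball 0 1. f z \<noteq> 0"
    have "Kn n = 0" for n
    proof (rule JK(3), rule ballI)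
      fix z :: complex assume z: "z \<in> ball 0 1"
      have "r n * cmod z \<le> 1 * cmod z" using r(2)[of n] by (intro mult_right_mono) auto
      then have "of_real (r n) * z \<in> ball 0 1" using z r(1)[of n] by (simp add: norm_mult)
      then show "F n z \<noteq> 0" using nz by (simp add: F_def)
    qed
    then have "Kn = (\<lambda>_. 0)" by auto
    then show "K = 0" using Klim LIMSEQ_unique tendsto_const by metis
  next
    assume K0: "K = 0"
    show "\<forall>z\<in>ball 0 1. f z \<noteq> 0"
    proof (rule ccontr)
      assume "\<not> (\<forall>z\<in>ball 0 1. f z \<noteq> 0)"
      then obtain \<rho> where rho: "cmod \<rho> < 1" "f \<rho> = 0" by auto
      have nr: "\<rho> \<notin> \<real>\<^sub>\<ge>\<^sub>0"
      proof
        assume "\<rho> \<in> \<real>\<^sub>\<ge>\<^sub>0"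
        then obtain x where "\<rho> = of_real x" "0 \<le> x" by (auto elim: nonneg_Reals_cases)
        with rho real_nz[of x] show False by auto
      qed
      \<comment> \<open>Off the branch cut \<open>csqrt\<close> is continuous, so the weights of
        \<rho>/r n converge; \<rho> avoids the cut because f has no zeros on the radius.\<close>
      have n1: "- \<rho> \<notin> \<real>\<^sub>\<le>\<^sub>0" using nr by (auto simp: complex_nonpos_Reals_iff complex_nonneg_Reals_iff)
      have s0: "csqrt (- \<rho>) \<noteq> 0" using nr by auto
      have "(\<lambda>n. - (\<rho> / of_real (r n))) \<longlonglongrightarrow> - (\<rho> / of_real 1)" by (intro tendsto_intros r) auto
      then have "(\<lambda>n. csqrt (- (\<rho> / of_real (r n)))) \<longlonglongrightarrow> csqrt (- \<rho>)"
        using n1 by (intro isCont_tendsto_compose[OF continuous_at_csqrt]) auto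
      then have wlim: "(\<lambda>n. zero_weight (\<rho> / of_real (r n))) \<longlonglongrightarrow> zero_weight \<rho>"
        unfolding zero_weight_def using s0 by (intro tendsto_intros)
      have "eventually (\<lambda>n. cmod \<rho> < r n) sequentially" using order_tendstoD(1)[OF r(3) rho(1)] .
      then have "eventually (\<lambda>n. zero_weight (\<rho> / of_real (r n)) \<le> Kn n) sequentially"
      proof eventually_elim
        case (elim n)
        have "\<rho> / of_real (r n) \<in> ball 0 1" using elim r(1)[of n] by (simp add: norm_divide)
        moreover have "F n (\<rho> / of_real (r n)) = 0" using rho r(1)[of n] by (simp add: F_def)
        ultimately show ?case by (rule JK(4))
      qed
      then have "zero_weight \<rho> \<le> K" using tendsto_le[OF _ Klim wlim] by simp
      then show False using zero_weight_pos[OF nr rho(1)] K0 by simp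
    qed
  qed
  show "set_integrable lborel {0<..<pi} (\<lambda>p. ln (cmod (f (cis (2 * p)))) * (2 * sin p))"
    using ivW unfolding M_def integrable_Ioo_iff v_def W_def .
  show "set_integrable lborel {0<..<1} (\<lambda>y. ln (cmod (f (of_real (y\<^sup>2)))) * ((1 - y\<^sup>2) / y\<^sup>2))"
    using rad(1) unfolding N_def integrable_Ioo_iff q0_def .
  show "(LBINT p:{0<..<pi}. ln (cmod (f (cis (2 * p)))) * (2 * sin p)) +
      2 * (LBINT y:{0<..<1}. ln (cmod (f (of_real (y\<^sup>2)))) * ((1 - y\<^sup>2) / y\<^sup>2)) = 0
      \<longleftrightarrow> (\<forall>z\<in>ball 0 1. f z \<noteq> 0)"
    using Kiff unfolding K_def M_def N_def integral_Ioo_eq v_def W_def q0_def .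
qed

section \<open>From the half-plane to the disc\<close>

text \<open>The substitution rule is available for absolute integrability with respect to the
  completed measure. Borel measurability of \<open>f\<close> and of the image allows the return to
  \<open>lborel\<close>.\<close>

lemma LBINT_change_of_variables:
  fixes f g g' :: "real \<Rightarrow> real"
  assumes S: "S \<in> sets borel" and T: "g ` S \<in> sets borel"
    and der: "\<And>x. x \<in> S \<Longrightarrow> (g has_field_derivative g' x) (at x)" and inj: "inj_on g S"
    and f: "f \<in> borel_measurable borel"
    and int: "set_integrable lborel S (\<lambda>x. \<bar>g' x\<bar> * f (g x))"
  shows "(LBINT x:g ` S. f x) = (LBINT x:S. \<bar>g' x\<bar> * f (g x))"
proof -
  have "(\<lambda>x. \<bar>g' x\<bar> * f (g x)) absolutely_integrable_on S"
    using int unfolding set_integrable_def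
    by (subst integrable_completion) (auto dest: borel_measurable_integrable)
  moreover have "S \<in> sets lebesgue" using S by (auto simp: sets_completionI_sets)
  ultimately have *: "f absolutely_integrable_on g ` S"
      "integral (g ` S) f = integral S (\<lambda>x. \<bar>g' x\<bar> * f (g x))"
    using has_absolute_integral_change_of_variables_1'[of S g g' f] der inj
    by (auto intro: has_field_derivative_at_within)
  have "set_integrable lborel (g ` S) f"
    using *(1) f T unfolding set_integrable_def by (subst (asm) integrable_completion) auto
  then show ?thesis
    using *(2) set_borel_integral_eq_integral(2)[OF int] set_borel_integral_eq_integral(2)[of "g ` S" f] by simp
qed

lemma LBINT_Ici_eq_Ioi:
  fixes f :: "real \<Rightarrow> real"
  assumes "f \<in> borel_measurable borel"
  shows "(LBINT x:{c..}. f x) = (LBINT x:{c<..}. f x)"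
  unfolding set_lebesgue_integral_def
proof (rule integral_cong_AE)
  show "AE x in lborel. indicat_real {c..} x *\<^sub>R f x = indicat_real {c<..} x *\<^sub>R f x"
    using AE_lborel_singleton[of c] by eventually_elim (auto simp: indicator_def)
qed (use assms in auto)

text \<open>Chosen so that the origin goes to \<open>1\<close>, the radius \<open>[0, 1)\<close> to \<open>[1, \<infinity>)\<close> and the unit circle to
  the line \<open>Re s = 1 - a\<close>.\<close>

definition disc_to_halfplane :: "real \<Rightarrow> complex \<Rightarrow> complex" where
  "disc_to_halfplane a z = 1 + of_real (2 * a) * z / (1 - z)"

text \<open>Apart from the constant 1 - a this is a times the Poisson kernel with pole 1, so the
  sign of 1 - |z|^2 decides the side of the line.\<close>

lemma Re_disc_to_halfplane:
  assumes "z \<noteq> 1"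
  shows "Re (disc_to_halfplane a z) = 1 - a + a * (1 - (cmod z)\<^sup>2) / (cmod (1 - z))\<^sup>2"
proof -
  have nz: "(cmod (1 - z))\<^sup>2 \<noteq> 0" using assms by simp
  have e: "(cmod (1 - z))\<^sup>2 = 1 - 2 * Re z + (cmod z)\<^sup>2"
    unfolding cmod_power2 by (simp add: power2_eq_square algebra_simps)
  have "Re (z / (1 - z)) = (Re z - (cmod z)\<^sup>2) / (cmod (1 - z))\<^sup>2"
    unfolding Re_divide cmod_power2 by (simp add: power2_eq_square algebra_simps)
  moreover have "Re (of_real c * w) = c * Re w" for c w by simp
  ultimately have "Re (disc_to_halfplane a z) = 1 + 2 * a * ((Re z - (cmod z)\<^sup>2) / (cmod (1 - z))\<^sup>2)"
    unfolding disc_to_halfplane_def times_divide_eq_right[symmetric] by (simp only: plus_complex.sel one_complex.sel)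
  also have "\<dots> = 1 - a + a * (1 - (cmod z)\<^sup>2) / (cmod (1 - z))\<^sup>2"
  proof -
    have "2 * (Re z - (cmod z)\<^sup>2) = (1 - (cmod z)\<^sup>2) - (cmod (1 - z))\<^sup>2" using e by simp
    moreover have "2 * a * ((Re z - (cmod z)\<^sup>2) / (cmod (1 - z))\<^sup>2) =
        a * (2 * (Re z - (cmod z)\<^sup>2)) / (cmod (1 - z))\<^sup>2" by simp
    ultimately have "2 * a * ((Re z - (cmod z)\<^sup>2) / (cmod (1 - z))\<^sup>2) =
        a * ((1 - (cmod z)\<^sup>2) - (cmod (1 - z))\<^sup>2) / (cmod (1 - z))\<^sup>2"
      by (simp only:)
    also have "\<dots> = a * (1 - (cmod z)\<^sup>2) / (cmod (1 - z))\<^sup>2 - a"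
      using nz by (simp add: field_simps)
    finally show ?thesis by simp
  qed
  finally show ?thesis .
qed

text \<open>The inverse is the quotient of s - 1 and s - (1 - 2a). The points 1 and 1 - 2a are
  mirror images in the line Re s = 1 - a, so the quotient has modulus < 1 exactly on the side of
  1.\<close>

lemma disc_to_halfplane_image:
  assumes a: "0 < a"
  shows "disc_to_halfplane a ` ball 0 1 = {s. 1 - a < Re s}"
proof (intro equalityI subsetI)
  fix s assume "s \<in> disc_to_halfplane a ` ball 0 1"
  then obtain z where z: "cmod z < 1" "s = disc_to_halfplane a z" by auto
  then have "z \<noteq> 1" by auto
  moreover have "0 < 1 - (cmod z)\<^sup>2" using z by (simp add: abs_square_less_1)
  ultimately show "s \<in> {s. 1 - a < Re s}" using a z(2) Re_disc_to_halfplane by simp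
next
  fix s assume s: "s \<in> {s. 1 - a < Re s}"
  define z where "z = (s - 1) / (s - 1 + of_real (2 * a))"
  have "(cmod (s - 1 + of_real (2 * a)))\<^sup>2 - (cmod (s - 1))\<^sup>2 = 4 * a * (Re s - (1 - a))"
    unfolding cmod_power2 by (simp add: power2_eq_square algebra_simps)
  moreover have "0 < 4 * a * (Re s - (1 - a))" using a s by simp
  ultimately have "(cmod (s - 1))\<^sup>2 < (cmod (s - 1 + of_real (2 * a)))\<^sup>2" by linarith
  then have lt: "cmod (s - 1) < cmod (s - 1 + of_real (2 * a))" by (rule power_less_imp_less_base) simp
  then have nz: "s - 1 + of_real (2 * a) \<noteq> 0" by (metis norm_ge_zero norm_zero not_less)
  have "cmod z < 1" unfolding z_def norm_divide using lt nz by (subst divide_less_eq_1_pos) auto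
  moreover have "disc_to_halfplane a z = s"
  proof -
    have 1: "1 - z = of_real (2 * a) / (s - 1 + of_real (2 * a))"
      unfolding z_def using nz by (simp add: divide_simps)
    have "of_real (2 * a) * z / (1 - z) = s - 1"
      unfolding 1 unfolding z_def using nz a by (simp add: divide_simps)
    then show ?thesis by (simp add: disc_to_halfplane_def)
  qed
  ultimately show "s \<in> disc_to_halfplane a ` ball 0 1" by (intro image_eqI[of _ _ z]) auto
qed

lemma disc_to_halfplane_of_real:
  "disc_to_halfplane a (of_real x) = of_real (1 + 2 * a * x / (1 - x))"
  by (simp add: disc_to_halfplane_def)

text \<open>Factoring cis p out of 1 - cis (2 * p) leaves i cis p / (2 sin p), with real part -1/2
  and imaginary part cot p / 2.\<close>

lemma disc_to_halfplane_cis: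
  assumes "sin p \<noteq> 0"
  shows "disc_to_halfplane a (cis (2 * p)) = Complex (1 - a) (a * cot p)"
proof -
  have c2: "cis (2 * p) = cis p * cis p" by (simp add: cis_mult)
  have m: "cis p * cis (- p) = 1" by (simp add: cis_mult)
  have d: "1 - cis (2 * p) = cis p * (- 2 * \<i> * of_real (sin p))"
  proof -
    have "1 - cis (2 * p) = cis p * (cis (- p) - cis p)" unfolding c2 right_diff_distrib m ..
    also have "cis (- p) - cis p = - 2 * \<i> * of_real (sin p)" by (simp add: complex_eq_iff)
    finally show ?thesis .
  qed
  have "cis (2 * p) / (1 - cis (2 * p)) = cis p / (- 2 * \<i> * of_real (sin p))"
    unfolding d unfolding c2 by (rule mult_divide_mult_cancel_left[OF cis_neq_zero])
  also have "\<dots> = Complex (- 1 / 2) (cot p / 2)"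
    using assms by (simp add: complex_eq_iff Re_divide Im_divide cot_def field_simps power2_eq_square)
  finally have e: "cis (2 * p) / (1 - cis (2 * p)) = Complex (- 1 / 2) (cot p / 2)" .
  show ?thesis
    unfolding disc_to_halfplane_def times_divide_eq_right[symmetric] e by (simp add: complex_eq_iff)
qed

section \<open>Zeta on the disc\<close>

definition zeta_disc :: "real \<Rightarrow> complex \<Rightarrow> complex" where
  "zeta_disc a z = zeta_entire (disc_to_halfplane a z)"

lemma zeta_entire_real_pos:
  assumes "1 \<le> x"
  shows "0 < Re (zeta_entire (of_real x))"
proof (cases "x = 1")
  case True
  then show ?thesis using zeta_entire_1 by simp
next
  case False
  then show ?thesis using zeta_entire_real_ge[of x] assms by simp
qed

lemma norm_zeta_entire_of_real:
  assumes "1 \<le> x"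
  shows "cmod (zeta_entire (of_real x)) = Re (zeta_entire (of_real x))"
  using arg_cong[OF zeta_entire_of_real[of x], of cmod] zeta_entire_real_pos[OF assms]
  unfolding norm_of_real by linarith

lemma holomorphic_zeta_disc: "zeta_disc a holomorphic_on - {1}"
proof -
  have "disc_to_halfplane a holomorphic_on - {1}"
    unfolding disc_to_halfplane_def[abs_def] by (intro holomorphic_intros) auto
  then have "(zeta_entire \<circ> disc_to_halfplane a) holomorphic_on - {1}"
    by (rule holomorphic_on_compose_gen[OF _ holomorphic_zeta_entire[of UNIV]]) auto
  then show ?thesis by (simp add: o_def zeta_disc_def[abs_def])
qed

lemma zeta_disc_0: "zeta_disc a 0 = 1"
  by (simp add: zeta_disc_def disc_to_halfplane_def zeta_entire_1)

text \<open>Since a <= 1/2, that is \<alpha> >= 0, the closed disc without 1 is mapped into Re s >=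
  1/2, where the growth is quadratic. With d = |1 - z| <= 2 one has 1 + |s| <= 2 + 1/d <= 5/d, hence
  the factor 25.\<close>

lemma zeta_disc_growth:
  assumes a: "0 < a" "a \<le> 1/2"
  shows "\<exists>B>0. \<forall>z. cmod z \<le> 1 \<and> z \<noteq> 1 \<longrightarrow> cmod (zeta_disc a z) \<le> B / (cmod (1 - z))\<^sup>2"
proof -
  obtain C where C: "0 < C" "\<And>s. 1/2 \<le> Re s \<Longrightarrow> norm (zeta_entire s) \<le> C * (1 + norm s)\<^sup>2"
    using zeta_entire_growth by blast
  have "cmod (zeta_disc a z) \<le> (25 * C) / (cmod (1 - z))\<^sup>2" if z: "cmod z \<le> 1" "z \<noteq> 1" for z
  proof -
    define d where "d = cmod (1 - z)"
    have d: "0 < d" "d \<le> 2" using z norm_triangle_ineq4[of 1 z] by (auto simp: d_def)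
    have "0 \<le> 1 - (cmod z)\<^sup>2" using z by (simp add: power_le_one)
    then have "1 - a \<le> Re (disc_to_halfplane a z)"
      using Re_disc_to_halfplane[OF z(2), of a] a by simp
    then have "cmod (zeta_disc a z) \<le> C * (1 + cmod (disc_to_halfplane a z))\<^sup>2"
      unfolding zeta_disc_def using a by (intro C(2)) auto
    also have "1 + cmod (disc_to_halfplane a z) \<le> 5 / d"
    proof -
      have "cmod (disc_to_halfplane a z) \<le> 1 + cmod (of_real (2 * a) * z / (1 - z))"
        unfolding disc_to_halfplane_def using norm_triangle_ineq[of 1 "of_real (2 * a) * z / (1 - z)"] by simp
      also have "cmod (of_real (2 * a) * z / (1 - z)) = 2 * a * cmod z / d"
        using a by (simp add: norm_mult norm_divide d_def)
      also have "\<dots> \<le> 1 * 1 / d"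
        using a z d by (intro divide_right_mono mult_mono) auto
      finally have "1 + cmod (disc_to_halfplane a z) \<le> 2 + 1 / d" by simp
      also have "\<dots> \<le> 5 / d" using d by (simp add: field_simps)
      finally show ?thesis .
    qed
    then have "C * (1 + cmod (disc_to_halfplane a z))\<^sup>2 \<le> C * (5 / d)\<^sup>2"
      using C(1) by (intro mult_left_mono power_mono) auto
    also have "\<dots> = 25 * C / d\<^sup>2" by (simp add: power_divide)
    finally show ?thesis by (simp add: d_def)
  qed
  then show ?thesis using C(1) by (intro exI[of _ "25 * C"]) auto
qed

lemma zeta_disc_real:
  assumes "0 < a" "0 \<le> x" "x < 1"
  shows "0 < cmod (zeta_disc a (of_real x))" "2 * a * x / (1 - x) \<le> cmod (zeta_disc a (of_real x))"
proof -
  define y where "y = 1 + 2 * a * x / (1 - x)"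
  have y: "1 \<le> y" using assms by (simp add: y_def)
  have z: "zeta_disc a (of_real x) = zeta_entire (of_real y)"
    by (simp add: zeta_disc_def disc_to_halfplane_of_real y_def del: of_real_add of_real_divide)
  show "0 < cmod (zeta_disc a (of_real x))"
    unfolding z norm_zeta_entire_of_real[OF y] by (rule zeta_entire_real_pos[OF y])
  show "2 * a * x / (1 - x) \<le> cmod (zeta_disc a (of_real x))"
  proof -
    have "y - 1 \<le> Re (zeta_entire (of_real y))"
      using zeta_entire_real_ge[of y] zeta_entire_real_pos[OF y] y by (cases "y = 1") auto
    then show ?thesis unfolding z norm_zeta_entire_of_real[OF y] by (simp add: y_def)
  qed
qed

lemma abs_ln_le:
  fixes t c :: real
  assumes "0 < c" "c \<le> 1" "c \<le> t"
  shows "\<bar>ln t\<bar> \<le> \<bar>t - 1\<bar> / c"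
proof -
  have t: "0 < t" using assms by simp
  have 1: "\<bar>t - 1\<bar> \<le> \<bar>t - 1\<bar> / c" using assms by (simp add: le_divide_eq mult_left_le)
  have "ln t \<le> t - 1" using ln_le_minus_one[OF t] .
  moreover have "- ln t \<le> \<bar>t - 1\<bar> / c"
  proof -
    have "- ln t = ln (1 / t)" using t by (simp add: ln_div)
    also have "\<dots> \<le> 1 / t - 1" using t by (intro ln_le_minus_one) auto
    also have "\<dots> = (1 - t) / t" using t by (simp add: field_simps)
    also have "\<dots> \<le> \<bar>t - 1\<bar> / t" using t by (intro divide_right_mono) auto
    also have "\<dots> \<le> \<bar>t - 1\<bar> / c" using assms t by (intro divide_left_mono) auto
    finally show ?thesis .
  qed
  ultimately show ?thesis using 1 by linarith
qed

text \<open>Two regimes, split at 1/2. Near 0 the logarithm vanishes to first order; near 1 it grows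
  at most like ln (1/(1 - x)), which the factor 1 - x absorbs. With x = y^2 this bounds the radial
  integrand by a constant.\<close>

lemma zeta_disc_real_bound:
  assumes a: "0 < a" "a \<le> 1/2"
  shows "\<exists>C. \<forall>x. 0 \<le> x \<and> x < 1 \<longrightarrow> \<bar>ln (cmod (zeta_disc a (of_real x)))\<bar> * (1 - x) \<le> C * x"
proof -
  define h where "h = (\<lambda>x. cmod (zeta_disc a (of_real x)))"
  obtain B where B: "0 < B" "\<And>z. cmod z \<le> 1 \<Longrightarrow> z \<noteq> 1 \<Longrightarrow> cmod (zeta_disc a z) \<le> B / (cmod (1 - z))\<^sup>2"
    using zeta_disc_growth[OF a] by blast
  have fcont: "continuous_on (cball 0 (1/2)) (zeta_disc a)"
    by (rule continuous_on_subset[OF holomorphic_on_imp_continuous_on[OF holomorphic_zeta_disc]]) auto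
  have "continuous_on {0..1/2} h"
    unfolding h_def by (intro continuous_intros continuous_on_compose2[OF fcont]) auto
  then have "\<exists>x\<in>{0..1/2}. \<forall>y\<in>{0..1/2}. h x \<le> h y"
    by (intro continuous_attains_inf) auto
  then obtain x0 where x0: "x0 \<in> {0..1/2}" "\<And>y. y \<in> {0..1/2} \<Longrightarrow> h x0 \<le> h y" by blast
  \<comment> \<open>Positive because the minimum of \<open>h\<close> on the compact interval is
    attained; capped at 1 to fit \<open>abs_ln_le\<close>.\<close>
  define c where "c = min 1 (h x0)"
  have c: "0 < c" "c \<le> 1" using zeta_disc_real(1)[of a x0] a x0(1) by (auto simp: c_def h_def)
  define Q where "Q = (\<lambda>z. if z = 0 then deriv (zeta_disc a) 0 else (zeta_disc a z - zeta_disc a 0) / (z - 0))"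
  have "Q holomorphic_on - {1}"
    unfolding Q_def by (rule pole_lemma_open[OF holomorphic_zeta_disc]) auto
  then have "continuous_on (cball 0 (1/2)) Q"
    by (intro continuous_on_subset[OF holomorphic_on_imp_continuous_on]) auto
  then have "bounded (Q ` cball 0 (1/2))"
    by (intro compact_imp_bounded compact_continuous_image) auto
  then obtain L where L: "\<And>z. z \<in> cball 0 (1/2) \<Longrightarrow> cmod (Q z) \<le> L" unfolding bounded_iff by blast
  have L0: "0 \<le> L" using order_trans[OF norm_ge_zero L[of 0]] by simp
  have near: "\<bar>ln (h x)\<bar> * (1 - x) \<le> (L / c) * x" if x: "0 \<le> x" "x \<le> 1/2" for x
  proof -
    have "\<bar>h x - 1\<bar> \<le> cmod (zeta_disc a (of_real x) - 1)"
      unfolding h_def using norm_triangle_ineq3[of "zeta_disc a (of_real x)" 1] by simp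
    also have "zeta_disc a (of_real x) - 1 = of_real x * Q (of_real x)"
      by (simp add: Q_def zeta_disc_0)
    also have "cmod \<dots> = x * cmod (Q (of_real x))" using x by (simp add: norm_mult)
    also have "\<dots> \<le> x * L" using x by (intro mult_left_mono L) auto
    finally have 1: "\<bar>h x - 1\<bar> \<le> x * L" .
    have "\<bar>ln (h x)\<bar> \<le> \<bar>h x - 1\<bar> / c"
      using c x0(2)[of x] x by (intro abs_ln_le) (auto simp: c_def)
    also have "\<dots> \<le> (x * L) / c" using 1 c by (intro divide_right_mono) auto
    finally have "\<bar>ln (h x)\<bar> \<le> (L / c) * x" by (simp add: mult.commute)
    moreover have "\<bar>ln (h x)\<bar> * (1 - x) \<le> \<bar>ln (h x)\<bar> * 1" using x by (intro mult_left_mono) auto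
    ultimately show ?thesis by linarith
  qed
  \<comment> \<open>The 2 stems from 2 ln (1/(1 - x)) <= 2/(1 - x), and |ln a| from the lower bound
    a for \<open>h\<close> on this half. The later factor 2 is 1 <= 2x.\<close>
  define P where "P = \<bar>ln B\<bar> + 2 + \<bar>ln a\<bar>"
  have far: "\<bar>ln (h x)\<bar> * (1 - x) \<le> (2 * P) * x" if x: "1/2 \<le> x" "x < 1" for x
  proof -
    have hp: "0 < h x" unfolding h_def using a x by (intro zeta_disc_real) auto
    have "1 \<le> 2 * x / (1 - x)" using x by (simp add: field_simps)
    then have "a * 1 \<le> a * (2 * x / (1 - x))" using a by (intro mult_left_mono) auto
    also have "\<dots> = 2 * a * x / (1 - x)" by simp
    also have "\<dots> \<le> h x" unfolding h_def using a x by (intro zeta_disc_real) auto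
    finally have "a \<le> h x" by simp
    then have "ln a \<le> ln (h x)" using a hp by (subst ln_le_cancel_iff) auto
    then have lo: "- ln (h x) \<le> \<bar>ln a\<bar>" by linarith
    have x1: "0 < 1 - x" using x by simp
    have "h x \<le> B / (cmod (1 - of_real x))\<^sup>2" unfolding h_def using x by (intro B(2)) auto
    also have "cmod (1 - of_real x) = 1 - x"
    proof -
      have "1 - of_real x = (of_real (1 - x) :: complex)" by simp
      then show ?thesis using x1 by (metis abs_of_pos norm_of_real)
    qed
    finally have up: "ln (h x) \<le> ln (B / (1 - x)\<^sup>2)" using hp B(1) x1 by (subst ln_le_cancel_iff) auto
    have "ln (B / (1 - x)\<^sup>2) = ln B + 2 * ln (1 / (1 - x))" using B(1) x1 by (simp add: ln_div ln_realpow)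
    moreover have "ln (1 / (1 - x)) \<le> 1 / (1 - x)" using ln_le_minus_one[of "1 / (1 - x)"] x1 by simp
    moreover have "0 \<le> 1 / (1 - x)" using x1 by simp
    ultimately have "\<bar>ln (h x)\<bar> \<le> (\<bar>ln B\<bar> + \<bar>ln a\<bar>) + 2 * (1 / (1 - x))"
      using lo up by linarith
    then have "\<bar>ln (h x)\<bar> \<le> (\<bar>ln B\<bar> + \<bar>ln a\<bar>) + 2 / (1 - x)" by simp
    then have "\<bar>ln (h x)\<bar> * (1 - x) \<le> ((\<bar>ln B\<bar> + \<bar>ln a\<bar>) + 2 / (1 - x)) * (1 - x)"
      using x1 by (intro mult_right_mono) auto
    also have "\<dots> = (\<bar>ln B\<bar> + \<bar>ln a\<bar>) * (1 - x) + 2" using x1 by (simp add: field_simps)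
    also have "\<dots> \<le> (\<bar>ln B\<bar> + \<bar>ln a\<bar>) * 1 + 2" using x by (intro add_mono mult_left_mono) auto
    also have "\<dots> = P * 1" by (simp add: P_def)
    also have "\<dots> \<le> P * (2 * x)" using x by (intro mult_left_mono) (auto simp: P_def)
    finally show ?thesis by simp
  qed
  have "\<bar>ln (h x)\<bar> * (1 - x) \<le> (L / c + 2 * P) * x" if x: "0 \<le> x" "x < 1" for x
  proof (cases "x \<le> 1/2")
    case True
    have "0 \<le> 2 * P * x" using x by (simp add: P_def)
    then show ?thesis using near[of x] True x by (simp add: distrib_right)
  next
    case False
    have "0 \<le> L / c * x" using x L0 c by simp
    then show ?thesis using far[of x] False x by (simp add: distrib_right)
  qed
  then show ?thesis unfolding h_def by blast
qed

lemma zeta_disc_cnj: "zeta_disc a (cnj z) = cnj (zeta_disc a z)"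
proof -
  have "disc_to_halfplane a (cnj z) = cnj (disc_to_halfplane a z)"
    by (simp add: disc_to_halfplane_def)
  then show ?thesis by (simp add: zeta_disc_def zeta_entire_cnj)
qed

text \<open>The exclusion s \<noteq> 1 on the right reflects the conventional value 0 of
  \<open>riemann_zeta\<close> at the pole, where the entire function is 1.\<close>

lemma zeta_disc_zeros_iff:
  assumes "0 < a"
  shows "(\<forall>z\<in>ball 0 1. zeta_disc a z \<noteq> 0) \<longleftrightarrow> (\<forall>s. 1 - a < Re s \<and> s \<noteq> 1 \<longrightarrow> riemann_zeta s \<noteq> 0)"
proof -
  have "(\<forall>z\<in>ball 0 1. zeta_disc a z \<noteq> 0) \<longleftrightarrow> (\<forall>s\<in>disc_to_halfplane a ` ball 0 1. zeta_entire s \<noteq> 0)"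
    by (simp add: zeta_disc_def)
  also have "\<dots> \<longleftrightarrow> (\<forall>s. 1 - a < Re s \<longrightarrow> zeta_entire s \<noteq> 0)"
    unfolding disc_to_halfplane_image[OF assms] by auto
  also have "\<dots> \<longleftrightarrow> (\<forall>s. 1 - a < Re s \<and> s \<noteq> 1 \<longrightarrow> riemann_zeta s \<noteq> 0)"
    unfolding riemann_zeta_eq using zeta_entire_1 by auto
  finally show ?thesis .
qed

section \<open>The substitutions in the two integrals\<close>

lemma powr_three_halves_square:
  fixes x :: real
  assumes "0 \<le> x"
  shows "(x\<^sup>2) powr (3/2) = x ^ 3"
proof (cases "x = 0")
  case False
  then have "x > 0" using assms by simp
  then have "(x\<^sup>2) powr (3/2) = x powr (2 * (3/2))" by (simp add: powr_powr flip: powr_numeral)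
  also have "\<dots> = x ^ 3" using \<open>x > 0\<close> by simp
  finally show ?thesis .
qed auto

lemma cot_image_Ioo:
  fixes a :: real
  assumes "0 < a"
  shows "(\<lambda>p. a * cot p) ` {0<..<pi/2} = {0<..}"
proof (intro equalityI subsetI)
  fix t assume "t \<in> (\<lambda>p. a * cot p) ` {0<..<pi/2}"
  then obtain p where p: "0 < p" "p < pi/2" "t = a * cot p" by auto
  have "0 < cot p" unfolding cot_def using p sin_gt_zero[of p] cos_gt_zero[of p] by auto
  then show "t \<in> {0<..}" using p assms by simp
next
  fix t :: real assume t: "t \<in> {0<..}"
  define p where "p = arctan (a / t)"
  have "0 < p" "p < pi/2" using t assms arctan_ubound by (auto simp: p_def zero_less_arctan_iff)
  moreover have "cot p = t / a" by (simp add: p_def cot_altdef tan_arctan)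
  then have "t = a * cot p" using assms by simp
  ultimately show "t \<in> (\<lambda>p. a * cot p) ` {0<..<pi/2}" by auto
qed

lemma inj_on_cot: "inj_on cot {0<..<pi/2::real}"
proof (rule inj_onI)
  fix p q :: real assume pq: "p \<in> {0<..<pi/2}" "q \<in> {0<..<pi/2}" "cot p = cot q"
  then have "tan p = tan q" by (simp add: cot_altdef)
  moreover have "arctan (tan p) = p" "arctan (tan q) = q" by (rule arctan_tan; use pq in auto)+
  ultimately show "p = q" by metis
qed

text \<open>The symmetry p -> pi - p reduces to a quarter turn in p. For t = a cot p one has a^2 +
  t^2 = (a / sin p)^2 and |dt| = a / sin^2 p dp, so the exponent 3/2 leaves sin p / a^2. The
  constant is 2 for the halving times 2a^2.\<close>

lemma LBINT_halfline_eq_arc: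
  fixes v :: "real \<Rightarrow> real" and h :: "real \<Rightarrow> real"
  assumes a: "0 < a" and h: "h \<in> borel_measurable borel"
    and v: "\<And>p. p \<in> {0<..<pi} \<Longrightarrow> v p = h (a * cot p)"
    and sym: "\<And>p. v (pi - p) = v p"
    and int: "set_integrable lborel {0<..<pi} (\<lambda>p. v p * (2 * sin p))"
  shows "(LBINT p:{0<..<pi}. v p * (2 * sin p)) = 4 * a\<^sup>2 * (LBINT t:{0..}. h t / (a\<^sup>2 + t\<^sup>2) powr (3/2))"
proof -
  define w where "w = (\<lambda>p. v p * (2 * sin p))"
  have int1: "set_integrable lborel {0<..<pi/2} w" and int2: "set_integrable lborel {pi/2..<pi} w"
    unfolding w_def by (rule set_integrable_subset[OF int]; auto)+
  have wsym: "w (pi - p) = w p" for p by (simp add: w_def sym)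
  have half_eq: "(LBINT p:{pi/2..<pi}. w p) = (LBINT p:{0<..<pi/2}. w p)"
  proof -
    have "(LBINT p:{pi/2..<pi}. w p) = (\<integral>p. indicator {pi/2..<pi} (pi + (-1) * p) *\<^sub>R w (pi + (-1) * p) \<partial>lborel)"
      unfolding set_lebesgue_integral_def by (subst lborel_integral_real_affine[where c = "-1" and t = pi]) auto
    also have "\<dots> = (\<integral>p. indicator {0<..pi/2} p *\<^sub>R w p \<partial>lborel)"
      using wsym by (intro Bochner_Integration.integral_cong) (auto simp: indicator_def)
    also have "\<dots> = (\<integral>p. indicator {0<..<pi/2} p *\<^sub>R w p \<partial>lborel)"
    proof (rule integral_cong_AE)
      have "set_integrable lborel {0<..pi/2} w" unfolding w_def by (rule set_integrable_subset[OF int]) auto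
      then show "(\<lambda>p. indicator {0<..pi/2} p *\<^sub>R w p) \<in> borel_measurable lborel"
        unfolding set_integrable_def by auto
      show "(\<lambda>p. indicator {0<..<pi/2} p *\<^sub>R w p) \<in> borel_measurable lborel"
        using int1 unfolding set_integrable_def by auto
      show "AE p in lborel. indicat_real {0<..pi/2} p *\<^sub>R w p = indicat_real {0<..<pi/2} p *\<^sub>R w p"
        using AE_lborel_singleton[of "pi/2"] by eventually_elim (auto simp: indicator_def)
    qed
    finally show ?thesis by (simp add: set_lebesgue_integral_def)
  qed
  have "{0<..<pi} = {0<..<pi/2} \<union> {pi/2..<pi}" using pi_gt_zero by auto
  then have "(LBINT p:{0<..<pi}. w p) = (LBINT p:{0<..<pi/2}. w p) + (LBINT p:{pi/2..<pi}. w p)"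
    using int1 int2 by (subst set_integral_Un[symmetric]) auto
  then have half: "(LBINT p:{0<..<pi}. w p) = 2 * (LBINT p:{0<..<pi/2}. w p)" using half_eq by simp
  define F where "F = (\<lambda>t. h t / (a\<^sup>2 + t\<^sup>2) powr (3/2))"
  define g' where "g' = (\<lambda>p::real. a * - inverse ((sin p)\<^sup>2))"
  have Fm: "F \<in> borel_measurable borel"
    unfolding F_def using h by measurable
  have jac: "\<bar>g' p\<bar> * F (a * cot p) = (1 / (2 * a\<^sup>2)) * w p" if p: "p \<in> {0<..<pi/2}" for p
  proof -
    have s: "0 < sin p" using p by (intro sin_gt_zero) auto
    have "a\<^sup>2 + (a * cot p)\<^sup>2 = (a / sin p)\<^sup>2"
    proof -
      have "a\<^sup>2 + (a * cot p)\<^sup>2 = a\<^sup>2 * ((sin p)\<^sup>2 + (cos p)\<^sup>2) / (sin p)\<^sup>2"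
        using s by (simp add: cot_def power_mult_distrib power_divide add_divide_distrib distrib_left
            del: sin_cos_squared_add sin_cos_squared_add2)
      then show ?thesis by (simp add: power_divide)
    qed
    then have "(a\<^sup>2 + (a * cot p)\<^sup>2) powr (3/2) = (a / sin p) ^ 3"
      using powr_three_halves_square[of "a / sin p"] a s by simp
    then have "F (a * cot p) = v p * (sin p) ^ 3 / a ^ 3"
      unfolding F_def using v[of p] p s a by (simp add: power_divide)
    moreover have "\<bar>g' p\<bar> = a / (sin p)\<^sup>2" using a s by (simp add: g'_def abs_mult divide_inverse)
    ultimately have "\<bar>g' p\<bar> * F (a * cot p) = a / (sin p)\<^sup>2 * (v p * (sin p) ^ 3 / a ^ 3)" by (simp only:)
    also have "\<dots> = (1 / (2 * a\<^sup>2)) * (v p * (2 * sin p))"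
      using a s by (simp add: field_simps power2_eq_square power3_eq_cube)
    finally show ?thesis by (simp only: w_def)
  qed
  have i: "set_integrable lborel {0<..<pi/2} (\<lambda>p. \<bar>g' p\<bar> * F (a * cot p))"
  proof -
    have "set_integrable lborel {0<..<pi/2} (\<lambda>p. (1 / (2 * a\<^sup>2)) * w p)" using int1 by (rule set_integrable_mult_right)
    then show ?thesis by (subst set_integrable_cong[OF refl refl jac]) auto
  qed
  have "(LBINT t:(\<lambda>p. a * cot p) ` {0<..<pi/2}. F t) = (LBINT p:{0<..<pi/2}. \<bar>g' p\<bar> * F (a * cot p))"
  proof (rule LBINT_change_of_variables[OF _ _ _ _ Fm i])
    show "inj_on (\<lambda>p. a * cot p) {0<..<pi/2}" using inj_on_cot a by (auto simp: inj_on_def)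
    show "((\<lambda>p. a * cot p) has_field_derivative g' p) (at p)" if "p \<in> {0<..<pi/2}" for p
      using that sin_gt_zero[of p] unfolding g'_def by (intro DERIV_cmult DERIV_cot) auto
  qed (auto simp: cot_image_Ioo[OF a])
  also have "\<dots> = (LBINT p:{0<..<pi/2}. (1 / (2 * a\<^sup>2)) * w p)"
    by (rule set_lebesgue_integral_cong) (use jac in auto)
  also have "\<dots> = (1 / (2 * a\<^sup>2)) * (LBINT p:{0<..<pi/2}. w p)" by (rule set_integral_mult_right)
  finally have "(LBINT t:{0<..}. F t) = (1 / (2 * a\<^sup>2)) * (LBINT p:{0<..<pi/2}. w p)"
    unfolding cot_image_Ioo[OF a] .
  then have "(LBINT p:{0<..<pi/2}. w p) = 2 * a\<^sup>2 * (LBINT t:{0..}. F t)"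
    using a LBINT_Ici_eq_Ioi[OF Fm, of 0] by simp
  with half show ?thesis unfolding w_def F_def by simp
qed

text \<open>Substituting x = 1 + 2a y^2/(1 - y^2) turns (x - 1)(x - 1 + 2a) into the square of
  2ay/(1 - y^2), so the power 3/2 becomes a cube. Together with dx = 4ay/(1 - y^2)^2 dy this leaves
  (1 - y^2)/(2 a^2 y^2).\<close>

lemma LBINT_real_halfline_eq_radius:
  fixes h :: "real \<Rightarrow> real"
  assumes a: "0 < a" and h: "h \<in> borel_measurable borel"
    and v: "\<And>y. y \<in> {0<..<1} \<Longrightarrow> v y = h (1 + 2 * a * y\<^sup>2 / (1 - y\<^sup>2))"
    and int: "set_integrable lborel {0<..<1} (\<lambda>y. v y * ((1 - y\<^sup>2) / y\<^sup>2))"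
  shows "(LBINT y:{0<..<1}. v y * ((1 - y\<^sup>2) / y\<^sup>2)) =
     2 * a\<^sup>2 * (LBINT x:{1..}. h x / ((x - 1) powr (3/2) * (x - 1 + 2 * a) powr (3/2)))"
proof -
  define w where "w = (\<lambda>y. v y * ((1 - y\<^sup>2) / y\<^sup>2))"
  define F where "F = (\<lambda>x. h x / ((x - 1) powr (3/2) * (x - 1 + 2 * a) powr (3/2)))"
  define g where "g = (\<lambda>y::real. 1 + 2 * a * y\<^sup>2 / (1 - y\<^sup>2))"
  define g' where "g' = (\<lambda>y::real. 4 * a * y / (1 - y\<^sup>2)\<^sup>2)"
  have Fm: "F \<in> borel_measurable borel" unfolding F_def using h by measurable
  have sq: "0 < y\<^sup>2" "0 < 1 - y\<^sup>2" if "y \<in> {0<..<1}" for y :: real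
    using that by (auto simp: power_less_one_iff)
  have image: "g ` {0<..<1} = {1<..}"
  proof (intro equalityI subsetI)
    fix x assume "x \<in> g ` {0<..<1}"
    then obtain y where "y \<in> {0<..<1}" "x = g y" by auto
    then show "x \<in> {1<..}" using sq[of y] a by (simp add: g_def)
  next
    fix x :: real assume x: "x \<in> {1<..}"
    define y where "y = sqrt ((x - 1) / (x - 1 + 2 * a))"
    have pos: "0 < x - 1" "0 < x - 1 + 2 * a" using x a by auto
    have y2: "y\<^sup>2 = (x - 1) / (x - 1 + 2 * a)" using pos by (simp add: y_def)
    have "1 - y\<^sup>2 = 2 * a / (x - 1 + 2 * a)" unfolding y2 using pos by (simp add: field_simps)
    then have "2 * a * y\<^sup>2 / (1 - y\<^sup>2) = x - 1" unfolding y2 using pos a by simp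
    moreover have "y \<in> {0<..<1}" using pos a by (auto simp: y_def real_sqrt_lt_1_iff divide_less_eq_1)
    ultimately show "x \<in> g ` {0<..<1}" by (intro image_eqI[of _ _ y]) (auto simp: g_def)
  qed
  have inj: "inj_on g {0<..<1}"
  proof (rule inj_onI)
    fix y z assume yz: "y \<in> {0<..<1}" "z \<in> {0<..<1}" "g y = g z"
    then have "2 * a * y\<^sup>2 / (1 - y\<^sup>2) = 2 * a * z\<^sup>2 / (1 - z\<^sup>2)" by (simp add: g_def)
    then have "y\<^sup>2 = z\<^sup>2" using sq[OF yz(1)] sq[OF yz(2)] a by (simp add: frac_eq_eq algebra_simps)
    then show "y = z" by (rule power2_eq_imp_eq) (use yz in auto)
  qed
  have jac: "\<bar>g' y\<bar> * F (g y) = (1 / (2 * a\<^sup>2)) * w y" if y: "y \<in> {0<..<1}" for y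
  proof -
    define d where "d = 1 - y\<^sup>2"
    have d: "0 < d" and y0: "0 < y" using sq[OF y] y by (auto simp: d_def)
    have e1: "g y - 1 = 2 * a * y\<^sup>2 / d" by (simp add: g_def d_def)
    have e2: "g y - 1 + 2 * a = 2 * a / d" unfolding e1 using d by (simp add: field_simps) (simp add: d_def algebra_simps)
    have "(g y - 1) powr (3/2) * (g y - 1 + 2 * a) powr (3/2) = ((2 * a * y\<^sup>2 / d) * (2 * a / d)) powr (3/2)"
      unfolding e2 unfolding e1 using a d by (subst powr_mult) auto
    also have "(2 * a * y\<^sup>2 / d) * (2 * a / d) = (2 * a * y / d)\<^sup>2" by (simp add: power2_eq_square)
    also have "\<dots> powr (3/2) = (2 * a * y / d) ^ 3" using a d y0 by (intro powr_three_halves_square) auto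
    finally have "F (g y) = v y / (2 * a * y / d) ^ 3" unfolding F_def using v[OF y] by (simp add: g_def)
    moreover have "\<bar>g' y\<bar> = 4 * a * y / d\<^sup>2" using a d y0 by (simp add: g'_def d_def)
    ultimately have "\<bar>g' y\<bar> * F (g y) = 4 * a * y / d\<^sup>2 * (v y / (2 * a * y / d) ^ 3)" by simp
    also have "\<dots> = (1 / (2 * a\<^sup>2)) * (v y * (d / y\<^sup>2))"
      using a d y0 by (simp add: field_simps power2_eq_square power3_eq_cube)
    finally show ?thesis by (simp add: w_def d_def)
  qed
  have i: "set_integrable lborel {0<..<1} (\<lambda>y. \<bar>g' y\<bar> * F (g y))"
  proof -
    have "set_integrable lborel {0<..<1} (\<lambda>p. (1 / (2 * a\<^sup>2)) * w p)"
      using int unfolding w_def[symmetric] by (rule set_integrable_mult_right)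
    then show ?thesis by (subst set_integrable_cong[OF refl refl jac]) auto
  qed
  have "(LBINT x:g ` {0<..<1}. F x) = (LBINT y:{0<..<1}. \<bar>g' y\<bar> * F (g y))"
  proof (rule LBINT_change_of_variables[OF _ _ _ inj Fm i])
    show "(g has_field_derivative g' y) (at y)" if y: "y \<in> {0<..<1}" for y
    proof -
      have nz: "1 - y\<^sup>2 \<noteq> 0" using sq[OF y] by simp
      have "((\<lambda>y. 1 + 2 * a * y\<^sup>2 / (1 - y\<^sup>2)) has_field_derivative
          (2 * a * (2 * y) * (1 - y\<^sup>2) - 2 * a * y\<^sup>2 * (- (2 * y))) / ((1 - y\<^sup>2) * (1 - y\<^sup>2))) (at y)"
        using nz by (auto intro!: derivative_eq_intros)
      also have "(2 * a * (2 * y) * (1 - y\<^sup>2) - 2 * a * y\<^sup>2 * (- (2 * y))) / ((1 - y\<^sup>2) * (1 - y\<^sup>2)) = g' y"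
        unfolding g'_def power2_eq_square[of "1 - y\<^sup>2"] by (simp add: algebra_simps)
      finally show ?thesis unfolding g_def .
    qed
  qed (auto simp: image)
  also have "\<dots> = (LBINT y:{0<..<1}. (1 / (2 * a\<^sup>2)) * w y)"
    by (rule set_lebesgue_integral_cong) (use jac in auto)
  also have "\<dots> = (1 / (2 * a\<^sup>2)) * (LBINT y:{0<..<1}. w y)" by (rule set_integral_mult_right)
  finally have "(LBINT x:{1<..}. F x) = (1 / (2 * a\<^sup>2)) * (LBINT y:{0<..<1}. w y)" unfolding image .
  then have "(LBINT y:{0<..<1}. w y) = 2 * a\<^sup>2 * (LBINT x:{1..}. F x)"
    using a LBINT_Ici_eq_Ioi[OF Fm, of 1] by simp
  then show ?thesis unfolding w_def F_def .
qed

theorem theorem6: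
  fixes \<alpha> :: real
  assumes "0 \<le> \<alpha>" and "\<alpha> < 1/2"
  shows "(LBINT t:{0..}.
            ln (cmod (riemann_zeta (Complex (1/2 + \<alpha>) t) * Complex (-1/2 + \<alpha>) t))
            / (((1/2 - \<alpha>)\<^sup>2 + t\<^sup>2) powr (3/2)))
         = - (LBINT \<sigma>:{1..}.
            ln (Re (riemann_zeta (complex_of_real \<sigma>) * complex_of_real (\<sigma> - 1)))
            / ((\<sigma> - 1) powr (3/2) * (\<sigma> - 2 * \<alpha>) powr (3/2)))
    \<longleftrightarrow> (\<forall>s. 1/2 + \<alpha> < Re s \<and> s \<noteq> 1 \<longrightarrow> riemann_zeta s \<noteq> 0)"
proof -
  define a where "a = 1/2 - \<alpha>"
  have a: "0 < a" "a \<le> 1/2" using assms by (auto simp: a_def)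
  obtain B where B: "\<And>z. cmod z \<le> 1 \<Longrightarrow> z \<noteq> 1 \<Longrightarrow> cmod (zeta_disc a z) \<le> B / (cmod (1 - z))\<^sup>2"
    using zeta_disc_growth[OF a] by blast
  obtain C where C: "\<And>x. 0 \<le> x \<Longrightarrow> x < 1 \<Longrightarrow> \<bar>ln (cmod (zeta_disc a (of_real x)))\<bar> * (1 - x) \<le> C * x"
    using zeta_disc_real_bound[OF a] by blast
  have nz: "zeta_disc a (of_real x) \<noteq> 0" if "0 \<le> x" "x < 1" for x
    using zeta_disc_real(1)[OF a(1) that] by auto
  define K where "K = (LBINT p:{0<..<pi}. ln (cmod (zeta_disc a (cis (2 * p)))) * (2 * sin p)) +
     2 * (LBINT y:{0<..<1}. ln (cmod (zeta_disc a (of_real (y\<^sup>2)))) * ((1 - y\<^sup>2) / y\<^sup>2))"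
  \<comment> \<open>Integrability is carried along because the integral of a non-integrable function
    is 0 by default; both substitutions require it.\<close>
  have K: "set_integrable lborel {0<..<pi} (\<lambda>p. ln (cmod (zeta_disc a (cis (2 * p)))) * (2 * sin p))"
    "set_integrable lborel {0<..<1} (\<lambda>y. ln (cmod (zeta_disc a (of_real (y\<^sup>2)))) * ((1 - y\<^sup>2) / y\<^sup>2))"
    "K = 0 \<longleftrightarrow> (\<forall>z\<in>ball 0 1. zeta_disc a z \<noteq> 0)"
    unfolding K_def using disc_formula[OF holomorphic_zeta_disc zeta_disc_0 B nz C] by blast+
  define h where "h = (\<lambda>t. ln (cmod (zeta_entire (Complex (1 - a) t))))"
  define k where "k = (\<lambda>x::real. ln (cmod (zeta_entire (of_real x))))"
  have cont: "continuous_on UNIV zeta_entire"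
    by (rule holomorphic_on_imp_continuous_on[OF holomorphic_zeta_entire])
  have hm: "h \<in> borel_measurable borel"
    unfolding h_def Complex_eq
    by (intro borel_measurable_ln borel_measurable_continuous_onI continuous_intros continuous_on_compose2[OF cont]) auto
  have km: "k \<in> borel_measurable borel"
    unfolding k_def
    by (intro borel_measurable_ln borel_measurable_continuous_onI continuous_intros continuous_on_compose2[OF cont]) auto
  have "(LBINT p:{0<..<pi}. ln (cmod (zeta_disc a (cis (2 * p)))) * (2 * sin p)) =
      4 * a\<^sup>2 * (LBINT t:{0..}. h t / (a\<^sup>2 + t\<^sup>2) powr (3/2))"
  proof (rule LBINT_halfline_eq_arc[OF a(1) hm _ _ K(1)])
    fix p :: real assume "p \<in> {0<..<pi}"
    then have "sin p \<noteq> 0" using sin_gt_zero[of p] by auto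
    then show "ln (cmod (zeta_disc a (cis (2 * p)))) = h (a * cot p)"
      by (simp add: zeta_disc_def disc_to_halfplane_cis h_def)
  next
    fix p :: real
    have "cis (2 * (pi - p)) = cnj (cis (2 * p))"
      by (simp add: complex_eq_iff right_diff_distrib cos_diff sin_diff)
    then show "ln (cmod (zeta_disc a (cis (2 * (pi - p))))) = ln (cmod (zeta_disc a (cis (2 * p))))"
      by (simp add: zeta_disc_cnj)
  qed
  moreover have "(LBINT y:{0<..<1}. ln (cmod (zeta_disc a (of_real (y\<^sup>2)))) * ((1 - y\<^sup>2) / y\<^sup>2)) =
      2 * a\<^sup>2 * (LBINT x:{1..}. k x / ((x - 1) powr (3/2) * (x - 1 + 2 * a) powr (3/2)))"
    by (rule LBINT_real_halfline_eq_radius[OF a(1) km _ K(2)])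
      (simp only: zeta_disc_def disc_to_halfplane_of_real k_def)
  \<comment> \<open>The radial integral counts twice in \<open>K\<close>, so both parts carry the
    same nonzero factor 4a^2.\<close>
  ultimately have "4 * a\<^sup>2 * ((LBINT t:{0..}. h t / (a\<^sup>2 + t\<^sup>2) powr (3/2)) +
      (LBINT x:{1..}. k x / ((x - 1) powr (3/2) * (x - 1 + 2 * a) powr (3/2)))) = K"
    unfolding K_def by (simp add: algebra_simps)
  then have K0: "K = 0 \<longleftrightarrow> (LBINT t:{0..}. h t / (a\<^sup>2 + t\<^sup>2) powr (3/2)) =
      - (LBINT x:{1..}. k x / ((x - 1) powr (3/2) * (x - 1 + 2 * a) powr (3/2)))"
    using a(1) by (auto simp: eq_neg_iff_add_eq_0)
  have L: "ln (cmod (riemann_zeta (Complex (1/2 + \<alpha>) t) * Complex (-1/2 + \<alpha>) t))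
            / (((1/2 - \<alpha>)\<^sup>2 + t\<^sup>2) powr (3/2)) = h t / (a\<^sup>2 + t\<^sup>2) powr (3/2)" for t
  proof -
    have "Complex (1/2 + \<alpha>) t - 1 = Complex (-1/2 + \<alpha>) t" by (simp add: complex_eq_iff)
    moreover have "Complex (-1/2 + \<alpha>) t \<noteq> 0" using assms by (simp add: complex_eq_iff)
    ultimately have "riemann_zeta (Complex (1/2 + \<alpha>) t) * Complex (-1/2 + \<alpha>) t = zeta_entire (Complex (1/2 + \<alpha>) t)"
      by (simp add: riemann_zeta_eq)
    moreover have "1/2 + \<alpha> = 1 - a" by (simp add: a_def)
    ultimately show ?thesis by (simp only: h_def a_def)
  qed
  have R: "(LBINT \<sigma>:{1..}. ln (Re (riemann_zeta (complex_of_real \<sigma>) * complex_of_real (\<sigma> - 1)))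
            / ((\<sigma> - 1) powr (3/2) * (\<sigma> - 2 * \<alpha>) powr (3/2))) =
      (LBINT x:{1..}. k x / ((x - 1) powr (3/2) * (x - 1 + 2 * a) powr (3/2)))"
  proof (rule set_lebesgue_integral_cong)
    have "ln (Re (riemann_zeta (of_real x) * of_real (x - 1)))
            / ((x - 1) powr (3/2) * (x - 2 * \<alpha>) powr (3/2)) =
          k x / ((x - 1) powr (3/2) * (x - 1 + 2 * a) powr (3/2))" if "1 \<le> x" for x
    proof (cases "x = 1")
      case False
      then have "of_real x - 1 \<noteq> (0::complex)" by simp
      then have "riemann_zeta (of_real x) * of_real (x - 1) = zeta_entire (of_real x)"
        by (simp add: riemann_zeta_eq)
      moreover have "x - 2 * \<alpha> = x - 1 + 2 * a" by (simp add: a_def)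
      ultimately show ?thesis unfolding k_def norm_zeta_entire_of_real[OF that] by (simp only:)
    \<comment> \<open>At x = 1 both denominators contain 0 powr (3/2) = 0, so both quotients are 0
      by convention.\<close>
    qed auto
    then show "\<forall>x. x \<in> {1..} \<longrightarrow> ln (Re (riemann_zeta (of_real x) * of_real (x - 1)))
            / ((x - 1) powr (3/2) * (x - 2 * \<alpha>) powr (3/2)) =
          k x / ((x - 1) powr (3/2) * (x - 1 + 2 * a) powr (3/2))" by auto
  qed auto
  have "1/2 + \<alpha> = 1 - a" by (simp add: a_def)
  then show ?thesis
    unfolding L R K0[symmetric] K(3) zeta_disc_zeros_iff[OF a(1)] by (simp only:)
qed

end
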